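(* Let $\Gamma\subset\mathbb{C}$ be a rectifiable curve homeomorphic to a line segment, and let $p:\Gamma\to(1,\infty)$ be a continuous function for which there is a constant $A_\Gamma>0$ such that $$|p(\tau)-p(t)|\le \frac{-A_\Gamma}{\log|\tau-t|}\quad\text{whenever } \tau,t\in\Gamma,\ |\tau-t|\le \tfrac12 .$$ Let $t_1,\dots,t_n\in\Gamma$ be pairwise distinct points, let $w_1,\dots,w_n\in\mathbb{W}$, and let the weight $w$ be given by $$w(t)=\prod_{k=1}^n w_k(|t-t_k|),\quad t\in\Gamma .$$ (1) If the Cauchy singular integral operator $S$ is bounded on $L^{p(\cdot)}(\Gamma,w)$, then $\Gamma$ is a Carleson curve and $$0\le \frac1{p(t_k)}+m(w_k),\qquad \frac1{p(t_k)}+M(w_k)\le 1\qquad\text{for all } k\in\{1,\dots,n\}.$$ (2) Moreover, if there exists an $\varepsilon_0>0$ such that $S$ is bounded on $L^{p(\cdot)}(\Gamma,w^{1+\varepsilon})$ for all $\varepsilon\in(-\varepsilon_0,\varepsilon_0)$, then $$0< \frac1{p(t_k)}+m(w_k),\qquad \frac1{p(t_k)}+M(w_k)< 1\qquad\text{for all } k\in\{1,\dots,n\}.$$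
   Context: A rectifiable curve $\Gamma\subset\mathbb{C}$ is equipped with Lebesgue length measure $|d\tau|$; $|\Omega|$ denotes the length measure of a measurable set $\Omega\subset\Gamma$. For $t\in\Gamma$ and $R>0$ put $\Gamma(t,R):=\{\tau\in\Gamma:|\tau-t|<R\}$. The curve $\Gamma$ is a Carleson curve if $$\sup_{t\in\Gamma}\sup_{R>0}\frac{|\Gamma(t,R)|}{R}<\infty.$$ Cauchy singular integral: $$(Sf)(t):=\frac1{\pi i}\int_\Gamma\frac{f(\tau)}{\tau-t}\,d\tau:=\frac{1}{\pi i}\lim_{R\to0}\int_{\Gamma\setminus\Gamma(t,R)}\frac{f(\tau)}{\tau-t}\,d\tau\quad(t\in\Gamma)$$ (principal value). A weight on $\Gamma$ is a measurable function $w:\Gamma\to[0,\infty]$ with $0<w(\tau)<\infty$ for almost all $\tau\in\Gamma$. The weighted variable Lebesgue space $L^{p(\cdot)}(\Gamma,w)$ is the Banach space of all measurable $f:\Gamma\to\mathbb{C}$ (modulo equality a.e.) such that $\int_\Gamma|f(\tau)w(\tau)/\lambda|^{p(\tau)}|d\tau|<\infty$ for some $\lambda=\lambda(f)>0$, with norm $$\|f\|_{p(\cdot),w}:=\inf\Big\{\lambda>0:\int_\Gamma|f(\tau)w(\tau)/\lambda|^{p(\tau)}|d\tau|\le1\Big\}.$$ "$S$ is bounded on $L^{p(\cdot)}(\Gamma,w)$" means that for every $f\in L^{p(\cdot)}(\Gamma,w)$ the principal value $(Sf)(t)$ exists for almost all $t\in\Gamma$, and there is a constant $C<\infty$ with $\|Sf\|_{p(\cdot),w}\le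 C\|f\|_{p(\cdot),w}$ for all such $f$. The class $W$ consists of all continuous functions $\varrho:[0,|\Gamma|]\to[0,\infty)$ such that $\varrho(0)=0$, $\varrho(x)>0$ for $0<x\le|\Gamma|$, and $\varrho$ is almost increasing, i.e. there is a constant $C>0$ such that $\varrho(x)\le C\varrho(y)$ whenever $x\le y$. The class $\mathbb{W}$ consists of all functions $\varrho:[0,|\Gamma|]\to[0,\infty]$ such that $x^\alpha\varrho(x)\in W$ and $x^\beta/\varrho(x)\in W$ for some $\alpha,\beta\in\mathbb{R}$ (the values of these two products at $x=0$ being understood as their limits as $x\to0^+$, so that e.g. $x^\gamma\in\mathbb{W}$ for every $\gamma\in\mathbb{R}$). For $\varrho\in\mathbb{W}$ put $$\Phi^0_\varrho(x):=\limsup_{y\to0}\frac{\varrho(xy)}{\varrho(y)},\quad x\in(0,\infty)$$ (with $y>0$). The limits $$m(\varrho):=\lim_{x\to0}\frac{\log\Phi^0_\varrho(x)}{\log x},\qquad M(\varrho):=\lim_{x\to\infty}\frac{\log\Phi^0_\varrho(x)}{\log x}$$ exist and satisfy $-\infty<m(\varrho)\le M(\varrho)<+\infty$; they are called the lower and upper Matuszewska–Orlicz indices of $\varrho$. *)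

theory Defs
  imports "HOL-Analysis.Analysis"
begin

(* A rectifiable curve homeomorphic to a segment is the image Gamma = path_image g of an
   arc g (HOL-Analysis: continuous and injective on {0..1}) of finite length.  Length, length
   measure and d tau are obtained from g by passing to the arc-length parametrization; another
   arc with the same image gives the same length measure and at most changes the sign of d tau. *)

definition arc_len :: "(real \<Rightarrow> complex) \<Rightarrow> real \<Rightarrow> real \<Rightarrow> ennreal" where
  "arc_len g a b = (SUP xs \<in> {xs. sorted xs \<and> set xs \<subseteq> {a..b}}.
     ennreal (\<Sum>i<length xs - 1. cmod (g (xs ! Suc i) - g (xs ! i))))"

definition rectifiable_arc :: "(real \<Rightarrow> complex) \<Rightarrow> bool" where
  "rectifiable_arc g \<longleftrightarrow> arc g \<and> arc_len g 0 1 < \<infinity>"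

definition curve_length :: "(real \<Rightarrow> complex) \<Rightarrow> real" where
  "curve_length g = enn2real (arc_len g 0 1)"

(* On {0..1} the map x |-> length of g restricted to {0..x} is a strictly increasing
   bijection onto {0..curve_length g}; only these arguments s are meaningful below. *)
definition arclength_param :: "(real \<Rightarrow> complex) \<Rightarrow> real \<Rightarrow> complex" where
  "arclength_param g s = g (inv_into {0..1} (\<lambda>x. enn2real (arc_len g 0 x)) s)"

(* The measure |d tau|: its space is the curve itself and, being complete, its measurable
   sets and functions are the Lebesgue measurable ones. *)
definition length_measure :: "(real \<Rightarrow> complex) \<Rightarrow> complex measure" where
  "length_measure g =
     completion (distr (restrict_space lborel {0..curve_length g})
                       (restrict_space borel (path_image g))
                       (arclength_param g))"

definition portion :: "(real \<Rightarrow> complex) \<Rightarrow> complex \<Rightarrow> real \<Rightarrow> complex set" where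
  "portion g t R = {\<tau> \<in> path_image g. cmod (\<tau> - t) < R}"

definition carleson_curve :: "(real \<Rightarrow> complex) \<Rightarrow> bool" where
  "carleson_curve g \<longleftrightarrow>
     (SUP t \<in> path_image g. SUP R \<in> {0<..}.
        emeasure (length_measure g) (portion g t R) / ennreal R) < \<infinity>"

(* d tau = gamma'(s) ds for the arc-length parametrization gamma, which is Lipschitz and hence
   differentiable almost everywhere. *)
definition dtau_integrable :: "(real \<Rightarrow> complex) \<Rightarrow> complex set \<Rightarrow> (complex \<Rightarrow> complex) \<Rightarrow> bool" where
  "dtau_integrable g \<Omega> h \<longleftrightarrow>
     set_integrable lebesgue {s \<in> {0..curve_length g}. arclength_param g s \<in> \<Omega>}
       (\<lambda>s. h (arclength_param g s) *
            vector_derivative (arclength_param g) (at s within {0..curve_length g}))"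

definition dtau_integral :: "(real \<Rightarrow> complex) \<Rightarrow> complex set \<Rightarrow> (complex \<Rightarrow> complex) \<Rightarrow> complex" where
  "dtau_integral g \<Omega> h =
     (LINT s : {s \<in> {0..curve_length g}. arclength_param g s \<in> \<Omega>} | lebesgue.
        h (arclength_param g s) *
        vector_derivative (arclength_param g) (at s within {0..curve_length g}))"

definition truncated_cauchy ::
  "(real \<Rightarrow> complex) \<Rightarrow> (complex \<Rightarrow> complex) \<Rightarrow> complex \<Rightarrow> real \<Rightarrow> complex" where
  "truncated_cauchy g f t R =
     1 / (complex_of_real pi * \<i>) *
       dtau_integral g (path_image g - portion g t R) (\<lambda>\<tau>. f \<tau> / (\<tau> - t))"

(* The Bochner integral of a non-integrable function is 0 by convention, so integrability of
   the truncated integrands has to be demanded explicitly. *)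
definition cauchy_pv_exists :: "(real \<Rightarrow> complex) \<Rightarrow> (complex \<Rightarrow> complex) \<Rightarrow> complex \<Rightarrow> bool" where
  "cauchy_pv_exists g f t \<longleftrightarrow>
     (\<forall>R>0. dtau_integrable g (path_image g - portion g t R) (\<lambda>\<tau>. f \<tau> / (\<tau> - t))) \<and>
     (\<exists>l. (truncated_cauchy g f t \<longlongrightarrow> l) (at_right 0))"

definition cauchy_S :: "(real \<Rightarrow> complex) \<Rightarrow> (complex \<Rightarrow> complex) \<Rightarrow> complex \<Rightarrow> complex" where
  "cauchy_S g f t = Lim (at_right 0) (truncated_cauchy g f t)"

(* Real powers on [0, \<infinity>]. *)
definition epowr :: "ennreal \<Rightarrow> real \<Rightarrow> ennreal" where
  "epowr x a =
     (if a = 0 then 1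
      else if x = 0 then (if a > 0 then 0 else \<infinity>)
      else if x = \<infinity> then (if a > 0 then \<infinity> else 0)
      else ennreal (enn2real x powr a))"

definition modular ::
  "(real \<Rightarrow> complex) \<Rightarrow> (complex \<Rightarrow> real) \<Rightarrow> (complex \<Rightarrow> ennreal) \<Rightarrow> (complex \<Rightarrow> complex) \<Rightarrow> real \<Rightarrow> ennreal"
  where
  "modular g p w f lam =
     (\<integral>\<^sup>+ \<tau>. epowr (ennreal (cmod (f \<tau>)) * w \<tau> / ennreal lam) (p \<tau>) \<partial>length_measure g)"

(* Represented by functions rather than by classes modulo equality a.e.; modular, norm and
   (where it exists) the principal value depend only on the class. *)
definition var_Lp ::
  "(real \<Rightarrow> complex) \<Rightarrow> (complex \<Rightarrow> real) \<Rightarrow> (complex \<Rightarrow> ennreal) \<Rightarrow> (complex \<Rightarrow> complex) set" where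
  "var_Lp g p w =
     {f \<in> borel_measurable (length_measure g). \<exists>lam>0. modular g p w f lam < \<infinity>}"

definition var_norm ::
  "(real \<Rightarrow> complex) \<Rightarrow> (complex \<Rightarrow> real) \<Rightarrow> (complex \<Rightarrow> ennreal) \<Rightarrow> (complex \<Rightarrow> complex) \<Rightarrow> real" where
  "var_norm g p w f = Inf {lam. lam > 0 \<and> modular g p w f lam \<le> 1}"

(* Membership of Sf in the space expresses that its norm is finite; the real infimum of an
   empty set would not. *)
definition S_bounded ::
  "(real \<Rightarrow> complex) \<Rightarrow> (complex \<Rightarrow> real) \<Rightarrow> (complex \<Rightarrow> ennreal) \<Rightarrow> bool" where
  "S_bounded g p w \<longleftrightarrow>
     (\<forall>f \<in> var_Lp g p w. AE t in length_measure g. cauchy_pv_exists g f t) \<and>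
     (\<exists>C::real. \<forall>f \<in> var_Lp g p w.
        cauchy_S g f \<in> var_Lp g p w \<and> var_norm g p w (cauchy_S g f) \<le> C * var_norm g p w f)"

(* L plays the role of the length of the curve; functions on [0, L] are functions on the
   reals of which only the values on {0..L} matter. *)
definition class_W :: "real \<Rightarrow> (real \<Rightarrow> real) set" where
  "class_W L =
     {\<rho>. continuous_on {0..L} \<rho> \<and> \<rho> 0 = 0 \<and> (\<forall>x\<in>{0<..L}. \<rho> x > 0) \<and>
         (\<exists>C>0. \<forall>x\<in>{0..L}. \<forall>y\<in>{0..L}. x \<le> y \<longrightarrow> \<rho> x \<le> C * \<rho> y)}"

(* The products are prescribed for x > 0 only: continuity of u and v on {0..L} then makes
   their values at 0 the limits of the products. *)
definition class_WW :: "real \<Rightarrow> (real \<Rightarrow> ennreal) set" where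
  "class_WW L =
     {\<rho>. \<exists>\<alpha> \<beta>. \<exists>u \<in> class_W L. \<exists>v \<in> class_W L. \<forall>x\<in>{0<..L}.
         ennreal (x powr \<alpha>) * \<rho> x = ennreal (u x) \<and>
         ennreal (x powr \<beta>) / \<rho> x = ennreal (v x)}"

definition Phi0 :: "(real \<Rightarrow> ennreal) \<Rightarrow> real \<Rightarrow> ennreal" where
  "Phi0 \<rho> x = Limsup (at_right 0) (\<lambda>y. \<rho> (x * y) / \<rho> y)"

(* For \<rho> in class_WW the value Phi0 \<rho> x (x > 0) is positive and finite, so enn2real is
   harmless. *)
definition mo_lower :: "(real \<Rightarrow> ennreal) \<Rightarrow> real" where
  "mo_lower \<rho> = Lim (at_right 0) (\<lambda>x. ln (enn2real (Phi0 \<rho> x)) / ln x)"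

definition mo_upper :: "(real \<Rightarrow> ennreal) \<Rightarrow> real" where
  "mo_upper \<rho> = Lim at_top (\<lambda>x. ln (enn2real (Phi0 \<rho> x)) / ln x)"

end

theory Submission
  imports Defs
begin

text \<open>
  Boundedness of the Cauchy integral operator \<open>S\<close> is used only through one test-function argument.
  Let \<open>E\<close> lie in the disc of radius \<open>R/4\<close> around \<open>t\<^sub>0\<close> and \<open>F\<close> in the annulus between the radii \<open>R\<close> and
  \<open>2R\<close>. For \<open>\<tau>\<close> in one of the two sets and \<open>s\<close> in the other, the kernel \<open>1/(\<tau> - s)\<close> has size about
  \<open>1/R\<close> and, up to a unimodular factor that depends on \<open>s\<close> alone or on \<open>\<tau>\<close> alone, its real part has
  that size too. Multiplying the indicator of \<open>E\<close> by the conjugate of the unit tangent turns \<open>d\<tau>\<close> into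
  length measure, so that the resulting \<open>f\<close> satisfies \<open>\<bar>f\<bar> \<le> 1\<^sub>E\<close> and \<open>\<bar>S f\<bar> \<ge> c |E| / R\<close> on \<open>F\<close>, and
  the roles of \<open>E\<close> and \<open>F\<close> can be exchanged. Hence boundedness of \<open>S\<close> gives
  \<open>|E| \<parallel>1\<^sub>F\<parallel> \<le> C R \<parallel>1\<^sub>E\<parallel>\<close> and \<open>|F| \<parallel>1\<^sub>E\<parallel> \<le> C R \<parallel>1\<^sub>F\<parallel>\<close>
  (\<open>near_far_transfer\<close>; the norms are handled through the modular).

  Three consequences follow. First, multiplying both inequalities gives \<open>|E| |F| \<le> C\<^sup>2 R\<^sup>2\<close>; since a
  connected curve has length at least \<open>R\<close> in the annulus, the curve is Carleson (\<open>carleson_bound\<close>).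
  Secondly, in the annulus of radius \<open>R\<close> around \<open>t\<^sub>k\<close> the weight is comparable to \<open>w\<^sub>k(R)\<close>, and the
  local log-Hoelder condition makes \<open>R\<close> to the power \<open>p(\<tau>)\<close> comparable to \<open>R\<close> to the power \<open>p(t\<^sub>k)\<close>;
  so the indicator of the annulus has norm about \<open>N(R) = w\<^sub>k(R) R\<^bsup>1/p\<^esup>\<close> with \<open>p = p(t\<^sub>k)\<close>, and the two
  inequalities for annuli of radii \<open>r\<close> and \<open>R\<close> read \<open>N(r) \<le> C N(R)\<close> and \<open>N(R) \<le> C (R/r) N(r)\<close>
  whenever \<open>8 r \<le> R\<close> (\<open>local_scaling\<close>). These are power bounds for \<open>\<Phi>\<^sup>0\<close> and thus the non-strict
  index inequalities. Thirdly, the same bounds for the weight raised to a power \<open>\<theta> > 1\<close> have \<open>\<theta> m\<close> and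
  \<open>\<theta> M\<close> in place of the indices \<open>m\<close> and \<open>M\<close> (\<open>index_bounds\<close>), and this makes the inequalities
  strict.

  Two classical facts are established on the way: a rectifiable arc parametrized by arc length has a
  derivative of modulus one almost everywhere (\<open>unit_speed_derivative\<close>), which rests on the Vitali
  covering theorem and the Radon--Nikodym theorem; and the limits that define the indices exist,
  which is Fekete's subadditivity argument applied to \<open>ln \<Phi>\<^sup>0(exp s)\<close>.
\<close>

section \<open>Differentiation almost everywhere on the line\<close>

text \<open>A measure that vanishes on \<open>G\<close> has upper density \<open>0\<close> at almost every point of \<open>G\<close>: an open set around
\<open>G\<close> of small \<open>M\<close>-measure contains a disjoint Vitali cover of the exceptional points by intervals whose
lengths are controlled by their \<open>M\<close>-measures.\<close>

lemma negligible_points_of_large_ratio: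
  fixes M :: "real measure"
  assumes M: "finite_measure M" "sets M = sets borel"
    and G: "G \<in> sets borel" "emeasure M G = 0" and c: "0 < c"
  shows "negligible {x\<in>G. \<forall>d>0. \<exists>a r. 0 < r \<and> r < d \<and> x \<in> cball a r \<and> c * r < measure M (cball a r)}"
    (is "negligible ?B")
proof (rule negligible_outer_le[THEN iffD2], intro allI impI)
  fix e :: real assume e: "0 < e"
  interpret finite_measure M by fact
  have "0 = emeasure M G" using G by simp
  also have "\<dots> = (INF U\<in>{U. G \<subseteq> U \<and> open U}. emeasure M U)"
    by (rule outer_regular) (use M G emeasure_finite in auto)
  finally have "(INF U\<in>{U. G \<subseteq> U \<and> open U}. emeasure M U) < ennreal (c * e / 2)"
    using c e by simp
  then obtain U where U: "G \<subseteq> U" "open U" "emeasure M U < ennreal (c * e / 2)"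
    by (auto simp: INF_less_iff)
  define K where "K = {(a, r). 0 < r \<and> cball a r \<subseteq> U \<and> c * r < measure M (cball a r)}"
  have cover: "\<exists>i. i \<in> K \<and> x \<in> cball (fst i) (snd i) \<and> snd i < d" if x: "x \<in> ?B" and d: "0 < d" for x d
  proof -
    obtain \<delta> where \<delta>: "0 < \<delta>" "ball x \<delta> \<subseteq> U" using U x open_contains_ball by blast
    then obtain a r where ar: "0 < r" "r < min d (\<delta> / 2)" "x \<in> cball a r" "c * r < measure M (cball a r)"
      using x d by (smt (verit, best) half_gt_zero_iff mem_Collect_eq)
    have "cball a r \<subseteq> ball x \<delta>"
    proof
      fix y assume "y \<in> cball a r"
      then have "dist x y \<le> 2 * r" using ar(3) dist_triangle[of x y a] by (simp add: dist_commute)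
      then show "y \<in> ball x \<delta>" using ar(2) by simp
    qed
    then show ?thesis using ar \<delta> by (intro exI[of _ "(a, r)"]) (auto simp: K_def)
  qed
  have radius: "0 < snd i" if "i \<in> K" for i using that by (auto simp: K_def)
  obtain C where C: "countable C" "C \<subseteq> K"
     "pairwise (\<lambda>i j. disjnt (cball (fst i) (snd i)) (cball (fst j) (snd j))) C"
     "negligible (?B - (\<Union>i \<in> C. cball (fst i) (snd i)))"
    by (rule Vitali_covering_theorem_cballs[of K snd ?B fst, OF radius cover]) blast
  \<comment> \<open>On the selected disjoint intervals length is at most \<open>2 / c\<close> times \<open>M\<close>, hence at most
    \<open>2 / c * M U < e\<close> in total.\<close>
  define V where "V = (\<Union>i \<in> C. cball (fst i) (snd i))"
  have V: "V \<in> sets borel" unfolding V_def by (intro sets.countable_UN' C(1)) auto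
  have disj: "disjoint_family_on (\<lambda>i. cball (fst i) (snd i)) C"
    using C(3) by (auto simp: disjoint_family_on_def pairwise_def disjnt_def)
  have "emeasure lborel V = (\<integral>\<^sup>+ i. emeasure lborel (cball (fst i) (snd i)) \<partial>count_space C)"
    unfolding V_def by (rule emeasure_UN_countable) (use C(1) disj in auto)
  also have "\<dots> \<le> (\<integral>\<^sup>+ i. ennreal (2 / c) * emeasure M (cball (fst i) (snd i)) \<partial>count_space C)"
  proof (rule nn_integral_mono, simp)
    fix i assume "i \<in> C"
    then have i: "0 < snd i" "c * snd i < measure M (cball (fst i) (snd i))" using C(2) by (auto simp: K_def)
    have "emeasure lborel (cball (fst i) (snd i)) = ennreal (2 * snd i)"
      using i by (simp add: cball_eq_atLeastAtMost)
    also have "\<dots> \<le> ennreal (2 / c * measure M (cball (fst i) (snd i)))"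
      using i c by (intro ennreal_leI) (simp add: field_simps)
    also have "\<dots> = ennreal (2 / c) * emeasure M (cball (fst i) (snd i))"
      unfolding emeasure_eq_measure using c by (subst ennreal_mult[symmetric]) auto
    finally show "emeasure lborel (cball (fst i) (snd i)) \<le> ennreal (2 / c) * emeasure M (cball (fst i) (snd i))" .
  qed
  also have "\<dots> = ennreal (2 / c) * emeasure M V"
    unfolding V_def by (subst emeasure_UN_countable) (use C(1) disj M in \<open>auto simp: nn_integral_cmult\<close>)
  also have "\<dots> \<le> ennreal (2 / c) * ennreal (c * e / 2)"
  proof (intro mult_left_mono order.trans[OF emeasure_mono less_imp_le[OF U(3)]])
    have "cball (fst i) (snd i) \<subseteq> U" if "i \<in> C" for i
    proof -
      have "i \<in> K" using that C(2) by blast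
      then show ?thesis by (simp add: K_def case_prod_beta)
    qed
    then show "V \<subseteq> U" unfolding V_def by blast
  qed (use U M in auto)
  also have "\<dots> = ennreal e" using c e by (simp flip: ennreal_mult)
  finally have Ve: "emeasure lborel V \<le> ennreal e" .
  have Vm: "V \<in> lmeasurable" "measure lebesgue V \<le> e"
  proof -
    have "emeasure lebesgue V \<le> ennreal e" using Ve V by simp
    then show "V \<in> lmeasurable" "measure lebesgue V \<le> e" using V e
      by (auto simp: fmeasurable_def measure_def enn2real_leI order.strict_trans1)
  qed
  have N: "negligible (?B - V)" using C(4) by (simp add: V_def)
  show "\<exists>T. ?B \<subseteq> T \<and> T \<in> lmeasurable \<and> measure lebesgue T \<le> e"
  proof (intro exI[of _ "(?B - V) \<union> V"] conjI)
    show "?B \<subseteq> (?B - V) \<union> V" by blast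
    show "(?B - V) \<union> V \<in> lmeasurable" by (intro fmeasurable.Un negligible_imp_measurable N Vm)
    have "measure lebesgue ((?B - V) \<union> V) \<le> measure lebesgue (?B - V) + measure lebesgue V"
      by (intro measure_Un_le fmeasurableD negligible_imp_measurable N Vm)
    then show "measure lebesgue ((?B - V) \<union> V) \<le> e"
      using Vm(2) negligible_imp_measure0[OF N] by linarith
  qed
qed

text \<open>Lebesgue's differentiation theorem. For \<open>z\<close> in a countable dense set and \<open>q > 0\<close>, the measure with
density \<open>max 0 (\<bar>f - z\<bar> - q)\<close> vanishes where \<open>\<bar>f - z\<bar> \<le> q\<close>, so by the preceding lemma the average
of \<open>\<bar>f - z\<bar>\<close> over short intervals around almost every such point is not much larger than \<open>q\<close>.
Choosing \<open>z\<close> within \<open>q\<close> of \<open>f x\<close> gives the derivative at \<open>x\<close>.\<close>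

lemma AE_has_vector_derivative_indefinite_integral:
  fixes f F :: "real \<Rightarrow> complex"
  assumes f: "integrable lborel f"
    and F: "\<And>a b. a \<le> b \<Longrightarrow> F b - F a = (LINT x:{a..b}|lborel. f x)"
  shows "AE x in lborel. (F has_vector_derivative f x) (at x)"
proof -
  have fm [measurable]: "f \<in> borel_measurable borel" using f by (simp add: borel_measurable_integrable)
  obtain D :: "complex set" where D: "countable D" "\<And>X. open X \<Longrightarrow> X \<noteq> {} \<Longrightarrow> \<exists>d\<in>D. d \<in> X"
    using countable_dense_exists by metis
  \<comment> \<open>The cut-off to \<open>{- n..n}\<close> makes \<open>u\<close> integrable for every \<open>z\<close>.\<close>
  define u where "u z q n x = max 0 (cmod (f x - z) - q) * indicator {- real n..real n} x" for z q n x
  define M where "M z q n = density lborel (\<lambda>x. ennreal (u z q n x))" for z q n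
  define B where "B z q n = {x\<in>{x. cmod (f x - z) \<le> q}. \<forall>d>0. \<exists>a r. 0 < r \<and> r < d \<and> x \<in> cball a r \<and>
       q * r < measure (M z q n) (cball a r)}" for z q n
  have um [measurable]: "u z q n \<in> borel_measurable borel" for z q n unfolding u_def by measurable
  have ui: "integrable lborel (u z q n)" if "0 < q" for z q n
  proof (rule Bochner_Integration.integrable_bound)
    show "integrable lborel (\<lambda>x. cmod (f x) + cmod z * indicator {- real n..real n} x)"
      using f by (intro Bochner_Integration.integrable_add integrable_norm integrable_mult_right) auto
    show "AE x in lborel. norm (u z q n x) \<le> norm (cmod (f x) + cmod z * indicator {- real n..real n} x)"
    proof (intro AE_I2)
      fix x show "norm (u z q n x) \<le> norm (cmod (f x) + cmod z * indicator {- real n..real n} x)"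
        using norm_triangle_ineq4[of "f x" z] that by (auto simp: u_def indicator_def)
    qed
  qed auto
  have Mcb: "measure (M z q n) A = (LINT x:A|lborel. u z q n x)" if "A \<in> sets borel" "0 < q" for z q n A
    unfolding M_def measure_def using that ui[OF that(2)]
    by (subst emeasure_density)
       (auto simp: set_lebesgue_integral_def integral_eq_nn_integral u_def indicator_def
          intro!: arg_cong[where f=enn2real] nn_integral_cong)
  have "negligible (B z q n)" if "0 < q" for z q n
    unfolding B_def
  proof (rule negligible_points_of_large_ratio)
    show "finite_measure (M z q n)"
    proof
      show "emeasure (M z q n) (space (M z q n)) \<noteq> \<infinity>"
        using ui[OF that, of z n] unfolding M_def
        by (subst emeasure_density) (auto simp: integrable_iff_bounded u_def less_top)
    qed
    show "emeasure (M z q n) {x. cmod (f x - z) \<le> q} = 0"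
      unfolding M_def by (subst emeasure_density)
        (auto simp: nn_integral_0_iff_AE u_def indicator_def)
  qed (use that in \<open>auto simp: M_def\<close>)
  then have "negligible (\<Union>z\<in>D. \<Union>m. \<Union>n. B z (inverse (real (Suc m))) n)"
    using D(1) by (auto intro!: negligible_countable_Union)
  then have "AE x in lebesgue. x \<notin> (\<Union>z\<in>D. \<Union>m. \<Union>n. B z (inverse (real (Suc m))) n)"
    by (metis AE_not_in negligible_iff_null_sets)
  moreover have "(F has_vector_derivative f x) (at x)"
    if x: "x \<notin> (\<Union>z\<in>D. \<Union>m. \<Union>n. B z (inverse (real (Suc m))) n)" for x
  proof -
    have key: "\<exists>d>0. \<forall>a b. a \<le> x \<and> x \<le> b \<and> b - a < d \<longrightarrow>
        cmod (F b - F a - (b - a) *\<^sub>R f x) \<le> e * (b - a)" if e: "0 < e" for e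
    proof -
      obtain m where m: "inverse (real (Suc m)) < e / 3" using reals_Archimedean[of "e/3"] e by auto
      define q where "q = inverse (real (Suc m))"
      have q: "0 < q" "q < e / 3" using m by (auto simp: q_def)
      obtain z where z: "z \<in> D" "z \<in> ball (f x) q" using D(2)[of "ball (f x) q"] q by auto
      define n where "n = nat \<lceil>\<bar>x\<bar> + 1\<rceil>"
      have n: "\<bar>x\<bar> + 1 \<le> real n" unfolding n_def by linarith
      have "x \<notin> B z q n" using x z(1) unfolding q_def by blast
      moreover have "cmod (f x - z) \<le> q" using z by (simp add: dist_norm)
      ultimately obtain d where d: "0 < d" "\<And>a r. 0 < r \<Longrightarrow> r < d \<Longrightarrow> x \<in> cball a r \<Longrightarrow>
          measure (M z q n) (cball a r) \<le> q * r" by (force simp: B_def not_less)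
      show ?thesis
      proof (intro exI[of _ "min d 1"] conjI allI impI)
        fix a b assume ab: "a \<le> x \<and> x \<le> b \<and> b - a < min d 1"
        show "cmod (F b - F a - (b - a) *\<^sub>R f x) \<le> e * (b - a)"
        proof (cases "a = b")
          case False
          define r where "r = (b - a) / 2"
          define y where "y = (a + b) / 2"
          have cb: "cball y r = {a..b}" by (simp add: cball_eq_atLeastAtMost y_def r_def field_simps)
          have "measure (M z q n) (cball y r) \<le> q * r"
            by (rule d(2)) (use ab False in \<open>auto simp: cb\<close>, auto simp: r_def)
          then have Mq: "(LINT s:{a..b}|lborel. u z q n s) \<le> q * r" using Mcb[of "{a..b}" q z n] q cb by simp
          have I1: "set_integrable lborel {a..b} f"
            unfolding set_integrable_def using f by (intro integrable_mult_indicator) auto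
          have const: "set_integrable lborel {a..b} (\<lambda>_. c)" for c :: "'b :: {banach, second_countable_topology}"
            by (intro borel_integrable_atLeastAtMost' continuous_on_const)
          have I2: "set_integrable lborel {a..b} (\<lambda>s. f s - f x)"
            by (intro set_integral_diff I1 const)
          have I3: "set_integrable lborel {a..b} (u z q n)"
            unfolding set_integrable_def using ui q by (intro integrable_mult_indicator) auto
          have "F b - F a - (b - a) *\<^sub>R f x = (LINT s:{a..b}|lborel. f s - f x)"
            using F[of a b] ab by (subst set_integral_diff(2)[OF I1 const]) (auto simp: set_lebesgue_integral_def)
          also have "cmod \<dots> \<le> (LINT s:{a..b}|lborel. cmod (f s - f x))"
            using I2 unfolding set_lebesgue_integral_def set_integrable_def
            by (intro order.trans[OF integral_norm_bound]) auto
          also have "\<dots> \<le> (LINT s:{a..b}|lborel. u z q n s + 2 * q)"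
          proof (rule set_integral_mono)
            show "set_integrable lborel {a..b} (\<lambda>s. cmod (f s - f x))" using I2 by (rule set_integrable_norm)
            show "set_integrable lborel {a..b} (\<lambda>s. u z q n s + 2 * q)" by (intro set_integral_add I3 const)
            fix s assume s: "s \<in> {a..b}"
            have "cmod (f s - f x) \<le> cmod (f s - z) + cmod (f x - z)"
              by (metis dist_norm dist_triangle2)
            moreover have "s \<in> {- real n..real n}" using s ab n by auto
            ultimately show "cmod (f s - f x) \<le> u z q n s + 2 * q"
              using \<open>cmod (f x - z) \<le> q\<close> by (simp add: u_def)
          qed
          also have "\<dots> = (LINT s:{a..b}|lborel. u z q n s) + 2 * q * (b - a)"
            using ab by (subst set_integral_add(2)[OF I3 const]) (auto simp: set_lebesgue_integral_def)
          also have "\<dots> \<le> 3 * q * (b - a)" 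
          proof -
            have "q * r \<le> q * (b - a)" using q ab by (intro mult_left_mono) (auto simp: r_def)
            then show ?thesis using Mq by (simp add: algebra_simps)
          qed
          also have "\<dots> \<le> e * (b - a)" using q ab by (intro mult_right_mono) auto
          finally show ?thesis .
        qed (use ab in auto)
      qed (use d in auto)
    qed
    have "\<exists>d>0. \<forall>y. norm (y - x) < d \<longrightarrow> norm (F y - F x - (y - x) *\<^sub>R f x) \<le> e * norm (y - x)"
      if e: "0 < e" for e
    proof -
      obtain d where d: "d > 0" "\<forall>a b. a \<le> x \<and> x \<le> b \<and> b - a < d \<longrightarrow>
        cmod (F b - F a - (b - a) *\<^sub>R f x) \<le> e * (b - a)" using key[OF e] by (elim exE conjE)
      show "\<exists>d>0. \<forall>y. norm (y - x) < d \<longrightarrow> norm (F y - F x - (y - x) *\<^sub>R f x) \<le> e * norm (y - x)"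
      proof (intro exI[of _ d] conjI allI impI d(1))
        fix y assume y: "norm (y - x) < d"
        show "norm (F y - F x - (y - x) *\<^sub>R f x) \<le> e * norm (y - x)"
        proof (cases "x \<le> y")
          case True then show ?thesis using d(2)[rule_format, of x y] y by simp
        next
          case False
          have "F y - F x - (y - x) *\<^sub>R f x = - (F x - F y - (x - y) *\<^sub>R f x)" by (simp add: algebra_simps)
          then have "norm (F y - F x - (y - x) *\<^sub>R f x) = norm (F x - F y - (x - y) *\<^sub>R f x)"
            by (simp only: norm_minus_cancel)
          then show ?thesis using d(2)[rule_format, of y x] y False by simp
        qed
      qed
    qed
    then show ?thesis unfolding has_vector_derivative_def has_derivative_at_alt
      by (simp add: bounded_linear_scaleR_left)
  qed
  ultimately have "AE x in lebesgue. (F has_vector_derivative f x) (at x)" by (auto elim: eventually_mono)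
  then show ?thesis by (simp add: AE_completion_iff)
qed

text \<open>Adding a multiple of the identity makes \<open>f\<close> an increasing bi-Lipschitz homeomorphism \<open>F\<close>. The image
of Lebesgue measure under the inverse of \<open>F\<close> gives \<open>{a..b}\<close> the mass \<open>F b - F a\<close> and is absolutely
continuous because \<open>F\<close> maps null sets to null sets; its Radon--Nikodym density is the integrand.\<close>

lemma lipschitz_integral_representation_real:
  fixes f :: "real \<Rightarrow> real"
  assumes K: "0 < K" and f: "\<And>x y. \<bar>f x - f y\<bar> \<le> K * \<bar>x - y\<bar>"
  obtains \<phi> where "\<phi> \<in> borel_measurable borel"
    "\<And>a b. a \<le> b \<Longrightarrow> set_integrable lborel {a..b} \<phi> \<and> f b - f a = (LINT x:{a..b}|lborel. \<phi> x)"
proof -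
  \<comment> \<open>The slopes of \<open>F\<close> lie between \<open>K\<close> and \<open>3 K\<close>.\<close>
  define F where "F s = f s + 2 * K * s" for s
  have Fup: "F y - F x \<le> 3 * K * (y - x)" and Flo: "K * (y - x) \<le> F y - F x" if "x \<le> y" for x y
    using f[of x y] that by (auto simp: F_def abs_if algebra_simps split: if_splits)
  have less: "F x < F y \<longleftrightarrow> x < y" for x y
  proof -
    have "F x < F y" if "x < y" for x y
      using Flo[of x y] that mult_pos_pos[OF K, of "y - x"] by linarith
    then show ?thesis by (metis less_asym linorder_neqE)
  qed
  have le: "F x \<le> F y \<longleftrightarrow> x \<le> y" for x y using less[of y x] by auto
  have injF: "inj F" by (rule injI) (metis le order_antisym order_refl)
  have lipF: "\<bar>F x - F y\<bar> \<le> 3 * K * \<bar>x - y\<bar>" for x y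
    using Fup[of x y] Flo[of x y] Fup[of y x] Flo[of y x] le[of x y] le[of y x] by (cases "x \<le> y") (auto simp: abs_if)
  have contF: "continuous_on UNIV F"
    by (rule lipschitz_on_continuous_on[of "3 * K"]) (auto intro!: lipschitz_onI simp: dist_real_def lipF K less_imp_le)
  have surjF: "surj F"
  proof -
    have "\<exists>x. F x = y" for y
    proof -
      define m where "m = \<bar>y - F 0\<bar> / K"
      have m: "0 \<le> m" "K * m = \<bar>y - F 0\<bar>" using K by (auto simp: m_def)
      have "F (- m) \<le> y" "y \<le> F m" using Flo[of 0 m] Flo[of "-m" 0] m by auto
      then show ?thesis using IVT'[of F "- m" y m] continuous_on_subset[OF contF] m by auto
    qed
    then show ?thesis by (metis surjI)
  qed
  define G where "G = inv F"
  have GF: "G (F x) = x" for x using injF by (simp add: G_def)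
  have FG: "F (G y) = y" for y using surjF by (simp add: G_def surj_f_inv_f)
  have "mono G" by (rule monoI) (metis FG le)
  then have [measurable]: "G \<in> borel_measurable borel" by (rule borel_measurable_mono)
  define N where "N = distr lborel borel G"
  have emN: "emeasure N B = emeasure lborel (G -` B)" if "B \<in> sets borel" for B
    unfolding N_def using that by (subst emeasure_distr) auto
  have vim: "G -` B = F ` B" for B :: "real set" using GF FG by (auto simp: image_iff) metis
  have ac: "absolutely_continuous lborel N"
    unfolding absolutely_continuous_def
  proof
    fix B :: "real set" assume "B \<in> null_sets lborel"
    then have B: "B \<in> sets borel" "negligible B" by (auto simp: null_sets_def negligible_iff_null_sets null_sets_completionI)
    have "negligible (F ` B)"
    proof (rule negligible_locally_Lipschitz_image[OF _ B(2)])
      fix x show "\<exists>T B'. open T \<and> x \<in> T \<and> (\<forall>y\<in>B \<inter> T. norm (F y - F x) \<le> B' * norm (y - x))"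
        by (intro exI[of _ UNIV] exI[of _ "3 * K"]) (auto simp: lipF)
    qed simp
    moreover have "F ` B \<in> sets borel" using B measurable_sets[of G borel borel B] by (simp add: vim)
    ultimately have "emeasure lborel (F ` B) = 0"
      by (simp add: negligible_iff_null_sets null_sets_completion_iff null_sets_def)
    then show "B \<in> null_sets N" using emN[OF B(1)] B by (auto simp: null_sets_def N_def vim)
  qed
  obtain h where h [measurable]: "h \<in> borel_measurable lborel" and hN: "density lborel h = N"
    using sigma_finite_measure.Radon_Nikodym[OF lborel.sigma_finite_measure_axioms ac] by (auto simp: N_def)
  have Nab: "emeasure N {a..b} = ennreal (F b - F a)" if "a \<le> b" for a b
  proof -
    have "a \<le> G y \<longleftrightarrow> F a \<le> y" "G y \<le> b \<longleftrightarrow> y \<le> F b" for y using le[of a "G y"] le[of "G y" b] FG by auto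
    then have "G -` {a..b} = {F a..F b}" by auto
    then show ?thesis using that le by (simp add: emN)
  qed
  have hint: "(\<integral>\<^sup>+x. h x * indicator {a..b} x \<partial>lborel) = ennreal (F b - F a)" if "a \<le> b" for a b
    using Nab[OF that] by (simp add: emeasure_density flip: hN)
  have fin: "AE x in lborel. h x \<noteq> \<infinity>"
  proof -
    have "AE x in lborel. h x * indicator {- real n..real n} x \<noteq> \<infinity>" for n
      by (rule nn_integral_PInf_AE) (use hint[of "- real n" "real n"] in auto)
    then have "AE x in lborel. \<forall>n. h x * indicator {- real n..real n} x \<noteq> \<infinity>" by (simp add: AE_all_countable)
    then show ?thesis
    proof (rule AE_mp, intro AE_I2 impI)
      fix x assume "\<forall>n. h x * indicator {- real n..real n} x \<noteq> \<infinity>"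
      moreover obtain n where "\<bar>x\<bar> \<le> real n" using real_arch_simple by blast
      then have "indicator {- real n..real n} x = (1 :: ennreal)" by (auto simp: indicator_def)
      ultimately show "h x \<noteq> \<infinity>" by (metis mult.right_neutral)
    qed
  qed
  define \<phi> where "\<phi> x = enn2real (h x) - 2 * K" for x
  show ?thesis
  proof (rule that[of \<phi>])
    show "\<phi> \<in> borel_measurable borel" unfolding \<phi>_def by measurable
    fix a b :: real assume ab: "a \<le> b"
    have nn: "(\<integral>\<^sup>+x. ennreal (indicator {a..b} x * enn2real (h x)) \<partial>lborel) = ennreal (F b - F a)"
      unfolding hint[OF ab, symmetric] using fin
      by (intro nn_integral_cong_AE) (auto simp: indicator_def less_top)
    have hi: "has_bochner_integral lborel (\<lambda>x. indicator {a..b} x * enn2real (h x)) (F b - F a)"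
      by (rule has_bochner_integral_nn_integral[OF _ _ _ nn]) (use ab le in auto)
    have I: "set_integrable lborel {a..b} (\<lambda>x. enn2real (h x))" "(LINT x:{a..b}|lborel. enn2real (h x)) = F b - F a"
      using hi by (auto simp: has_bochner_integral_iff set_integrable_def set_lebesgue_integral_def)
    have C: "set_integrable lborel {a..b} (\<lambda>x. 2 * K)" "(LINT x:{a..b}|lborel. 2 * K) = 2 * K * (b - a)"
      using ab by (auto simp: set_integrable_def set_lebesgue_integral_def)
    show "set_integrable lborel {a..b} \<phi> \<and> f b - f a = (LINT x:{a..b}|lborel. \<phi> x)"
      unfolding \<phi>_def using set_integral_diff[OF I(1) C(1)] I(2) C(2) by (simp add: F_def algebra_simps)
  qed
qed

lemma lipschitz_integral_representation:
  fixes f :: "real \<Rightarrow> complex"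
  assumes f: "\<And>x y. cmod (f x - f y) \<le> \<bar>x - y\<bar>"
  obtains \<phi> where "\<phi> \<in> borel_measurable borel"
    "\<And>a b. a \<le> b \<Longrightarrow> set_integrable lborel {a..b} \<phi> \<and> f b - f a = (LINT x:{a..b}|lborel. \<phi> x)"
proof -
  have re: "\<bar>Re (f x) - Re (f y)\<bar> \<le> 1 * \<bar>x - y\<bar>" and im: "\<bar>Im (f x) - Im (f y)\<bar> \<le> 1 * \<bar>x - y\<bar>" for x y
    using f[of x y] abs_Re_le_cmod[of "f x - f y"] abs_Im_le_cmod[of "f x - f y"] by simp_all
  obtain u where u: "u \<in> borel_measurable borel"
    "\<And>a b. a \<le> b \<Longrightarrow> set_integrable lborel {a..b} u \<and> Re (f b) - Re (f a) = (LINT x:{a..b}|lborel. u x)"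
    using lipschitz_integral_representation_real[of 1 "\<lambda>x. Re (f x)", OF _ re] by auto
  obtain v where v: "v \<in> borel_measurable borel"
    "\<And>a b. a \<le> b \<Longrightarrow> set_integrable lborel {a..b} v \<and> Im (f b) - Im (f a) = (LINT x:{a..b}|lborel. v x)"
    using lipschitz_integral_representation_real[of 1 "\<lambda>x. Im (f x)", OF _ im] by auto
  show ?thesis
  proof (rule that[of "\<lambda>x. of_real (u x) + \<i> * of_real (v x)"])
    show "(\<lambda>x. of_real (u x) + \<i> * of_real (v x)) \<in> borel_measurable borel" using u(1) v(1) by measurable
    fix a b :: real assume ab: "a \<le> b"
    have U: "set_integrable lborel {a..b} (\<lambda>x. complex_of_real (u x))"
        "(LINT x:{a..b}|lborel. complex_of_real (u x)) = of_real (Re (f b) - Re (f a))"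
      using u(2)[OF ab] by (auto simp: set_integrable_def set_lebesgue_integral_def scaleR_conv_of_real
           simp flip: of_real_mult)
    have V: "set_integrable lborel {a..b} (\<lambda>x. complex_of_real (v x))"
        "(LINT x:{a..b}|lborel. complex_of_real (v x)) = of_real (Im (f b) - Im (f a))"
      using v(2)[OF ab] by (auto simp: set_integrable_def set_lebesgue_integral_def scaleR_conv_of_real
           simp flip: of_real_mult)
    have V': "set_integrable lborel {a..b} (\<lambda>x. \<i> * complex_of_real (v x))" using V(1) by simp
    have "(LINT x:{a..b}|lborel. of_real (u x) + \<i> * of_real (v x)) = of_real (Re (f b) - Re (f a)) + \<i> * of_real (Im (f b) - Im (f a))"
      using set_integral_add(2)[OF U(1) V'] U(2) V(2) by simp
    also have "\<dots> = f b - f a" by (simp add: complex_eq_iff)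
    finally show "set_integrable lborel {a..b} (\<lambda>x. of_real (u x) + \<i> * of_real (v x)) \<and>
        f b - f a = (LINT x:{a..b}|lborel. of_real (u x) + \<i> * of_real (v x))"
      using set_integral_add(1)[OF U(1) V'] by simp
  qed
qed
lemma lipschitz_AE_has_vector_derivative:
  fixes f :: "real \<Rightarrow> complex"
  assumes L: "0 \<le> L" and f: "\<And>x y. x \<in> {0..L} \<Longrightarrow> y \<in> {0..L} \<Longrightarrow> cmod (f x - f y) \<le> \<bar>x - y\<bar>"
  obtains \<phi> where "\<phi> \<in> borel_measurable borel"
    "AE x in lborel. x \<in> {0<..<L} \<longrightarrow> (f has_vector_derivative \<phi> x) (at x)"
    "AE x in lborel. x \<in> {0<..<L} \<longrightarrow> cmod (\<phi> x) \<le> 1"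
    "\<And>a b. 0 \<le> a \<Longrightarrow> a \<le> b \<Longrightarrow> b \<le> L \<Longrightarrow> set_integrable lborel {a..b} \<phi> \<and> f b - f a = (LINT x:{a..b}|lborel. \<phi> x)"
proof -
  \<comment> \<open>\<open>c\<close> extends \<open>f\<close> by constants to a 1-Lipschitz function on the line.\<close>
  define c where "c x = f (max 0 (min L x))" for x
  have cl: "cmod (c x - c y) \<le> \<bar>x - y\<bar>" for x y
  proof -
    have "cmod (c x - c y) \<le> \<bar>max 0 (min L x) - max 0 (min L y)\<bar>" unfolding c_def using L by (intro f) auto
    also have "\<dots> \<le> \<bar>x - y\<bar>" using L by (auto simp: max_def min_def)
    finally show ?thesis .
  qed
  have cf: "c x = f x" if "0 \<le> x" "x \<le> L" for x using that by (simp add: c_def)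
  obtain \<phi> where \<phi>: "\<phi> \<in> borel_measurable borel"
    "\<And>a b. a \<le> b \<Longrightarrow> set_integrable lborel {a..b} \<phi> \<and> c b - c a = (LINT x:{a..b}|lborel. \<phi> x)"
    using lipschitz_integral_representation[OF cl] by blast
  define \<psi> where "\<psi> x = indicator {0..L} x *\<^sub>R \<phi> x" for x
  have der: "AE x in lborel. (c has_vector_derivative \<psi> x) (at x)"
  proof (rule AE_has_vector_derivative_indefinite_integral)
    show "integrable lborel \<psi>" using \<phi>(2)[OF L] by (simp add: set_integrable_def \<psi>_def[abs_def])
    fix a b :: real assume ab: "a \<le> b"
    have "(LINT x:{a..b}|lborel. \<psi> x) = (LINT x:{max 0 (min L a)..max 0 (min L b)}|lborel. \<phi> x)"
    proof (cases "b < 0 \<or> L < a")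
      case True
      then have zero: "indicator {a..b} x *\<^sub>R \<psi> x = 0" for x by (auto simp: \<psi>_def indicator_def)
      then have "(LINT x:{a..b}|lborel. \<psi> x) = 0" by (simp only: set_lebesgue_integral_def zero integral_zero)
      moreover have "(LINT x:{max 0 (min L a)..max 0 (min L b)}|lborel. \<phi> x) = c (max 0 (min L b)) - c (max 0 (min L a))"
        using \<phi>(2)[of "max 0 (min L a)" "max 0 (min L b)"] ab by auto
      moreover have "max 0 (min L b) = max 0 (min L a)" using True ab L by auto
      ultimately show ?thesis by simp
    next
      case False
      then have "{max 0 (min L a)..max 0 (min L b)} = {a..b} \<inter> {0..L}" using ab L by (auto simp: max_def min_def)
      then show ?thesis
        by (auto simp: set_lebesgue_integral_def \<psi>_def indicator_def intro!: Bochner_Integration.integral_cong)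
    qed
    also have "\<dots> = c (max 0 (min L b)) - c (max 0 (min L a))"
      using \<phi>(2)[of "max 0 (min L a)" "max 0 (min L b)"] ab by auto
    also have "\<dots> = c b - c a" using L by (simp add: c_def)
    finally show "c b - c a = (LINT x:{a..b}|lborel. \<psi> x)" by simp
  qed
  have der2: "AE x in lborel. x \<in> {0<..<L} \<longrightarrow> (f has_vector_derivative \<phi> x) (at x)"
    using der
  proof (rule AE_mp, intro AE_I2 impI)
    fix x assume d: "(c has_vector_derivative \<psi> x) (at x)" and x: "x \<in> {0<..<L}"
    have "(f has_vector_derivative \<psi> x) (at x)"
      by (rule has_vector_derivative_transform_within_open[OF d, of "{0<..<L}"]) (use x cf in auto)
    then show "(f has_vector_derivative \<phi> x) (at x)" using x by (simp add: \<psi>_def)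
  qed
  have norm: "cmod v \<le> 1" if v: "(c has_vector_derivative v) (at x)" for v x
  proof -
    show ?thesis
    proof (rule field_le_epsilon)
      fix e :: real assume "0 < e"
      then obtain d where d: "0 < d" "\<And>y. norm (y - x) < d \<Longrightarrow> norm (c y - c x - (y - x) *\<^sub>R v) \<le> e * norm (y - x)"
        using v unfolding has_vector_derivative_def has_derivative_at_alt by blast
      have 1: "cmod (c (x + d/2) - c x - (d/2) *\<^sub>R v) \<le> e * (d/2)" using d(2)[of "x + d/2"] d(1) by simp
      have "cmod ((d/2) *\<^sub>R v) \<le> cmod (c (x + d/2) - c x) + cmod (c (x + d/2) - c x - (d/2) *\<^sub>R v)"
        using norm_triangle_ineq4[of "c (x + d/2) - c x" "c (x + d/2) - c x - (d/2) *\<^sub>R v"] by simp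
      also have "\<dots> \<le> d/2 + e * (d/2)" using 1 cl[of "x + d/2" x] d(1) by simp
      finally have "(d/2) * cmod v \<le> (d/2) * (1 + e)" using d(1) by (simp add: algebra_simps)
      then show "cmod v \<le> 1 + e" using d(1) by simp
    qed
  qed
  have "AE x in lborel. x \<in> {0<..<L} \<longrightarrow> cmod (\<phi> x) \<le> 1"
    using der by (rule AE_mp) (use norm in \<open>force simp: \<psi>_def\<close>)
  then show ?thesis
  proof (rule that[OF \<phi>(1) der2])
    fix a b assume "0 \<le> a" "a \<le> b" "b \<le> L"
    then show "set_integrable lborel {a..b} \<phi> \<and> f b - f a = (LINT x:{a..b}|lborel. \<phi> x)"
      using \<phi>(2)[of a b] cf[of a] cf[of b] by simp
  qed
qed

section \<open>Arc-length parametrization of a rectifiable arc\<close>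

definition chord_sum :: "(real \<Rightarrow> complex) \<Rightarrow> real list \<Rightarrow> real" where
  "chord_sum g xs = (\<Sum>i<length xs - 1. cmod (g (xs ! Suc i) - g (xs ! i)))"

lemma chord_sum_nonneg: "0 \<le> chord_sum g xs" by (simp add: chord_sum_def sum_nonneg)

lemma arc_len_alt: "arc_len g a b = (SUP xs \<in> {xs. sorted xs \<and> set xs \<subseteq> {a..b}}. ennreal (chord_sum g xs))"
  by (simp add: arc_len_def chord_sum_def)

lemma chord_sum_le_arc_len:
  assumes "sorted xs" "set xs \<subseteq> {a..b}"
  shows "ennreal (chord_sum g xs) \<le> arc_len g a b"
  unfolding arc_len_alt by (rule SUP_upper) (use assms in auto)

lemma chord_le_arc_len: "a \<le> b \<Longrightarrow> ennreal (cmod (g b - g a)) \<le> arc_len g a b"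
  using chord_sum_le_arc_len[of "[a, b]" a b g] by (simp add: chord_sum_def)

lemma chord_sum_Cons: "xs \<noteq> [] \<Longrightarrow> chord_sum g (x # xs) = cmod (g (hd xs) - g x) + chord_sum g xs"
proof (cases xs)
  case (Cons y ys)
  then show ?thesis by (simp add: chord_sum_def sum.lessThan_Suc_shift del: sum.lessThan_Suc)
qed simp

text \<open>Concatenation inserts one further chord, joining the last point of the first list to the first point
of the second; all other chords are unchanged.\<close>

lemma chord_sum_append: "chord_sum g xs + chord_sum g ys \<le> chord_sum g (xs @ ys)"
proof (induction xs)
  case Nil then show ?case by (simp add: chord_sum_def)
next
  case (Cons x xs)
  show ?case
  proof (cases "xs = []")
    case True
    show ?thesis
    proof (cases "ys = []")
      case False
      then show ?thesis using True chord_sum_Cons[of ys g x] by (simp add: chord_sum_def)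
    qed (simp add: chord_sum_def)
  next
    case False
    then show ?thesis using Cons chord_sum_Cons[of xs g x] chord_sum_Cons[of "xs @ ys" g x] by simp
  qed
qed

lemma sorted_map_mono: "mono f \<Longrightarrow> sorted xs \<Longrightarrow> sorted (map f xs)"
  for f :: "real \<Rightarrow> real" by (simp add: sorted_iff_nth_mono monoD)

text \<open>For \<open>\<le>\<close>, a list in \<open>{a..c}\<close> is replaced by its two truncations \<open>min b\<close> and \<open>max b\<close>, which turns every
chord into a sum of two chords without any case distinction on where \<open>b\<close> lies in the list.\<close>

lemma arc_len_add:
  assumes ab: "a \<le> b" and bc: "b \<le> c"
  shows "arc_len g a c = arc_len g a b + arc_len g b c"
proof (rule antisym)
  show "arc_len g a c \<le> arc_len g a b + arc_len g b c"
    unfolding arc_len_alt[of g a c]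
  proof (rule SUP_least)
    fix xs assume "xs \<in> {xs. sorted xs \<and> set xs \<subseteq> {a..c}}"
    then have xs: "sorted xs" "set xs \<subseteq> {a..c}" by auto
    have "cmod (g (xs ! Suc i) - g (xs ! i)) \<le> cmod (g (min b (xs ! Suc i)) - g (min b (xs ! i)))
        + cmod (g (max b (xs ! Suc i)) - g (max b (xs ! i)))" if "i < length xs - 1" for i
    proof -
      have split: "g z = g (min b z) + g (max b z) - g b" for z by (simp add: min_def max_def)
      show ?thesis
        unfolding split[of "xs ! Suc i"] split[of "xs ! i"]
        using norm_triangle_ineq[of "g (min b (xs ! Suc i)) - g (min b (xs ! i))" "g (max b (xs ! Suc i)) - g (max b (xs ! i))"]
        by (simp add: algebra_simps)
    qed
    then have "chord_sum g xs \<le> chord_sum g (map (min b) xs) + chord_sum g (map (max b) xs)"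
      unfolding chord_sum_def by (auto simp: sum.distrib[symmetric] intro!: sum_mono)
    then have "ennreal (chord_sum g xs) \<le> ennreal (chord_sum g (map (min b) xs)) + ennreal (chord_sum g (map (max b) xs))"
      by (simp add: chord_sum_nonneg flip: ennreal_plus)
    also have "\<dots> \<le> arc_len g a b + arc_len g b c"
    proof (intro add_mono chord_sum_le_arc_len sorted_map_mono xs)
      show "set (map (min b) xs) \<subseteq> {a..b}" "set (map (max b) xs) \<subseteq> {b..c}" using xs ab bc by auto
    qed (auto simp: mono_def)
    finally show "ennreal (chord_sum g xs) \<le> arc_len g a b + arc_len g b c" .
  qed
  have ne: "{xs. sorted xs \<and> set xs \<subseteq> {u..v}} \<noteq> {}" for u v :: real by (auto intro: exI[of _ "[]"])
  have 1: "ennreal (chord_sum g xs) + arc_len g b c \<le> arc_len g a c" if xs: "sorted xs" "set xs \<subseteq> {a..b}" for xs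
    unfolding arc_len_alt[of g b c] ennreal_SUP_add_right[OF ne]
  proof (rule SUP_least)
    fix ys assume "ys \<in> {xs. sorted xs \<and> set xs \<subseteq> {b..c}}"
    then have xy: "sorted (xs @ ys)" "set (xs @ ys) \<subseteq> {a..c}" using xs ab bc by (force simp: sorted_append)+
    have "ennreal (chord_sum g xs) + ennreal (chord_sum g ys) \<le> ennreal (chord_sum g (xs @ ys))"
      using chord_sum_append[of g xs ys] by (simp add: chord_sum_nonneg flip: ennreal_plus)
    also have "\<dots> \<le> arc_len g a c" by (rule chord_sum_le_arc_len[OF xy])
    finally show "ennreal (chord_sum g xs) + ennreal (chord_sum g ys) \<le> arc_len g a c" .
  qed
  show "arc_len g a b + arc_len g b c \<le> arc_len g a c"
    unfolding arc_len_alt[of g a b] ennreal_SUP_add_left[OF ne, symmetric]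
    by (rule SUP_least) (use 1 in auto)
qed

locale rect_arc =
  fixes g :: "real \<Rightarrow> complex"
  assumes curve: "rectifiable_arc g"
begin

definition len_to :: "real \<Rightarrow> real" where "len_to x = enn2real (arc_len g 0 x)"
definition len :: real where "len = curve_length g"
definition \<gamma> :: "real \<Rightarrow> complex" where "\<gamma> = arclength_param g"

lemma g_cont: "continuous_on {0..1} g" and g_inj: "inj_on g {0..1}" and total_finite: "arc_len g 0 1 < \<infinity>"
  using curve by (auto simp: rectifiable_arc_def arc_def path_def)

lemma arc_len_finite: "0 \<le> a \<Longrightarrow> a \<le> b \<Longrightarrow> b \<le> 1 \<Longrightarrow> arc_len g a b < \<infinity>"
proof -
  assume ab: "0 \<le> a" "a \<le> b" "b \<le> 1"
  have "arc_len g a b \<le> arc_len g 0 a + (arc_len g a b + arc_len g b 1)"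
    by (meson add_increasing add_increasing2 order_refl zero_le)
  also have "\<dots> = arc_len g 0 1" using ab arc_len_add[of 0 a 1 g] arc_len_add[of a b 1 g] by auto
  finally show ?thesis using total_finite by (rule le_less_trans)
qed

lemma len_to_diff: "0 \<le> a \<Longrightarrow> a \<le> b \<Longrightarrow> b \<le> 1 \<Longrightarrow> ennreal (len_to b - len_to a) = arc_len g a b"
  using arc_len_add[of 0 a b g] arc_len_finite[of 0 a] arc_len_finite[of a b]
  unfolding len_to_def by (cases "arc_len g 0 a"; cases "arc_len g a b") (auto simp flip: ennreal_plus)

lemma len_to_mono: "0 \<le> a \<Longrightarrow> a \<le> b \<Longrightarrow> b \<le> 1 \<Longrightarrow> len_to a \<le> len_to b"
  using arc_len_add[of 0 a b g] arc_len_finite[of 0 b]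
  unfolding len_to_def by (intro enn2real_mono) auto

lemma chord_le_len_to: "0 \<le> a \<Longrightarrow> a \<le> b \<Longrightarrow> b \<le> 1 \<Longrightarrow> cmod (g b - g a) \<le> len_to b - len_to a"
  using chord_le_arc_len[of a b g] len_to_mono[of a b] by (simp flip: len_to_diff)

lemma chord_sum_le_len_to: "0 \<le> a \<Longrightarrow> a \<le> b \<Longrightarrow> b \<le> 1 \<Longrightarrow> sorted xs \<Longrightarrow> set xs \<subseteq> {a..b} \<Longrightarrow> chord_sum g xs \<le> len_to b - len_to a"
  using chord_sum_le_arc_len[of xs a b g] len_to_mono[of a b] by (simp flip: len_to_diff)

lemma len_to_0: "len_to 0 = 0"
proof -
  have "arc_len g 0 0 = arc_len g 0 0 + arc_len g 0 0" using arc_len_add[of 0 0 0 g] by simp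
  then show ?thesis using arc_len_finite[of 0 0] unfolding len_to_def
    by (cases "arc_len g 0 0") (auto simp flip: ennreal_plus)
qed

lemma len_to_1: "len_to 1 = len" by (simp add: len_to_def len_def curve_length_def)

lemma len_to_strict: "0 \<le> a \<Longrightarrow> a < b \<Longrightarrow> b \<le> 1 \<Longrightarrow> len_to a < len_to b"
proof -
  assume ab: "0 \<le> a" "a < b" "b \<le> 1"
  then have "g a \<noteq> g b" using inj_onD[OF g_inj, of a b] by auto
  then show ?thesis using chord_le_len_to[of a b] ab by (smt (verit) zero_less_norm_iff right_minus_eq)
qed
text \<open>Almost all of the total length is seen by a single finite list \<open>xs\<close>. On an interval \<open>{a..b}\<close> so
short that \<open>g\<close> hardly moves there, this list picks up hardly any length, so almost all of the total
length lies outside \<open>{a..b}\<close>.\<close>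

lemma len_to_cont: "continuous_on {0..1} len_to"
proof (rule continuous_on_iff[THEN iffD2], intro ballI allI impI)
  fix x e :: real assume x: "x \<in> {0..1}" and e: "0 < e"
  have len0: "0 < len" using len_to_strict[of 0 1] len_to_0 len_to_1 by simp
  have "arc_len g 0 1 = ennreal len" using len_to_diff[of 0 1] len_to_0 len_to_1 by simp
  then have "ennreal (len - e / 2) < arc_len g 0 1" using len0 e by (simp add: ennreal_lessI)
  then obtain xs where xs: "sorted xs" "set xs \<subseteq> {0..1}" "ennreal (len - e / 2) < ennreal (chord_sum g xs)"
    unfolding arc_len_alt by (auto simp: less_SUP_iff)
  have cs: "len - e / 2 < chord_sum g xs"
    using xs(3) chord_sum_nonneg[of g xs] by (metis ennreal_leI not_less)
  define \<eta> where "\<eta> = e / (4 * (real (length xs) + 1))"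
  have \<eta>: "0 < \<eta>" using e by (simp add: \<eta>_def)
  have "\<eta> * real (length xs - 1) \<le> \<eta> * (real (length xs) + 1)" using \<eta> by (intro mult_left_mono) auto
  also have "\<dots> = e / 4" by (simp add: \<eta>_def field_simps)
  finally have \<eta>e: "\<eta> * real (length xs - 1) \<le> e / 4" .
  have "uniformly_continuous_on {0..1} g" by (intro compact_uniformly_continuous g_cont) simp
  then obtain d where d: "0 < d" "\<And>u v. u \<in> {0..1} \<Longrightarrow> v \<in> {0..1} \<Longrightarrow> dist v u < d \<Longrightarrow> dist (g v) (g u) < \<eta>"
    using \<eta> unfolding uniformly_continuous_on_def by metis
  have main: "len_to b - len_to a < e" if ab: "0 \<le> a" "a \<le> b" "b \<le> 1" "b - a < d" for a b
  proof -
    have "cmod (g (xs ! Suc i) - g (xs ! i)) \<le> cmod (g (min a (xs ! Suc i)) - g (min a (xs ! i)))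
        + cmod (g (max b (xs ! Suc i)) - g (max b (xs ! i))) + \<eta>" (is "_ \<le> cmod ?p + cmod ?q + \<eta>") for i
    proof -
      define c where "c z = max a (min b z)" for z
      \<comment> \<open>Splits every chord into a part before \<open>a\<close>, a part after \<open>b\<close> and a part inside \<open>{a..b}\<close>,
        the last of which is shorter than \<open>\<eta>\<close>.\<close>
      have split: "g z = g (min a z) + g (max b z) + g (c z) - g a - g b" for z
        using ab by (auto simp: min_def max_def c_def)
      have "g (xs ! Suc i) - g (xs ! i) = ?p + ?q + (g (c (xs ! Suc i)) - g (c (xs ! i)))"
        unfolding split[of "xs ! Suc i"] split[of "xs ! i"] by (simp add: algebra_simps)
      moreover have "dist (g (c (xs ! Suc i))) (g (c (xs ! i))) < \<eta>"
        using ab by (intro d(2)) (auto simp: c_def dist_real_def)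
      ultimately show ?thesis
        using norm_triangle_ineq[of "?p + ?q" "g (c (xs ! Suc i)) - g (c (xs ! i))"] norm_triangle_ineq[of ?p ?q]
        by (simp add: dist_norm)
    qed
    then have "chord_sum g xs \<le> (\<Sum>i<length xs - 1. cmod (g (min a (xs ! Suc i)) - g (min a (xs ! i)))
        + cmod (g (max b (xs ! Suc i)) - g (max b (xs ! i))) + \<eta>)"
      unfolding chord_sum_def by (intro sum_mono) auto
    also have "\<dots> = chord_sum g (map (min a) xs) + chord_sum g (map (max b) xs) + \<eta> * real (length xs - 1)"
      by (simp add: chord_sum_def sum.distrib)
    finally have B: "chord_sum g xs \<le> chord_sum g (map (min a) xs) + chord_sum g (map (max b) xs) + \<eta> * real (length xs - 1)" .
    have "chord_sum g (map (min a) xs) \<le> len_to a - len_to 0"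
      by (intro chord_sum_le_len_to sorted_map_mono xs) (use ab xs in \<open>auto simp: mono_def\<close>)
    moreover have "chord_sum g (map (max b) xs) \<le> len_to 1 - len_to b"
      by (intro chord_sum_le_len_to sorted_map_mono xs) (use ab xs in \<open>auto simp: mono_def\<close>)
    ultimately show ?thesis using B cs \<eta>e len_to_0 len_to_1 e by linarith
  qed
  show "\<exists>d>0. \<forall>x'\<in>{0..1}. dist x' x < d \<longrightarrow> dist (len_to x') (len_to x) < e"
  proof (intro exI[of _ d] conjI ballI impI d(1))
    fix y assume y: "y \<in> {0..1}" "dist y x < d"
    show "dist (len_to y) (len_to x) < e"
      using main[of x y] main[of y x] len_to_mono[of x y] len_to_mono[of y x] x y by (cases "x \<le> y") (auto simp: dist_real_def)
  qed
qed

lemma len_pos: "0 < len" using len_to_strict[of 0 1] len_to_0 len_to_1 by simp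

lemma len_to_bij: "bij_betw len_to {0..1} {0..len}"
proof -
  have "inj_on len_to {0..1}"
    by (rule inj_onI) (metis len_to_strict atLeastAtMost_iff less_irrefl linorder_neqE)
  moreover have "len_to ` {0..1} = {0..len}"
  proof
    show "len_to ` {0..1} \<subseteq> {0..len}" using len_to_mono[of 0] len_to_mono[of _ 1] len_to_0 len_to_1 by auto
    show "{0..len} \<subseteq> len_to ` {0..1}"
    proof
      fix s assume "s \<in> {0..len}"
      then obtain x where "0 \<le> x" "x \<le> 1" "len_to x = s" using IVT'[of len_to 0 s 1] len_to_0 len_to_1 len_to_cont by auto
      then show "s \<in> len_to ` {0..1}" by auto
    qed
  qed
  ultimately show ?thesis by (simp add: bij_betw_def)
qed

lemma \<gamma>_len_to: "x \<in> {0..1} \<Longrightarrow> \<gamma> (len_to x) = g x"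
  using len_to_bij unfolding \<gamma>_def arclength_param_def len_to_def[abs_def, symmetric] bij_betw_def
  by (simp add: inv_into_f_f)

lemma obtain_len_to: assumes "s \<in> {0..len}" obtains x where "x \<in> {0..1}" "s = len_to x"
  using len_to_bij assms unfolding bij_betw_def by blast

lemma \<gamma>_image: "\<gamma> ` {0..len} = path_image g"
proof -
  have "\<gamma> ` len_to ` {0..1} = g ` {0..1}" using \<gamma>_len_to by (simp add: image_image)
  then show ?thesis using len_to_bij by (simp add: bij_betw_def path_image_def)
qed

lemma \<gamma>_in: "s \<in> {0..len} \<Longrightarrow> \<gamma> s \<in> path_image g" using \<gamma>_image by blast

lemma \<gamma>_lipschitz: assumes "s \<in> {0..len}" "u \<in> {0..len}" shows "cmod (\<gamma> s - \<gamma> u) \<le> \<bar>s - u\<bar>"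
proof -
  obtain x y where xy: "x \<in> {0..1}" "s = len_to x" "y \<in> {0..1}" "u = len_to y" using assms obtain_len_to by metis
  have "cmod (g y - g x) \<le> \<bar>len_to x - len_to y\<bar>"
    using chord_le_len_to[of x y] chord_le_len_to[of y x] xy by (cases "x \<le> y") (auto simp: norm_minus_commute)
  then show ?thesis using xy \<gamma>_len_to by (simp add: norm_minus_commute)
qed

lemma \<gamma>_cont: "continuous_on {0..len} \<gamma>"
  by (rule lipschitz_on_continuous_on[of 1]) (auto intro!: lipschitz_onI \<gamma>_lipschitz simp: dist_norm)

lemma \<gamma>_inj: "inj_on \<gamma> {0..len}"
proof (rule inj_onI)
  fix s u assume a: "s \<in> {0..len}" "u \<in> {0..len}" "\<gamma> s = \<gamma> u"
  obtain x y where xy: "x \<in> {0..1}" "s = len_to x" "y \<in> {0..1}" "u = len_to y" using a obtain_len_to by metis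
  then have "g x = g y" using a \<gamma>_len_to by simp
  then show "s = u" using inj_onD[OF g_inj _ xy(1) xy(3)] xy by simp
qed

lemma obtain_chords:
  assumes e: "0 < e"
  obtains ss where "sorted ss" "set ss \<subseteq> {0..len}" "len - e < (\<Sum>i<length ss - 1. cmod (\<gamma> (ss ! Suc i) - \<gamma> (ss ! i)))"
proof -
  have "ennreal (len - e) < arc_len g 0 1"
    using len_to_diff[of 0 1] len_to_0 len_to_1 len_pos e by (simp add: ennreal_lessI flip: len_to_diff)
  then obtain xs where xs: "sorted xs" "set xs \<subseteq> {0..1}" "ennreal (len - e) < ennreal (chord_sum g xs)"
    unfolding arc_len_alt by (auto simp: less_SUP_iff)
  have cs: "len - e < chord_sum g xs"
    using xs(3) chord_sum_nonneg[of g xs] by (metis ennreal_leI not_less)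
  have nth: "xs ! i \<in> {0..1}" if "i < length xs" for i using xs(2) that nth_mem by blast
  show ?thesis
  proof (rule that[of "map len_to xs"])
    show "sorted (map len_to xs)"
      using xs(1) nth len_to_mono by (auto simp: sorted_iff_nth_mono)
    show "set (map len_to xs) \<subseteq> {0..len}" using xs(2) len_to_bij by (auto simp: bij_betw_def)
    have "(\<Sum>i<length (map len_to xs) - 1. cmod (\<gamma> (map len_to xs ! Suc i) - \<gamma> (map len_to xs ! i))) = chord_sum g xs"
      unfolding chord_sum_def using nth by (intro sum.cong) (auto simp: \<gamma>_len_to)
    then show "len - e < (\<Sum>i<length (map len_to xs) - 1. cmod (\<gamma> (map len_to xs ! Suc i) - \<gamma> (map len_to xs ! i)))"
      using cs by simp
  qed
qed

lemma sum_integral_chords: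
  fixes h :: "real \<Rightarrow> real"
  assumes ss: "sorted ss" "set ss \<subseteq> {0..len}" and h: "set_integrable lborel {0..len} h" and nn: "\<And>x. 0 \<le> h x"
  shows "(\<Sum>i<length ss - 1. LINT x:{ss ! i..ss ! Suc i}|lborel. h x) \<le> (LINT x:{0..len}|lborel. h x)"
proof (cases "ss = []")
  case True
  then show ?thesis using nn by (simp add: set_lebesgue_integral_def)
next
  case False
  have sub: "set_integrable lborel {a..b} h" if "0 \<le> a" "b \<le> len" for a b
    by (rule set_integrable_subset[OF h]) (use that in auto)
  have bd: "0 \<le> ss ! i" "ss ! i \<le> len" if "i < length ss" for i
    using ss(2) nth_mem[OF that] by auto
  have "k < length ss \<Longrightarrow> (\<Sum>i<k. LINT x:{ss ! i..ss ! Suc i}|lborel. h x) = (LINT x:{ss ! 0..ss ! k}|lborel. h x)" for k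
  proof (induction k)
    case 0
    have "(LINT x:{ss ! 0..ss ! 0}|lborel. h x) = 0"
      using interval_integral_Icc[of "ss ! 0" "ss ! 0" h] by (simp only: interval_integral_endpoints_same order_refl)
    then show ?case by simp
  next
    case (Suc k)
    have le: "ss ! 0 \<le> ss ! k" "ss ! k \<le> ss ! Suc k" using ss(1) Suc by (auto simp: sorted_iff_nth_mono)
    have "(LINT x:{ss ! 0..ss ! Suc k}|lborel. h x) = (LBINT x=ss ! 0..ss ! Suc k. h x)"
      using le by (simp add: interval_integral_Icc)
    also have "\<dots> = (LBINT x=ss ! 0..ss ! k. h x) + (LBINT x=ss ! k..ss ! Suc k. h x)"
    proof (subst interval_integral_sum)
      have "set_integrable lborel {ss ! 0<..<ss ! Suc k} h"
        by (rule set_integrable_subset[OF h]) (use bd[of 0] bd[of "Suc k"] Suc.prems False in auto)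
      then show "interval_lebesgue_integrable lborel (min (ereal (ss ! 0)) (min (ereal (ss ! k)) (ereal (ss ! Suc k))))
          (max (ereal (ss ! 0)) (max (ereal (ss ! k)) (ereal (ss ! Suc k)))) h"
        using le by (simp add: interval_lebesgue_integrable_def)
    qed simp
    also have "\<dots> = (LINT x:{ss ! 0..ss ! k}|lborel. h x) + (LINT x:{ss ! k..ss ! Suc k}|lborel. h x)"
      using le by (simp add: interval_integral_Icc)
    finally show ?case using Suc by simp
  qed
  from this[of "length ss - 1"] False
  have "(\<Sum>i<length ss - 1. LINT x:{ss ! i..ss ! Suc i}|lborel. h x) = (LINT x:{ss ! 0..ss ! (length ss - 1)}|lborel. h x)"
    by simp
  also have "\<dots> \<le> (LINT x:{0..len}|lborel. h x)"
    unfolding set_lebesgue_integral_def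
  proof (rule integral_mono)
    show "integrable lborel (\<lambda>x. indicator {ss ! 0..ss ! (length ss - 1)} x *\<^sub>R h x)"
      using sub[of "ss ! 0" "ss ! (length ss - 1)"] bd[of 0] bd[of "length ss - 1"] False by (auto simp: set_integrable_def)
    show "integrable lborel (\<lambda>x. indicator {0..len} x *\<^sub>R h x)" using h by (simp add: set_integrable_def)
    show "indicator {ss ! 0..ss ! (length ss - 1)} x *\<^sub>R h x \<le> indicator {0..len} x *\<^sub>R h x" for x
      using nn[of x] bd[of 0] bd[of "length ss - 1"] False by (auto simp: indicator_def)
  qed
  finally show ?thesis .
qed
text \<open>The derivative has modulus at most \<open>1\<close> because \<open>\<gamma>\<close> is 1-Lipschitz. Every chord is at most the integral
of the modulus of the derivative, so this integral is at least the length \<open>len\<close> of the parameter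
interval, which forces modulus \<open>1\<close> almost everywhere.\<close>

lemma unit_speed_derivative:
  obtains \<phi> where "\<phi> \<in> borel_measurable borel"
    "\<And>x. cmod (\<phi> x) = 1"
    "AE x in lborel. x \<in> {0<..<len} \<longrightarrow> (\<gamma> has_vector_derivative \<phi> x) (at x)"
proof -
  obtain \<phi> where \<phi>: "\<phi> \<in> borel_measurable borel"
    "AE x in lborel. x \<in> {0<..<len} \<longrightarrow> (\<gamma> has_vector_derivative \<phi> x) (at x)"
    "AE x in lborel. x \<in> {0<..<len} \<longrightarrow> cmod (\<phi> x) \<le> 1"
    "\<And>a b. 0 \<le> a \<Longrightarrow> a \<le> b \<Longrightarrow> b \<le> len \<Longrightarrow> set_integrable lborel {a..b} \<phi> \<and> \<gamma> b - \<gamma> a = (LINT x:{a..b}|lborel. \<phi> x)"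
    by (rule lipschitz_AE_has_vector_derivative[OF less_imp_le[OF len_pos] \<gamma>_lipschitz]) (assumption+, rule that)
  have I: "set_integrable lborel {0..len} (\<lambda>x. cmod (\<phi> x))"
    using \<phi>(4)[of 0 len] len_pos by (intro set_integrable_norm) auto
  have low: "len \<le> (LINT x:{0..len}|lborel. cmod (\<phi> x))"
  proof (rule field_le_epsilon)
    fix e :: real assume "0 < e"
    then obtain ss where ss: "sorted ss" "set ss \<subseteq> {0..len}"
      "len - e < (\<Sum>i<length ss - 1. cmod (\<gamma> (ss ! Suc i) - \<gamma> (ss ! i)))" by (rule obtain_chords)
    have "(\<Sum>i<length ss - 1. cmod (\<gamma> (ss ! Suc i) - \<gamma> (ss ! i))) \<le> (\<Sum>i<length ss - 1. LINT x:{ss ! i..ss ! Suc i}|lborel. cmod (\<phi> x))"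
    proof (rule sum_mono)
      fix i assume "i \<in> {..<length ss - 1}"
      then have "ss ! i \<in> set ss" "ss ! Suc i \<in> set ss" "ss ! i \<le> ss ! Suc i" using ss(1) by (auto simp: sorted_iff_nth_mono)
      then have "\<gamma> (ss ! Suc i) - \<gamma> (ss ! i) = (LINT x:{ss ! i..ss ! Suc i}|lborel. \<phi> x)" using \<phi>(4)[of "ss ! i" "ss ! Suc i"] subsetD[OF ss(2), of "ss ! i"] subsetD[OF ss(2), of "ss ! Suc i"] by simp
      then show "cmod (\<gamma> (ss ! Suc i) - \<gamma> (ss ! i)) \<le> (LINT x:{ss ! i..ss ! Suc i}|lborel. cmod (\<phi> x))"
        unfolding set_lebesgue_integral_def
        using integral_norm_bound[of lborel "\<lambda>x. indicator {ss ! i..ss ! Suc i} x *\<^sub>R \<phi> x"] by simp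
    qed
    also have "\<dots> \<le> (LINT x:{0..len}|lborel. cmod (\<phi> x))"
      by (rule sum_integral_chords[OF ss(1,2) I]) simp
    finally show "len \<le> (LINT x:{0..len}|lborel. cmod (\<phi> x)) + e" using ss(3) by linarith
  qed
  define h where "h x = indicator {0<..<len} x *\<^sub>R (1 - cmod (\<phi> x))" for x
  have ep: "AE x in lborel. x \<noteq> 0 \<and> x \<noteq> len"
    using AE_lborel_singleton[of 0] AE_lborel_singleton[of len] by (auto elim: AE_mp)
  have one: "set_integrable lborel {0..len} (\<lambda>x. 1::real)" "(LINT x:{0..len}|lborel. 1::real) = len"
    using len_pos by (auto simp: set_integrable_def set_lebesgue_integral_def)
  have hI: "set_integrable lborel {0..len} (\<lambda>x. 1 - cmod (\<phi> x))" by (intro set_integral_diff one I)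
  have eq: "AE x in lborel. h x = indicator {0..len} x *\<^sub>R (1 - cmod (\<phi> x))"
    using ep by (rule AE_mp) (auto simp: h_def indicator_def)
  have hm: "h \<in> borel_measurable lborel" unfolding h_def[abs_def] using \<phi>(1) by measurable
  have hI': "integrable lborel h"
    using hI eq hm unfolding set_integrable_def by (subst integrable_cong_AE[of _ _ "\<lambda>x. indicator {0..len} x *\<^sub>R (1 - cmod (\<phi> x))"]) (auto dest: borel_measurable_integrable)
  have h0: "AE x in lborel. 0 \<le> h x"
    using \<phi>(3) by (rule AE_mp) (auto simp: h_def indicator_def)
  have "(\<integral>x. h x \<partial>lborel) = (LINT x:{0..len}|lborel. 1 - cmod (\<phi> x))"
    unfolding set_lebesgue_integral_def using hI eq hm unfolding set_integrable_def
    by (intro integral_cong_AE) (auto dest: borel_measurable_integrable)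
  also have "\<dots> = len - (LINT x:{0..len}|lborel. cmod (\<phi> x))" using set_integral_diff(2)[OF one(1) I] one(2) by simp
  also have "\<dots> \<le> 0" using low by simp
  finally have "(\<integral>x. h x \<partial>lborel) = 0" using integral_nonneg_AE[OF h0] by linarith
  then have "AE x in lborel. h x = 0" using integral_nonneg_eq_0_iff_AE[OF hI' h0] by simp
  then have "AE x in lborel. x \<in> {0<..<len} \<longrightarrow> (\<gamma> has_vector_derivative \<phi> x) (at x) \<and> cmod (\<phi> x) = 1"
    using \<phi>(2) by eventually_elim (auto simp: h_def)
  then have "AE x in lborel. x \<in> {0<..<len} \<longrightarrow> (\<gamma> has_vector_derivative (if cmod (\<phi> x) = 1 then \<phi> x else 1)) (at x)"
    by eventually_elim auto
  moreover have "(\<lambda>x. if cmod (\<phi> x) = 1 then \<phi> x else 1) \<in> borel_measurable borel" using \<phi>(1) by measurable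
  ultimately show ?thesis by (intro that[of "\<lambda>x. if cmod (\<phi> x) = 1 then \<phi> x else 1"]) auto
qed
end

section \<open>Modulars and the length measure\<close>

lemma epowr_ennreal: "0 \<le> r \<Longrightarrow> 0 < a \<Longrightarrow> epowr (ennreal r) a = ennreal (r powr a)"
  by (auto simp: epowr_def)

lemma epowr_mono: "x \<le> y \<Longrightarrow> 0 < a \<Longrightarrow> epowr x a \<le> epowr y a"
  by (cases x; cases y) (auto simp: epowr_ennreal powr_mono2 top_unique, auto simp: epowr_def)

lemma epowr_divide_le:
  assumes "1 \<le> k" "1 \<le> a"
  shows "epowr (x / ennreal k) a \<le> epowr x a / ennreal k"
proof (cases x)
  case (real r)
  have "(r / k) powr a = r powr a / k powr a" using real assms by (simp add: powr_divide)
  also have "\<dots> \<le> r powr a / k"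
    using assms powr_mono[of 1 a k] by (intro divide_left_mono) auto
  finally show ?thesis using real assms by (simp add: epowr_ennreal divide_ennreal ennreal_leI)
next
  case top
  then show ?thesis using assms by (simp add: epowr_def ennreal_top_divide)
qed

text \<open>Since the weight may take the values \<open>0\<close> and \<open>\<infinity>\<close>, the quotients of \<open>f\<close> and \<open>l\<close> are compared before
the weight enters as a factor.\<close>

lemma modular_mono:
  assumes "\<And>\<tau>. \<tau> \<in> space (length_measure g) \<Longrightarrow> 0 < p \<tau> \<and> ennreal (cmod (f \<tau>)) / ennreal l \<le> ennreal (cmod (f' \<tau>)) / ennreal l'"
  shows "modular g p w f l \<le> modular g p w f' l'"
  unfolding modular_def
proof (intro nn_integral_mono epowr_mono)
  fix \<tau> assume "\<tau> \<in> space (length_measure g)"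
  note a = assms[OF this]
  show "0 < p \<tau>" using a by simp
  have "ennreal (cmod (f \<tau>)) / ennreal l * w \<tau> \<le> ennreal (cmod (f' \<tau>)) / ennreal l' * w \<tau>"
    using a by (intro mult_right_mono) auto
  then show "ennreal (cmod (f \<tau>)) * w \<tau> / ennreal l \<le> ennreal (cmod (f' \<tau>)) * w \<tau> / ennreal l'"
    by (simp add: divide_ennreal_def ac_simps)
qed

text \<open>The integral is a supremum over simple functions below the integrand, and scaling such a function
scales its integral. The lemma serves to scale the modular of \<open>S f\<close>.\<close>

lemma nn_integral_scaled_le:
  assumes k: "0 < k" and le: "\<And>x. x \<in> space M \<Longrightarrow> ennreal k * u x \<le> v x"
  shows "ennreal k * nn_integral M u \<le> nn_integral M v"
proof -
  have "{s. simple_function M s \<and> s \<le> u} \<noteq> {}" by (auto intro!: exI[of _ "\<lambda>_. 0"] simp: le_fun_def)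
  then have "ennreal k * nn_integral M u = (SUP s\<in>{s. simple_function M s \<and> s \<le> u}. ennreal k * integral\<^sup>S M s)"
    unfolding nn_integral_def by (simp add: SUP_mult_left_ennreal)
  also have "\<dots> \<le> nn_integral M v"
  proof (rule SUP_least)
    fix s assume "s \<in> {s. simple_function M s \<and> s \<le> u}"
    then have s: "simple_function M s" "\<And>x. s x \<le> u x" by (auto simp: le_fun_def)
    have "ennreal k * integral\<^sup>S M s = integral\<^sup>S M (\<lambda>x. ennreal k * s x)" using s by simp
    also have "\<dots> = (\<integral>\<^sup>+x. ennreal k * s x \<partial>M)" using s by (intro nn_integral_eq_simple_integral[symmetric]) auto
    also have "\<dots> \<le> nn_integral M v"
      by (intro nn_integral_mono order.trans[OF mult_left_mono le]) (auto simp: s)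
    finally show "ennreal k * integral\<^sup>S M s \<le> nn_integral M v" .
  qed
  finally show ?thesis .
qed

text \<open>Guarantees that the infimum in the Luxemburg norm is taken over a nonempty set, so that the norm of a
member of the space controls the modular. Since the exponent is at least \<open>1\<close>, dividing by \<open>k \<ge> 1\<close>
divides the modular by at least \<open>k\<close>.\<close>

lemma modular_le_1_exists:
  assumes p: "\<And>\<tau>. \<tau> \<in> space (length_measure g) \<Longrightarrow> 1 < p \<tau>"
    and l: "0 < l" "modular g p w f l < \<infinity>"
  shows "\<exists>l'>0. modular g p w f l' \<le> 1"
proof -
  obtain m where m: "0 \<le> m" "modular g p w f l = ennreal m" using l(2) by (cases "modular g p w f l") auto
  define k where "k = max 1 m"
  have k: "1 \<le> k" "m \<le> k" by (auto simp: k_def)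
  have "ennreal k * modular g p w f (l * k) \<le> modular g p w f l"
    unfolding modular_def
  proof (rule nn_integral_scaled_le)
    fix \<tau> assume "\<tau> \<in> space (length_measure g)"
    have "ennreal (cmod (f \<tau>)) * w \<tau> / ennreal (l * k) = ennreal (cmod (f \<tau>)) * w \<tau> / ennreal l / ennreal k"
      using l k by (simp add: ennreal_mult divide_ennreal_def ennreal_inverse_mult ac_simps inverse_ennreal flip: ennreal_mult)
    then have "epowr (ennreal (cmod (f \<tau>)) * w \<tau> / ennreal (l * k)) (p \<tau>) \<le> epowr (ennreal (cmod (f \<tau>)) * w \<tau> / ennreal l) (p \<tau>) / ennreal k"
      using epowr_divide_le[OF k(1)] p[OF \<open>\<tau> \<in> _\<close>] by auto
    then have "ennreal k * epowr (ennreal (cmod (f \<tau>)) * w \<tau> / ennreal (l * k)) (p \<tau>) \<le> ennreal k * (epowr (ennreal (cmod (f \<tau>)) * w \<tau> / ennreal l) (p \<tau>) / ennreal k)"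
      by (rule mult_left_mono) simp
    also have "\<dots> = epowr (ennreal (cmod (f \<tau>)) * w \<tau> / ennreal l) (p \<tau>)"
      using k by (subst ennreal_times_divide, subst mult.commute, subst mult_divide_eq_ennreal) auto
    finally show "ennreal k * epowr (ennreal (cmod (f \<tau>)) * w \<tau> / ennreal (l * k)) (p \<tau>) \<le> epowr (ennreal (cmod (f \<tau>)) * w \<tau> / ennreal l) (p \<tau>)" .
  qed (use k in simp)
  then have "ennreal k * modular g p w f (l * k) \<le> ennreal k * 1" using m k by (simp add: order.trans[OF _ ennreal_leI])
  then have "modular g p w f (l * k) \<le> 1" using k by (subst (asm) ennreal_mult_le_mult_iff) auto
  then show ?thesis using l k by (intro exI[of _ "l * k"]) auto
qed

context rect_arc begin

abbreviation "\<mu> \<equiv> length_measure g"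
abbreviation "\<Gamma> \<equiv> path_image g"

lemma len_unfold: "curve_length g = len" "arclength_param g = \<gamma>" by (simp_all add: len_def \<gamma>_def)

lemma \<Gamma>_compact: "compact \<Gamma>" using curve by (simp add: rectifiable_arc_def compact_arc_image)

lemma \<Gamma>_borel: "\<Gamma> \<in> sets borel" using \<Gamma>_compact by (simp add: borel_compact)

lemma \<gamma>_measurable: "\<gamma> \<in> measurable (restrict_space lborel {0..len}) (restrict_space borel \<Gamma>)"
proof (rule measurable_restrict_space2)
  have "\<gamma> \<in> borel_measurable (restrict_space borel {0..len})"
    by (rule borel_measurable_continuous_on_restrict[OF \<gamma>_cont])
  then show "\<gamma> \<in> borel_measurable (restrict_space lborel {0..len})"
    by (simp cong: measurable_cong_sets sets_restrict_space_cong)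
qed (use \<gamma>_in in \<open>auto simp: space_restrict_space\<close>)

lemma \<mu>_eq: "\<mu> = completion (distr (restrict_space lborel {0..len}) (restrict_space borel \<Gamma>) \<gamma>)"
  unfolding length_measure_def len_unfold ..

lemma space_\<mu>: "space \<mu> = \<Gamma>" by (simp add: \<mu>_eq space_restrict_space)

lemma sets_\<mu>: "E \<in> sets borel \<Longrightarrow> E \<subseteq> \<Gamma> \<Longrightarrow> E \<in> sets \<mu>"
  unfolding \<mu>_eq by (rule sets_completionI_sets) (auto simp: sets_restrict_space image_iff)

lemma borel_measurable_\<mu>: "f \<in> borel_measurable (restrict_space borel \<Gamma>) \<Longrightarrow> f \<in> borel_measurable \<mu>"
  unfolding \<mu>_eq by (rule measurable_completion) simp

lemma nn_integral_\<mu>: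
  assumes "f \<in> borel_measurable (restrict_space borel \<Gamma>)"
  shows "(\<integral>\<^sup>+\<tau>. f \<tau> \<partial>\<mu>) = (\<integral>\<^sup>+s. f (\<gamma> s) * indicator {0..len} s \<partial>lborel)"
  unfolding \<mu>_eq nn_integral_completion
  using assms \<gamma>_measurable by (subst nn_integral_distr) (auto simp: nn_integral_restrict_space)

lemma \<gamma>_vimage: "E \<in> sets borel \<Longrightarrow> {s\<in>{0..len}. \<gamma> s \<in> E} \<in> sets borel"
proof -
  assume E: "E \<in> sets borel"
  have "\<gamma> \<in> borel_measurable (restrict_space borel {0..len})"
    by (rule borel_measurable_continuous_on_restrict[OF \<gamma>_cont])
  from measurable_sets[OF this E] show ?thesis
    by (auto simp: sets_restrict_space space_restrict_space Int_def vimage_def conj_commute)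
qed

lemma \<gamma>_vimage_finite: "emeasure lborel {s\<in>{0..len}. \<gamma> s \<in> E} < \<infinity>"
proof -
  have "emeasure lborel {s\<in>{0..len}. \<gamma> s \<in> E} \<le> emeasure lborel {0..len}" by (intro emeasure_mono) auto
  also have "\<dots> < \<infinity>" using len_pos by simp
  finally show ?thesis .
qed

lemma emeasure_\<mu>:
  assumes "E \<in> sets borel" "E \<subseteq> \<Gamma>"
  shows "emeasure \<mu> E = emeasure lborel {s\<in>{0..len}. \<gamma> s \<in> E}"
proof -
  have "emeasure \<mu> E = (\<integral>\<^sup>+\<tau>. indicator E \<tau> \<partial>\<mu>)" using sets_\<mu>[OF assms] by simp
  also have "\<dots> = (\<integral>\<^sup>+s. indicator E (\<gamma> s) * indicator {0..len} s \<partial>lborel)"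
    by (rule nn_integral_\<mu>, rule measurable_restrict_space1) (use assms in auto)
  also have "\<dots> = (\<integral>\<^sup>+s. indicator {s\<in>{0..len}. \<gamma> s \<in> E} s \<partial>lborel)"
    by (intro nn_integral_cong) (auto simp: indicator_def)
  also have "\<dots> = emeasure lborel {s\<in>{0..len}. \<gamma> s \<in> E}" using \<gamma>_vimage[OF assms(1)] by simp
  finally show ?thesis .
qed

lemma \<mu>_finite: "finite_measure \<mu>"
proof
  have "emeasure \<mu> \<Gamma> = emeasure lborel {0..len}"
    using \<gamma>_in by (subst emeasure_\<mu>) (auto simp: \<Gamma>_borel intro!: arg_cong[where f="emeasure lborel"])
  then show "emeasure \<mu> (space \<mu>) \<noteq> \<infinity>" using len_pos by (simp add: space_\<mu>)
qed

lemma measure_\<mu>: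
  assumes "E \<in> sets borel" "E \<subseteq> \<Gamma>"
  shows "measure \<mu> E = measure lborel {s\<in>{0..len}. \<gamma> s \<in> E}"
  unfolding measure_def using emeasure_\<mu>[OF assms] by simp

lemma Re_integral_lower_bound:
  fixes k :: "real \<Rightarrow> complex"
  assumes k: "integrable lborel k" and A: "A \<in> sets borel" "emeasure lborel A < \<infinity>"
    and c: "cmod c = 1" and lo: "\<And>s. \<kappa> * indicator A s \<le> Re (c * k s)"
  shows "\<kappa> * measure lborel A \<le> cmod (\<integral>s. k s \<partial>lborel)"
proof -
  have "\<kappa> * measure lborel A = (\<integral>s. \<kappa> * indicator A s \<partial>lborel)" using A by simp
  also have "\<dots> \<le> (\<integral>s. Re (c * k s) \<partial>lborel)" using k A lo by (intro integral_mono) auto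
  also have "\<dots> = Re (c * (\<integral>s. k s \<partial>lborel))" using k by simp
  also have "\<dots> \<le> cmod (\<integral>s. k s \<partial>lborel)" using complex_Re_le_cmod[of "c * (\<integral>s. k s \<partial>lborel)"] c by (simp add: norm_mult)
  finally show ?thesis .
qed

text \<open>Once the truncation radius is smaller than the distance \<open>d\<close> from \<open>t\<close> to \<open>E\<close>, truncation has no effect,
and the conjugate tangent in \<open>f\<close> cancels the tangent in \<open>d\<tau>\<close> because the tangent has modulus \<open>1\<close>.\<close>

lemma cauchy_S_separated:
  assumes \<phi>: "\<phi> \<in> borel_measurable borel" "\<And>x. cmod (\<phi> x) = 1"
      "AE x in lborel. x \<in> {0<..<len} \<longrightarrow> (\<gamma> has_vector_derivative \<phi> x) (at x)"
    and E: "E \<in> sets borel" "E \<subseteq> \<Gamma>" and q: "q \<in> borel_measurable borel" "\<And>\<tau>. cmod (q \<tau>) \<le> 1"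
    and d: "0 < d" "\<And>\<tau>. \<tau> \<in> E \<Longrightarrow> d \<le> cmod (\<tau> - t)"
    and f: "\<And>s. s \<in> {0..len} \<Longrightarrow> f (\<gamma> s) = indicator E (\<gamma> s) * q (\<gamma> s) * cnj (\<phi> s)"
  defines "k \<equiv> \<lambda>s. indicator {s\<in>{0..len}. \<gamma> s \<in> E} s *\<^sub>R (q (\<gamma> s) / (\<gamma> s - t))"
  shows "integrable lborel k" "cauchy_S g f t = 1 / (complex_of_real pi * \<i>) * (\<integral>s. k s \<partial>lborel)"
proof -
  let ?A = "{s\<in>{0..len}. \<gamma> s \<in> E}"
  have A: "?A \<in> sets borel" by (rule \<gamma>_vimage[OF E(1)])
  define c where "c x = \<gamma> (max 0 (min len x))" for x
  have cc: "continuous_on UNIV c" unfolding c_def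
    by (rule continuous_on_compose2[OF \<gamma>_cont]) (use len_pos in \<open>auto intro!: continuous_intros\<close>)
  then have cm [measurable]: "c \<in> borel_measurable borel" by (rule borel_measurable_continuous_onI)
  note q(1)[measurable] A[measurable]
  have kc: "k = (\<lambda>s. indicator ?A s *\<^sub>R (q (c s) / (c s - t)))"
    by (auto simp: k_def c_def indicator_def fun_eq_iff)
  have km: "k \<in> borel_measurable borel" unfolding kc by measurable
  have fin: "emeasure lborel ?A < \<infinity>"
    by (rule \<gamma>_vimage_finite)
  have kb: "cmod (k s) \<le> indicator ?A s * (1 / d)" for s
    using d q(2)[of "\<gamma> s"] by (auto simp: k_def indicator_def norm_divide intro!: frac_le)
  show ki: "integrable lborel k"
    by (rule Bochner_Integration.integrable_bound[of _ "\<lambda>s. indicator ?A s * (1 / d)"])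
       (use A fin km kb d(1) in auto)
  have trunc: "truncated_cauchy g f t R = 1 / (complex_of_real pi * \<i>) * (\<integral>s. k s \<partial>lborel)" if R: "0 < R" "R < d" for R
  proof -
    let ?B = "{s \<in> {0..len}. \<gamma> s \<in> \<Gamma> - portion g t R}"
    let ?h = "\<lambda>s. indicator ?B s *\<^sub>R (f (\<gamma> s) / (\<gamma> s - t) * vector_derivative \<gamma> (at s within {0..len}))"
    have ep: "AE x in lborel. x \<noteq> 0 \<and> x \<noteq> len"
      using AE_lborel_singleton[of 0] AE_lborel_singleton[of len] by (auto elim: AE_mp)
    have "AE s in lborel. k s = ?h s"
      using \<phi>(3) ep
    proof eventually_elim
      fix s assume s: "s \<in> {0<..<len} \<longrightarrow> (\<gamma> has_vector_derivative \<phi> s) (at s)" "s \<noteq> 0 \<and> s \<noteq> len"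
      show "k s = ?h s"
      proof (cases "s \<in> {0<..<len}")
        case False
        then have "s \<notin> {0..len}" using s(2) by auto
        then show ?thesis by (auto simp: k_def indicator_def)
      next
        case True
        then have sI: "s \<in> {0..len}" by auto
        have vd: "vector_derivative \<gamma> (at s within {0..len}) = \<phi> s"
          using s(1) True by (simp add: at_within_Icc_at vector_derivative_at)
        have "cnj (\<phi> s) * \<phi> s = 1" using \<phi>(2)[of s] complex_norm_square[of "\<phi> s"] by (simp add: mult.commute)
        then have "f (\<gamma> s) / (\<gamma> s - t) * \<phi> s = indicator E (\<gamma> s) * q (\<gamma> s) / (\<gamma> s - t)"
          unfolding f[OF sI] by (simp add: mult.assoc)
        moreover have "\<gamma> s \<in> E \<Longrightarrow> s \<in> ?B" using d(2)[of "\<gamma> s"] R \<gamma>_in[OF sI] sI by (auto simp: portion_def)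
        ultimately show ?thesis using sI by (auto simp: k_def vd indicator_def)
      qed
    qed
    then have AE: "AE s in lebesgue. k s = ?h s" by (rule AE_completion)
    have km': "k \<in> borel_measurable lebesgue" using km by (simp add: measurable_completion)
    have "integral\<^sup>L lebesgue ?h = integral\<^sup>L lebesgue k"
      using borel_measurable_AE[OF km' AE] km' AE by (intro integral_cong_AE) auto
    also have "\<dots> = integral\<^sup>L lborel k" using km by (simp add: integral_completion)
    finally show ?thesis
      unfolding truncated_cauchy_def dtau_integral_def len_unfold set_lebesgue_integral_def by simp
  qed
  have "\<forall>\<^sub>F R in at_right 0. truncated_cauchy g f t R = 1 / (complex_of_real pi * \<i>) * (\<integral>s. k s \<partial>lborel)"
    unfolding eventually_at_right_field using trunc d(1) by (intro exI[of _ d]) auto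
  then have "(truncated_cauchy g f t \<longlongrightarrow> 1 / (complex_of_real pi * \<i>) * (\<integral>s. k s \<partial>lborel)) (at_right 0)"
    by (rule tendsto_eventually)
  then show "cauchy_S g f t = 1 / (complex_of_real pi * \<i>) * (\<integral>s. k s \<partial>lborel)"
    unfolding cauchy_S_def by (intro tendsto_Lim) auto
qed

text \<open>On \<open>E\<close> the Cauchy kernel at \<open>t\<close>, multiplied by \<open>q\<close> and by one constant rotation, stays in a half-plane
to the right of \<open>\<kappa>\<close>: its integral over \<open>E\<close> cannot suffer cancellation. The number \<open>d\<close> keeps \<open>t\<close> away
from \<open>E\<close>, so that the principal value is an ordinary integral.\<close>

definition aligned :: "(complex \<Rightarrow> complex) \<Rightarrow> real \<Rightarrow> complex set \<Rightarrow> complex \<Rightarrow> bool" where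
  "aligned q \<kappa> E t \<longleftrightarrow> (\<exists>c d. cmod c = 1 \<and> 0 < d \<and>
     (\<forall>\<tau>\<in>E. d \<le> cmod (\<tau> - t) \<and> \<kappa> \<le> Re (c * (q \<tau> / (\<tau> - t)))))"

text \<open>The test function is the indicator of \<open>E\<close> times \<open>q\<close> times the conjugate unit tangent, written as a
function on the curve through the inverse of the arc-length parametrization.\<close>

lemma phase_function:
  assumes E: "E \<in> sets borel" "E \<subseteq> \<Gamma>" and q: "q \<in> borel_measurable borel" "\<And>\<tau>. cmod (q \<tau>) \<le> 1"
  shows "\<exists>f. f \<in> borel_measurable \<mu> \<and> (\<forall>\<tau>. cmod (f \<tau>) \<le> indicator E \<tau>) \<and>
    (\<forall>t \<kappa>. aligned q \<kappa> E t \<longrightarrow> \<kappa> * measure \<mu> E / pi \<le> cmod (cauchy_S g f t))"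
proof -
  obtain \<phi> where \<phi>: "\<phi> \<in> borel_measurable borel" "\<And>x. cmod (\<phi> x) = 1"
      "AE x in lborel. x \<in> {0<..<len} \<longrightarrow> (\<gamma> has_vector_derivative \<phi> x) (at x)"
    by (rule unit_speed_derivative) (rule that)
  define \<sigma> where "\<sigma> = the_inv_into {0..len} \<gamma>"
  have \<sigma>c: "continuous_on \<Gamma> \<sigma>"
    unfolding \<sigma>_def using continuous_on_inv_into[OF \<gamma>_cont _ \<gamma>_inj] by (simp add: \<gamma>_image)
  have \<sigma>\<gamma>: "\<sigma> (\<gamma> s) = s" if "s \<in> {0..len}" for s unfolding \<sigma>_def by (rule the_inv_into_f_f[OF \<gamma>_inj that])
  define f where "f \<tau> = indicator E \<tau> * q \<tau> * cnj (\<phi> (\<sigma> \<tau>))" for \<tau>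
  have \<sigma>m: "\<sigma> \<in> borel_measurable (restrict_space borel \<Gamma>)" by (rule borel_measurable_continuous_on_restrict[OF \<sigma>c])
  have m1: "(\<lambda>\<tau>. cnj (\<phi> (\<sigma> \<tau>))) \<in> borel_measurable (restrict_space borel \<Gamma>)"
    by (rule measurable_compose[OF measurable_compose[OF \<sigma>m \<phi>(1)]]) (auto intro: borel_measurable_continuous_onI continuous_intros)
  have m2: "(\<lambda>\<tau>. indicator E \<tau> * q \<tau>) \<in> borel_measurable (restrict_space borel \<Gamma>)"
    by (rule measurable_restrict_space1) (use q(1) E in measurable)
  have fm: "f \<in> borel_measurable (restrict_space borel \<Gamma>)"
    unfolding f_def by (rule borel_measurable_times[OF m2 m1])
  show ?thesis
  proof (intro exI[of _ f] conjI allI impI)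
    show "f \<in> borel_measurable \<mu>" by (rule borel_measurable_\<mu>[OF fm])
    show "cmod (f \<tau>) \<le> indicator E \<tau>" for \<tau> using q(2)[of \<tau>] \<phi>(2) by (auto simp: f_def norm_mult indicator_def)
    fix t \<kappa> assume "aligned q \<kappa> E t"
    then obtain c d where c: "cmod c = 1" and d: "0 < d" "\<And>\<tau>. \<tau> \<in> E \<Longrightarrow> d \<le> cmod (\<tau> - t)"
      and \<kappa>: "\<And>\<tau>. \<tau> \<in> E \<Longrightarrow> \<kappa> \<le> Re (c * (q \<tau> / (\<tau> - t)))"
      unfolding aligned_def by blast
    let ?A = "{s\<in>{0..len}. \<gamma> s \<in> E}"
    have f\<gamma>: "f (\<gamma> s) = indicator E (\<gamma> s) * q (\<gamma> s) * cnj (\<phi> s)" if "s \<in> {0..len}" for s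
      using \<sigma>\<gamma>[OF that] by (simp add: f_def)
    note S = cauchy_S_separated[where f = f and t = t, OF \<phi> E q d f\<gamma>]
    have "\<kappa> * measure lborel ?A \<le> cmod (\<integral>s. indicator ?A s *\<^sub>R (q (\<gamma> s) / (\<gamma> s - t)) \<partial>lborel)"
    proof (rule Re_integral_lower_bound[OF S(1) \<gamma>_vimage[OF E(1)] _ c])
      show "emeasure lborel ?A < \<infinity>"
        by (rule \<gamma>_vimage_finite)
      show "\<kappa> * indicator ?A s \<le> Re (c * (indicator ?A s *\<^sub>R (q (\<gamma> s) / (\<gamma> s - t))))" for s
        using \<kappa>[of "\<gamma> s"] by (auto simp: indicator_def)
    qed
    then show "\<kappa> * measure \<mu> E / pi \<le> cmod (cauchy_S g f t)"
    proof -
      have "cauchy_S g f t = 1 / (complex_of_real pi * \<i>) * (\<integral>s. indicator ?A s *\<^sub>R (q (\<gamma> s) / (\<gamma> s - t)) \<partial>lborel)"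
        by (rule S(2))
      then have "cmod (cauchy_S g f t) = cmod (\<integral>s. indicator ?A s *\<^sub>R (q (\<gamma> s) / (\<gamma> s - t)) \<partial>lborel) / pi"
        by (simp add: norm_mult norm_divide)
      moreover assume "\<kappa> * measure lborel ?A \<le> cmod (\<integral>s. indicator ?A s *\<^sub>R (q (\<gamma> s) / (\<gamma> s - t)) \<partial>lborel)"
      ultimately show ?thesis using measure_\<mu>[OF E] by (simp add: divide_right_mono)
    qed
  qed
qed

end

section \<open>Boundedness of the Cauchy integral compares indicator functions\<close>

lemma Re_inverse_one_minus_lower_bound:
  assumes "cmod z \<le> 1 / 4" shows "1 / 4 \<le> Re (1 / (1 - z))"
proof -
  have z: "\<bar>Re z\<bar> \<le> 1 / 4" "(Im z)\<^sup>2 \<le> (1/4)\<^sup>2"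
    using assms abs_Re_le_cmod[of z] abs_Im_le_cmod[of z] by (auto simp: abs_le_square_iff[symmetric])
  have "(1 - Re z)\<^sup>2 \<le> (5/4)\<^sup>2" using z by (intro power_mono) auto
  then have "(1 - Re z)\<^sup>2 + (Im z)\<^sup>2 \<le> 26/16" using z by (simp add: power2_eq_square)
  moreover have "0 < (1 - Re z)\<^sup>2 + (Im z)\<^sup>2" using z by (intro add_pos_nonneg) auto
  ultimately have "1 / 4 \<le> (1 - Re z) / ((1 - Re z)\<^sup>2 + (Im z)\<^sup>2)" using z by (simp add: le_divide_eq)
  then show ?thesis by (simp add: Re_divide)
qed

context rect_arc begin

text \<open>The modular form of \<open>\<kappa> |E| \<parallel>1\<^sub>F\<parallel> \<le> C \<parallel>1\<^sub>E\<parallel>\<close>: the test function \<open>f\<close> of the preceding lemma is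
dominated by the indicator of \<open>E\<close>, while \<open>\<bar>S f\<bar>\<close> dominates \<open>\<kappa> |E| / \<pi>\<close> times the indicator of \<open>F\<close>.\<close>

lemma bounded_S_transfers_modular:
  assumes S: "S_bounded g p w" and p: "\<forall>\<tau>\<in>\<Gamma>. 1 < p \<tau>"
  shows "\<exists>C>0. \<forall>E F q \<kappa> \<Lambda>. E \<in> sets borel \<and> E \<subseteq> \<Gamma> \<and> 0 < measure \<mu> E \<and>
      q \<in> borel_measurable borel \<and> (\<forall>\<tau>. cmod (q \<tau>) \<le> 1) \<and> 0 < \<kappa> \<and> 0 < \<Lambda> \<and> (\<forall>t\<in>F. aligned q \<kappa> E t) \<and>
      modular g p w (indicator E) \<Lambda> \<le> 1 \<longrightarrow> modular g p w (indicator F) (C * \<Lambda> / (\<kappa> * measure \<mu> E)) \<le> 1"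
proof -
  obtain C0 where C0: "\<And>f. f \<in> var_Lp g p w \<Longrightarrow>
      cauchy_S g f \<in> var_Lp g p w \<and> var_norm g p w (cauchy_S g f) \<le> C0 * var_norm g p w f"
    using S unfolding S_bounded_def by blast
  \<comment> \<open>The summand \<open>1\<close> gives a strict inequality below the infimum in the norm; \<open>pi\<close> is the factor in
    the definition of the Cauchy integral.\<close>
  define C where "C = (\<bar>C0\<bar> + 1) * pi"
  show ?thesis
  proof (intro exI[of _ C] conjI allI impI; (elim conjE)?)
    show "0 < C" by (simp add: C_def)
    fix E F :: "complex set" and q :: "complex \<Rightarrow> complex" and \<kappa> \<Lambda> :: real
    assume E: "E \<in> sets borel" "E \<subseteq> \<Gamma>" and mE: "0 < measure \<mu> E"
      and q: "q \<in> borel_measurable borel" "\<forall>\<tau>. cmod (q \<tau>) \<le> 1" and \<kappa>: "0 < \<kappa>" and \<Lambda>: "0 < \<Lambda>"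
      and F: "\<forall>t\<in>F. aligned q \<kappa> E t" and m1: "modular g p w (indicator E) \<Lambda> \<le> 1"
    have ps: "\<And>\<tau>. \<tau> \<in> space \<mu> \<Longrightarrow> 1 < p \<tau>" using p by (simp add: space_\<mu>)
    obtain f where f: "f \<in> borel_measurable \<mu>" "\<And>\<tau>. cmod (f \<tau>) \<le> indicator E \<tau>"
      and fS: "\<And>t \<kappa>. aligned q \<kappa> E t \<Longrightarrow> \<kappa> * measure \<mu> E / pi \<le> cmod (cauchy_S g f t)"
      using phase_function[OF E q(1)] q(2) by blast
    have fm: "modular g p w f \<Lambda> \<le> 1"
    proof (rule order.trans[OF modular_mono m1])
      fix \<tau> assume "\<tau> \<in> space \<mu>"
      moreover have "ennreal (cmod (f \<tau>)) \<le> ennreal (cmod (indicator E \<tau>))" using f(2)[of \<tau>] by (intro ennreal_leI) (cases "\<tau> \<in> E"; simp)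
      ultimately show "0 < p \<tau> \<and> ennreal (cmod (f \<tau>)) / ennreal \<Lambda> \<le> ennreal (cmod (indicator E \<tau>)) / ennreal \<Lambda>"
        using ps[of \<tau>] by (auto intro: divide_right_mono_ennreal)
    qed
    then have fV: "f \<in> var_Lp g p w" unfolding var_Lp_def using f(1) \<Lambda> by (auto intro!: exI[of _ \<Lambda>] simp: order.strict_trans1)
    have "var_norm g p w f \<le> \<Lambda>"
      unfolding var_norm_def by (rule cInf_lower) (use fm \<Lambda> in \<open>auto intro!: bdd_belowI[of _ 0]\<close>)
    have n0: "0 \<le> var_norm g p w f"
      unfolding var_norm_def by (rule cInf_greatest) (use fm \<Lambda> in auto)
    have "var_norm g p w (cauchy_S g f) \<le> C0 * var_norm g p w f" using C0[OF fV] by simp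
    also have "\<dots> \<le> \<bar>C0\<bar> * \<Lambda>" using n0 \<open>var_norm g p w f \<le> \<Lambda>\<close> by (intro mult_mono) auto
    also have "\<dots> < (\<bar>C0\<bar> + 1) * \<Lambda>" using \<Lambda> by simp
    finally have lt: "var_norm g p w (cauchy_S g f) < (\<bar>C0\<bar> + 1) * \<Lambda>" .
    have "\<exists>l'>0. modular g p w (cauchy_S g f) l' \<le> 1"
      using C0[OF fV] modular_le_1_exists[of g p, OF ps] unfolding var_Lp_def by blast
    then obtain l where l: "0 < l" "modular g p w (cauchy_S g f) l \<le> 1" "l < (\<bar>C0\<bar> + 1) * \<Lambda>"
      using cInf_lessD[OF _ lt[unfolded var_norm_def]] by auto
    have "modular g p w (indicator F) (C * \<Lambda> / (\<kappa> * measure \<mu> E)) \<le> modular g p w (cauchy_S g f) l"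
    proof (rule modular_mono)
      fix t assume t: "t \<in> space \<mu>"
      have "ennreal (cmod (indicator F t)) / ennreal (C * \<Lambda> / (\<kappa> * measure \<mu> E)) \<le> ennreal (cmod (cauchy_S g f t)) / ennreal l"
      proof (cases "t \<in> F")
        case True
        then have *: "\<kappa> * measure \<mu> E / pi \<le> cmod (cauchy_S g f t)" using F fS by blast
        have "1 / (C * \<Lambda> / (\<kappa> * measure \<mu> E)) = (\<kappa> * measure \<mu> E / pi) / ((\<bar>C0\<bar> + 1) * \<Lambda>)"
          by (simp add: C_def field_simps)
        also have "\<dots> \<le> cmod (cauchy_S g f t) / l"
          using * l \<kappa> mE by (intro frac_le) auto
        finally have "ennreal (1 / (C * \<Lambda> / (\<kappa> * measure \<mu> E))) \<le> ennreal (cmod (cauchy_S g f t) / l)" by (rule ennreal_leI)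
        moreover have "0 < C * \<Lambda> / (\<kappa> * measure \<mu> E)" using \<Lambda> \<kappa> mE by (simp add: C_def)
        ultimately show ?thesis using True l by (simp add: divide_ennreal[symmetric] del: divide_divide_eq_right)
      qed simp
      then show "0 < p t \<and> ennreal (cmod (indicator F t)) / ennreal (C * \<Lambda> / (\<kappa> * measure \<mu> E)) \<le> ennreal (cmod (cauchy_S g f t)) / ennreal l"
        using ps[OF t] by auto
    qed
    then show "modular g p w (indicator F) (C * \<Lambda> / (\<kappa> * measure \<mu> E)) \<le> 1" using l(2) by (rule order.trans)
  qed
qed

definition near_far :: "complex \<Rightarrow> real \<Rightarrow> complex set \<Rightarrow> complex set \<Rightarrow> bool" where
  "near_far t0 R E F \<longleftrightarrow> E \<in> sets borel \<and> E \<subseteq> \<Gamma> \<and> F \<in> sets borel \<and> F \<subseteq> \<Gamma> \<and> 0 < R \<and>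
     (\<forall>\<tau>\<in>E. 4 * cmod (\<tau> - t0) \<le> R) \<and> (\<forall>\<tau>\<in>F. R \<le> cmod (\<tau> - t0) \<and> cmod (\<tau> - t0) \<le> 2 * R)"

text \<open>With \<open>z = (x - t\<^sub>0) / (y - t\<^sub>0)\<close>, which has modulus at most \<open>1/4\<close>, the kernel is
\<open>1 / (y - x) = 1 / ((y - t\<^sub>0) (1 - z))\<close>, and \<open>1 / (1 - z)\<close>
has real part at least \<open>1/4\<close>.\<close>

lemma near_far_kernel:
  assumes "4 * cmod (x - t0) \<le> R" "R \<le> cmod (y - t0)" "cmod (y - t0) \<le> 2 * R" and R: "0 < R"
  shows "R / 2 \<le> cmod (y - x)" "1 / (8 * R) \<le> Re ((y - t0) / of_real (cmod (y - t0)) / (y - x))"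
proof -
  show "R / 2 \<le> cmod (y - x)" using norm_triangle_ineq4[of "y - x" "t0 - x"] assms by (simp add: norm_minus_commute)
  have y0: "y - t0 \<noteq> 0" using assms by auto
  define z where "z = (x - t0) / (y - t0)"
  have z: "cmod z \<le> 1 / 4" using assms y0 by (simp add: z_def norm_divide divide_le_eq)
  have "y - x = (y - t0) * (1 - z)" using y0 by (simp add: z_def field_simps)
  then have "(y - t0) / of_real (cmod (y - t0)) / (y - x) = (1 / (1 - z)) / of_real (cmod (y - t0))"
    using y0 by simp
  then have "Re ((y - t0) / of_real (cmod (y - t0)) / (y - x)) = Re (1 / (1 - z)) / cmod (y - t0)"
    by (simp only: Re_divide_of_real)
  moreover have "(1/4) / (2 * R) \<le> Re (1 / (1 - z)) / cmod (y - t0)"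
    using assms Re_inverse_one_minus_lower_bound[OF z] by (intro frac_le) auto
  ultimately show "1 / (8 * R) \<le> Re ((y - t0) / of_real (cmod (y - t0)) / (y - x))" by simp
qed

text \<open>The rotation of the kernel depends only on the point of \<open>F\<close>. When \<open>F\<close> carries the evaluation points
it is a constant; when \<open>F\<close> carries the integration variable it is absorbed into \<open>q\<close>.\<close>

lemma near_far_aligned:
  assumes nf: "near_far t0 R E F"
  shows "t \<in> F \<Longrightarrow> aligned (\<lambda>_. 1) (1 / (8 * R)) E t"
    and "t \<in> E \<Longrightarrow> aligned (\<lambda>\<tau>. (\<tau> - t0) / of_real (cmod (\<tau> - t0))) (1 / (8 * R)) F t"
proof -
  have R: "0 < R" using nf by (simp add: near_far_def)
  have k: "R / 2 \<le> cmod (y - x)" "1 / (8 * R) \<le> Re ((y - t0) / of_real (cmod (y - t0)) / (y - x))"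
    if "x \<in> E" "y \<in> F" for x y
    using near_far_kernel[of x t0 R y] nf that by (auto simp: near_far_def)
  show "aligned (\<lambda>_. 1) (1 / (8 * R)) E t" if t: "t \<in> F"
    unfolding aligned_def
  proof (intro exI[of _ "- ((t - t0) / of_real (cmod (t - t0)))"] exI[of _ "R / 2"] conjI ballI)
    have "t - t0 \<noteq> 0" using nf t R by (auto simp: near_far_def)
    then show "cmod (- ((t - t0) / of_real (cmod (t - t0)))) = 1" by (simp add: norm_divide)
    fix \<tau> assume \<tau>: "\<tau> \<in> E"
    show "R / 2 \<le> cmod (\<tau> - t)" using k(1)[OF \<tau> t] by (simp add: norm_minus_commute)
    have "- ((t - t0) / of_real (cmod (t - t0))) * (1 / (\<tau> - t)) = (t - t0) / of_real (cmod (t - t0)) / (t - \<tau>)"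
      by (metis (no_types, opaque_lifting) divide_inverse minus_diff_eq minus_mult_commute mult.right_neutral mult_1 inverse_minus_eq)
    then show "1 / (8 * R) \<le> Re (- ((t - t0) / of_real (cmod (t - t0))) * (1 / (\<tau> - t)))" using k(2)[OF \<tau> t] by simp
  qed (use R in simp)
  show "aligned (\<lambda>\<tau>. (\<tau> - t0) / of_real (cmod (\<tau> - t0))) (1 / (8 * R)) F t" if t: "t \<in> E"
    unfolding aligned_def using k[OF t] R by (intro exI[of _ 1] exI[of _ "R / 2"]) auto
qed

text \<open>The two inequalities between the norms of the indicators, with \<open>\<kappa> = 1 / (8 R)\<close>. A bound \<open>\<Lambda>\<close> on the
norm is expressed by a modular of at most \<open>1\<close> at \<open>\<Lambda>\<close>, which is what the later estimates of the weight
produce and consume.\<close>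

lemma near_far_transfer:
  assumes S: "S_bounded g p w" and p: "\<forall>\<tau>\<in>\<Gamma>. 1 < p \<tau>"
  shows "\<exists>C>0. \<forall>t0 R E F \<Lambda>. near_far t0 R E F \<and> 0 < \<Lambda> \<longrightarrow>
      (0 < measure \<mu> E \<and> modular g p w (indicator E) \<Lambda> \<le> 1 \<longrightarrow> modular g p w (indicator F) (C * \<Lambda> * R / measure \<mu> E) \<le> 1) \<and>
      (0 < measure \<mu> F \<and> modular g p w (indicator F) \<Lambda> \<le> 1 \<longrightarrow> modular g p w (indicator E) (C * \<Lambda> * R / measure \<mu> F) \<le> 1)"
proof -
  obtain C where C: "0 < C" and T: "\<And>E F q \<kappa> \<Lambda>. E \<in> sets borel \<and> E \<subseteq> \<Gamma> \<and> 0 < measure \<mu> E \<and>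
      q \<in> borel_measurable borel \<and> (\<forall>\<tau>. cmod (q \<tau>) \<le> 1) \<and> 0 < \<kappa> \<and> 0 < \<Lambda> \<and> (\<forall>t\<in>F. aligned q \<kappa> E t) \<and>
      modular g p w (indicator E) \<Lambda> \<le> 1 \<longrightarrow> modular g p w (indicator F) (C * \<Lambda> / (\<kappa> * measure \<mu> E)) \<le> 1"
    using bounded_S_transfers_modular[OF S p] by blast
  have q: "(\<lambda>\<tau>. (\<tau> - t0) / complex_of_real (cmod (\<tau> - t0))) \<in> borel_measurable borel"
    "cmod ((\<tau> - t0) / complex_of_real (cmod (\<tau> - t0))) \<le> 1" for t0 \<tau>
    by measurable (simp add: norm_divide)
  have eq: "C * \<Lambda> / (1 / (8 * R) * m) = 8 * C * \<Lambda> * R / m" for \<Lambda> R m :: real by simp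
  show ?thesis
  proof (intro exI[of _ "8 * C"] conjI allI impI; (elim conjE)?)
    show "0 < 8 * C" using C by simp
    fix t0 :: complex and R \<Lambda> :: real and E F :: "complex set"
    assume nf: "near_far t0 R E F" and \<Lambda>: "0 < \<Lambda>"
    note sets = nf[unfolded near_far_def]
    show "modular g p w (indicator F) (8 * C * \<Lambda> * R / measure \<mu> E) \<le> 1"
      if m: "0 < measure \<mu> E" "modular g p w (indicator E) \<Lambda> \<le> 1"
      unfolding eq[symmetric]
      by (rule T[rule_format, of E "\<lambda>_. 1" "1 / (8 * R)"]) (use sets m \<Lambda> near_far_aligned(1)[OF nf] in auto)
    show "modular g p w (indicator E) (8 * C * \<Lambda> * R / measure \<mu> F) \<le> 1"
      if m: "0 < measure \<mu> F" "modular g p w (indicator F) \<Lambda> \<le> 1"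
      unfolding eq[symmetric]
      by (rule T[rule_format, of F "\<lambda>\<tau>. (\<tau> - t0) / of_real (cmod (\<tau> - t0))" "1 / (8 * R)"])
        (use sets m \<Lambda> near_far_aligned(2)[OF nf] q in auto)
  qed
qed

end

section \<open>Carleson curves\<close>

text \<open>The first time \<open>d\<close> at which \<open>v\<close> is reached, and the last time \<open>c\<close> before it at which \<open>h\<close> is at most \<open>u\<close>.\<close>

lemma crossing_interval:
  fixes h :: "real \<Rightarrow> real"
  assumes h: "continuous_on {a..b} h" and ab: "a \<le> b" and le: "h a \<le> u" "v \<le> h b" and uv: "u < v"
  obtains c d where "a \<le> c" "c \<le> d" "d \<le> b" "h c \<le> u" "v \<le> h d" "\<And>x. c < x \<Longrightarrow> x < d \<Longrightarrow> u < h x \<and> h x < v"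
proof -
  let ?D = "{x\<in>{a..b}. v \<le> h x}"
  have "closed ?D" by (rule continuous_on_closed_Collect_le[OF continuous_on_const h]) simp
  then have "compact ?D" using compact_Int_closed[OF compact_Icc[of a b], of ?D] by (simp add: Int_def conj_ac)
  moreover have "?D \<noteq> {}" using ab le by auto
  ultimately obtain d where d: "d \<in> ?D" "\<And>x. x \<in> ?D \<Longrightarrow> d \<le> x" using compact_attains_inf[of ?D] by blast
  let ?C = "{x\<in>{a..d}. h x \<le> u}"
  have h': "continuous_on {a..d} h" using d by (intro continuous_on_subset[OF h]) auto
  have "closed ?C" by (rule continuous_on_closed_Collect_le[OF h' continuous_on_const]) simp
  then have "compact ?C" using compact_Int_closed[OF compact_Icc[of a d], of ?C] by (simp add: Int_def conj_ac)
  moreover have "?C \<noteq> {}" using d le by auto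
  ultimately obtain c where c: "c \<in> ?C" "\<And>x. x \<in> ?C \<Longrightarrow> x \<le> c" using compact_attains_sup[of ?C] by blast
  show ?thesis
  proof (rule that[of c d])
    fix x assume x: "c < x" "x < d"
    have "\<not> h x \<le> u" "\<not> v \<le> h x" using c(2)[of x] d(2)[of x] x c(1) d(1) by auto
    then show "u < h x \<and> h x < v" by simp
  qed (use c d in auto)
qed

context rect_arc begin

definition annulus :: "complex \<Rightarrow> real \<Rightarrow> complex set" where
  "annulus t R = {\<tau>\<in>\<Gamma>. R \<le> cmod (\<tau> - t) \<and> cmod (\<tau> - t) < 2 * R}"

lemma annulus_borel: "annulus t R \<in> sets borel"
proof -
  have "{\<tau>. R \<le> cmod (\<tau> - t)} \<in> sets borel" "{\<tau>. cmod (\<tau> - t) < 2 * R} \<in> sets borel"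
    by (auto intro!: borel_closed borel_open closed_Collect_le open_Collect_less continuous_intros)
  then have "\<Gamma> \<inter> {\<tau>. R \<le> cmod (\<tau> - t)} \<inter> {\<tau>. cmod (\<tau> - t) < 2 * R} \<in> sets borel"
    using \<Gamma>_borel by (intro sets.Int)
  then show ?thesis by (simp add: annulus_def Int_def conj_ac)
qed

lemma portion_borel: "portion g t R \<in> sets borel"
proof -
  have "{\<tau>. cmod (\<tau> - t) < R} \<in> sets borel"
    by (auto intro!: borel_open open_Collect_less continuous_intros)
  then have "\<Gamma> \<inter> {\<tau>. cmod (\<tau> - t) < R} \<in> sets borel"
    using \<Gamma>_borel by (intro sets.Int)
  then show ?thesis by (simp add: portion_def Int_def conj_ac)
qed

lemma annulus_sub: "annulus t R \<subseteq> \<Gamma>" and portion_sub: "portion g t R \<subseteq> \<Gamma>"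
  by (auto simp: annulus_def portion_def)

text \<open>The curve connects \<open>t\<close> to a point outside the disc of radius \<open>2R\<close>, so some subarc crosses the annulus,
and the distance to \<open>t\<close> is 1-Lipschitz in arc length.\<close>

lemma annulus_measure_ge:
  assumes t: "t \<in> \<Gamma>" and z: "z \<in> \<Gamma>" "2 * R \<le> cmod (z - t)" and R: "0 < R"
  shows "R \<le> measure \<mu> (annulus t R)"
proof -
  define h where "h s = cmod (\<gamma> s - t)" for s
  have hc: "continuous_on {0..len} h" unfolding h_def by (intro continuous_intros \<gamma>_cont)
  have hl: "\<bar>h s - h u\<bar> \<le> \<bar>s - u\<bar>" if "s \<in> {0..len}" "u \<in> {0..len}" for s u
    using norm_triangle_ineq3[of "\<gamma> s - t" "\<gamma> u - t"] \<gamma>_lipschitz[OF that] by (simp add: h_def)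
  obtain s0 s1 where s: "s0 \<in> {0..len}" "\<gamma> s0 = t" "s1 \<in> {0..len}" "\<gamma> s1 = z"
    using t z(1) \<gamma>_image by (metis imageE)
  have "\<exists>c d. 0 \<le> c \<and> c \<le> d \<and> d \<le> len \<and> R \<le> d - c \<and> (\<forall>x. c < x \<and> x < d \<longrightarrow> R < h x \<and> h x < 2 * R)"
  proof (cases "s0 \<le> s1")
    case True
    obtain c d where cd: "s0 \<le> c" "c \<le> d" "d \<le> s1" "h c \<le> R" "2 * R \<le> h d" "\<And>x. c < x \<Longrightarrow> x < d \<Longrightarrow> R < h x \<and> h x < 2 * R"
      using crossing_interval[of s0 s1 h R "2 * R"] continuous_on_subset[OF hc, of "{s0..s1}"] True s z R
      by (auto simp: h_def)
    then have "R \<le> d - c" using hl[of d c] s by auto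
    then show ?thesis using cd s by (intro exI[of _ c] exI[of _ d]) auto
  next
    case False
    have "continuous_on {- s0..- s1} (\<lambda>x. h (- x))"
      by (rule continuous_on_compose2[OF hc]) (use s in \<open>auto intro!: continuous_intros\<close>)
    then obtain c d where cd: "- s0 \<le> c" "c \<le> d" "d \<le> - s1" "h (- c) \<le> R" "2 * R \<le> h (- d)"
        "\<And>x. c < x \<Longrightarrow> x < d \<Longrightarrow> R < h (- x) \<and> h (- x) < 2 * R"
      using crossing_interval[of "- s0" "- s1" "\<lambda>x. h (- x)" R "2 * R"] False s z R by (auto simp: h_def)
    have "R \<le> d - c" using hl[of "- d" "- c"] s cd by auto
    moreover have "R < h x \<and> h x < 2 * R" if "- d < x" "x < - c" for x using cd(6)[of "- x"] that by auto
    ultimately show ?thesis using cd s by (intro exI[of _ "- d"] exI[of _ "- c"]) auto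
  qed
  then obtain c d where cd: "0 \<le> c" "c \<le> d" "d \<le> len" "R \<le> d - c" "\<forall>x. c < x \<and> x < d \<longrightarrow> R < h x \<and> h x < 2 * R" by blast
  have "d - c = measure lborel {c<..<d}" using cd by simp
  also have "\<dots> \<le> measure lborel {s\<in>{0..len}. \<gamma> s \<in> annulus t R}"
  proof (rule measure_mono_fmeasurable)
    show "{c<..<d} \<subseteq> {s\<in>{0..len}. \<gamma> s \<in> annulus t R}"
      using cd \<gamma>_in by (fastforce simp: annulus_def h_def)
    show "{s\<in>{0..len}. \<gamma> s \<in> annulus t R} \<in> fmeasurable lborel"
      using \<gamma>_vimage[OF annulus_borel] \<gamma>_vimage_finite by (auto simp: fmeasurable_def)
  qed simp
  finally show ?thesis using cd(4) measure_\<mu>[OF annulus_borel annulus_sub] by simp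
qed

lemma singleton_null: "x \<in> \<Gamma> \<Longrightarrow> emeasure \<mu> {x} = 0"
proof -
  assume x: "x \<in> \<Gamma>"
  then obtain s where s: "s \<in> {0..len}" "\<gamma> s = x" using \<gamma>_image by (metis imageE)
  then have "{u\<in>{0..len}. \<gamma> u \<in> {x}} = {s}" using inj_onD[OF \<gamma>_inj] by auto
  then show ?thesis using x by (subst emeasure_\<mu>) auto
qed

lemma far_point: obtains D where "0 < D" "\<And>t. t \<in> \<Gamma> \<Longrightarrow> \<exists>z\<in>\<Gamma>. D \<le> cmod (z - t)"
proof (rule that[of "cmod (g 1 - g 0) / 2"])
  show "0 < cmod (g 1 - g 0) / 2" using inj_onD[OF g_inj, of 0 1] by auto
  fix t assume "t \<in> \<Gamma>"
  have "cmod (g 1 - g 0) \<le> cmod (g 1 - t) + cmod (g 0 - t)" using norm_triangle_ineq4[of "g 1 - t" "g 0 - t"] by simp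
  moreover have "g 0 \<in> \<Gamma>" "g 1 \<in> \<Gamma>" by (auto simp: path_image_def)
  ultimately show "\<exists>z\<in>\<Gamma>. cmod (g 1 - g 0) / 2 \<le> cmod (z - t)" by (metis field_sum_of_halves add_mono linorder_le_less_linear add_strict_mono not_le)
qed
end

text \<open>\<open>T\<close> collects the points where the weight may vanish or be infinite. Apart from them \<open>w\<close> is given by
the real-valued function \<open>W\<close>, for which the powers in the modular are ordinary real powers.\<close>

locale weighted_arc = rect_arc +
  fixes p :: "complex \<Rightarrow> real" and w :: "complex \<Rightarrow> ennreal" and W :: "complex \<Rightarrow> real" and T :: "complex set"
  assumes p_gt1: "\<forall>\<tau>\<in>path_image g. 1 < p \<tau>"
    and T_fin: "finite T"
    and W_cont: "continuous_on (path_image g - T) W"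
    and W_pos: "\<And>\<tau>. \<tau> \<in> path_image g - T \<Longrightarrow> 0 < W \<tau>"
    and w_W: "\<And>\<tau>. \<tau> \<in> path_image g - T \<Longrightarrow> w \<tau> = ennreal (W \<tau>)"
begin

lemma modular_indicator:
  assumes E: "E \<subseteq> \<Gamma> - T" and \<Lambda>: "0 < \<Lambda>"
  shows "modular g p w (indicator E) \<Lambda> = (\<integral>\<^sup>+\<tau>. ennreal ((W \<tau> / \<Lambda>) powr p \<tau>) * indicator E \<tau> \<partial>\<mu>)"
  unfolding modular_def
proof (rule nn_integral_cong)
  fix \<tau> assume "\<tau> \<in> space \<mu>"
  then have p: "1 < p \<tau>" using p_gt1 by (simp add: space_\<mu>)
  show "epowr (ennreal (cmod (indicator E \<tau>)) * w \<tau> / ennreal \<Lambda>) (p \<tau>) = ennreal ((W \<tau> / \<Lambda>) powr p \<tau>) * indicator E \<tau>"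
  proof (cases "\<tau> \<in> E")
    case True
    then have "0 < W \<tau>" "w \<tau> = ennreal (W \<tau>)" using E W_pos w_W by auto
    then show ?thesis using True \<Lambda> p by (simp add: divide_ennreal epowr_ennreal)
  qed (use p in \<open>simp add: epowr_def\<close>)
qed

lemma modular_indicator_le:
  assumes E: "E \<in> sets borel" "E \<subseteq> \<Gamma> - T" and \<Lambda>: "0 < \<Lambda>" and B: "\<And>\<tau>. \<tau> \<in> E \<Longrightarrow> (W \<tau> / \<Lambda>) powr p \<tau> \<le> B" "0 \<le> B"
  shows "modular g p w (indicator E) \<Lambda> \<le> ennreal (B * measure \<mu> E)"
proof -
  interpret finite_measure \<mu> by (rule \<mu>_finite)
  have s: "E \<in> sets \<mu>" using E by (intro sets_\<mu>) auto
  have "modular g p w (indicator E) \<Lambda> \<le> (\<integral>\<^sup>+\<tau>. ennreal B * indicator E \<tau> \<partial>\<mu>)"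
    unfolding modular_indicator[OF E(2) \<Lambda>] using B by (intro nn_integral_mono) (auto simp: indicator_def ennreal_leI)
  also have "\<dots> = ennreal (B * measure \<mu> E)"
    using s B by (simp add: nn_integral_cmult_indicator emeasure_eq_measure ennreal_mult)
  finally show ?thesis .
qed

lemma modular_indicator_ge:
  assumes E: "E \<in> sets borel" "E \<subseteq> \<Gamma> - T" and \<Lambda>: "0 < \<Lambda>" and B: "\<And>\<tau>. \<tau> \<in> E \<Longrightarrow> B \<le> (W \<tau> / \<Lambda>) powr p \<tau>" "0 \<le> B"
  shows "ennreal (B * measure \<mu> E) \<le> modular g p w (indicator E) \<Lambda>"
proof -
  interpret finite_measure \<mu> by (rule \<mu>_finite)
  have s: "E \<in> sets \<mu>" using E by (intro sets_\<mu>) auto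
  have "ennreal (B * measure \<mu> E) = (\<integral>\<^sup>+\<tau>. ennreal B * indicator E \<tau> \<partial>\<mu>)"
    using s B by (simp add: nn_integral_cmult_indicator emeasure_eq_measure ennreal_mult)
  also have "\<dots> \<le> modular g p w (indicator E) \<Lambda>"
    unfolding modular_indicator[OF E(2) \<Lambda>] using B by (intro nn_integral_mono) (auto simp: indicator_def ennreal_leI)
  finally show ?thesis .
qed

text \<open>Indicators of subsets of these sets belong to the weighted space, which may fail for a portion that
contains points of \<open>T\<close>; and they exhaust the curve up to the null set \<open>T\<close>.\<close>

definition tame :: "nat \<Rightarrow> complex set" where
  "tame j = {\<tau>\<in>\<Gamma> - T. W \<tau> \<le> real (Suc j) \<and> 1 / real (Suc j) \<le> W \<tau>}"

lemma tame_borel: "tame j \<in> sets borel"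
proof -
  have T: "\<Gamma> - T \<in> sets borel" using \<Gamma>_borel T_fin by (intro sets.Diff) (auto intro: borel_closed finite_imp_closed)
  have "W \<in> borel_measurable (restrict_space borel (\<Gamma> - T))" by (rule borel_measurable_continuous_on_restrict[OF W_cont])
  from measurable_sets[OF this, of "{1 / real (Suc j)..real (Suc j)}"]
  have "tame j \<in> sets (restrict_space borel (\<Gamma> - T))"
    by (simp add: tame_def space_restrict_space vimage_def Int_def conj_ac)
  then show ?thesis using T by (simp add: sets_restrict_space_iff)
qed

lemma tame_exhausts:
  assumes E: "E \<in> sets borel" "E \<subseteq> \<Gamma>"
  shows "(\<lambda>j. measure \<mu> (E \<inter> tame j)) \<longlonglongrightarrow> measure \<mu> E"
proof -
  interpret finite_measure \<mu> by (rule \<mu>_finite)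
  have inc: "incseq (\<lambda>j. E \<inter> tame j)"
  proof (rule incseq_SucI)
    fix j
    have "1 / real (Suc (Suc j)) \<le> 1 / real (Suc j)" by (intro divide_left_mono) auto
    then show "E \<inter> tame j \<subseteq> E \<inter> tame (Suc j)" unfolding tame_def by auto
  qed
  have U: "(\<Union>j. E \<inter> tame j) = E - T"
  proof
    show "(\<Union>j. E \<inter> tame j) \<subseteq> E - T" by (auto simp: tame_def)
    show "E - T \<subseteq> (\<Union>j. E \<inter> tame j)"
    proof
      fix x assume x: "x \<in> E - T"
      then have W: "0 < W x" using W_pos E by auto
      obtain j where j: "max (W x) (1 / W x) \<le> real j" using real_arch_simple by blast
      then have "W x \<le> real (Suc j)" "1 / W x \<le> real (Suc j)" by auto
      then have "1 / real (Suc j) \<le> W x" using W by (simp add: field_simps)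
      then show "x \<in> (\<Union>j. E \<inter> tame j)" using x E \<open>W x \<le> real (Suc j)\<close> by (auto simp: tame_def)
    qed
  qed
  have "(\<lambda>j. measure \<mu> (E \<inter> tame j)) \<longlonglongrightarrow> measure \<mu> (\<Union>j. E \<inter> tame j)"
    using E tame_borel inc by (intro finite_Lim_measure_incseq) (auto intro!: sets_\<mu>)
  moreover have "measure \<mu> (E - T) = measure \<mu> E"
  proof -
    have "E \<inter> T = (\<Union>x\<in>E \<inter> T. {x})" by auto
    also have "\<dots> \<in> null_sets \<mu>"
      using T_fin E singleton_null by (intro null_sets_UN') (auto simp: null_sets_def countable_finite intro!: sets_\<mu>)
    finally have "measure \<mu> (E - E \<inter> T) = measure \<mu> E"
      using sets_\<mu>[OF E] by (intro measure_Diff_null_set) auto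
    then show ?thesis by (simp add: Diff_Int2 Diff_Int)
  qed
  ultimately show ?thesis by (simp only: U)
qed

text \<open>Transferring the modular from \<open>E\<close> to \<open>F\<close> and back shows that the norm of the indicator of \<open>E\<close> is at
most \<open>(C R)\<^sup>2 / (|E| |F|)\<close> times itself. As this norm is positive and finite for tame \<open>E\<close>, the factor
is at least \<open>1\<close>. Portions and annuli are then exhausted by tame sets, and annuli have length at
least their radius.\<close>

lemma carleson_bound:
  assumes S: "S_bounded g p w"
  obtains K where "0 < K" "\<And>t r. t \<in> \<Gamma> \<Longrightarrow> 0 < r \<Longrightarrow> measure \<mu> (portion g t r) \<le> K * r"
proof -
  interpret finite_measure \<mu> by (rule \<mu>_finite)
  obtain C where C: "0 < C" and AT: "\<And>t0 R E F \<Lambda>. near_far t0 R E F \<and> 0 < \<Lambda> \<longrightarrow>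
      (0 < measure \<mu> E \<and> modular g p w (indicator E) \<Lambda> \<le> 1 \<longrightarrow> modular g p w (indicator F) (C * \<Lambda> * R / measure \<mu> E) \<le> 1) \<and>
      (0 < measure \<mu> F \<and> modular g p w (indicator F) \<Lambda> \<le> 1 \<longrightarrow> modular g p w (indicator E) (C * \<Lambda> * R / measure \<mu> F) \<le> 1)"
    using near_far_transfer[OF S p_gt1] by blast
  obtain D where D: "0 < D" "\<And>t. t \<in> \<Gamma> \<Longrightarrow> \<exists>z\<in>\<Gamma>. D \<le> cmod (z - t)" using far_point by blast
  have product: "measure \<mu> E * measure \<mu> F \<le> (C * R)\<^sup>2"
    if nf: "near_far t0 R E F" and E: "E \<subseteq> tame j" for E F j R t0
  proof (rule ccontr)
    assume neg: "\<not> ?thesis"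
    let ?e = "measure \<mu> E" and ?f = "measure \<mu> F" and ?J = "real (Suc j)"
    have "0 < ?e * ?f" using neg zero_le_power2[of "C * R"] by linarith
    then have ef: "0 < ?e" "0 < ?f" using measure_nonneg[of \<mu>] by (auto simp: zero_less_mult_iff not_less[symmetric])
    have Eb: "E \<in> sets borel" and R: "0 < R" using nf by (auto simp: near_far_def)
    have sub: "E \<subseteq> \<Gamma> - T" using E by (auto simp: tame_def)
    have WE: "W \<tau> \<le> ?J" "1 / ?J \<le> W \<tau>" "0 < W \<tau>" "1 < p \<tau>" if "\<tau> \<in> E" for \<tau>
      using that E sub W_pos p_gt1 by (fastforce simp: tame_def)+
    \<comment> \<open>One round trip from \<open>E\<close> to \<open>F\<close> and back multiplies the admissible \<open>\<Lambda>\<close> by \<open>q\<close>.\<close>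
    define q where "q = (C * R)\<^sup>2 / (?e * ?f)"
    have q: "0 < q" "q < 1" using neg ef C R by (auto simp: q_def divide_less_eq)
    define \<Lambda>0 where "\<Lambda>0 = ?J * max 1 ?e"
    have \<Lambda>0: "0 < \<Lambda>0" by (simp add: \<Lambda>0_def)
    have step: "modular g p w (indicator E) (q * \<Lambda>) \<le> 1" if "0 < \<Lambda>" "modular g p w (indicator E) \<Lambda> \<le> 1" for \<Lambda>
    proof -
      have 1: "modular g p w (indicator F) (C * \<Lambda> * R / ?e) \<le> 1"
        using AT[of t0 R E F \<Lambda>] nf that ef by blast
      have pos: "0 < C * \<Lambda> * R / ?e" using C that R ef by simp
      have "modular g p w (indicator E) (C * (C * \<Lambda> * R / ?e) * R / ?f) \<le> 1"
        using AT[of t0 R E F "C * \<Lambda> * R / ?e"] nf pos ef 1 by blast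
      moreover have "C * (C * \<Lambda> * R / ?e) * R / ?f = q * \<Lambda>" by (simp add: q_def power2_eq_square)
      ultimately show ?thesis by simp
    qed
    have start: "modular g p w (indicator E) \<Lambda>0 \<le> 1"
    proof -
      have "modular g p w (indicator E) \<Lambda>0 \<le> ennreal (1 / max 1 ?e * ?e)"
      proof (rule modular_indicator_le[OF Eb sub \<Lambda>0])
        fix \<tau> assume \<tau>: "\<tau> \<in> E"
        have "W \<tau> / ?J \<le> 1" using WE(1)[OF \<tau>] by (simp add: divide_le_eq)
        then have "W \<tau> / ?J / max 1 ?e \<le> 1 / max 1 ?e" by (intro divide_right_mono) auto
        then have "W \<tau> / \<Lambda>0 \<le> 1 / max 1 ?e" by (simp only: \<Lambda>0_def divide_divide_eq_left)
        then have "(W \<tau> / \<Lambda>0) powr p \<tau> \<le> (1 / max 1 ?e) powr p \<tau>" using WE[OF \<tau>] \<Lambda>0 by (intro powr_mono2) auto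
        also have "\<dots> \<le> (1 / max 1 ?e) powr 1" using WE[OF \<tau>] by (intro powr_mono') auto
        finally show "(W \<tau> / \<Lambda>0) powr p \<tau> \<le> 1 / max 1 ?e" by simp
      qed simp
      also have "\<dots> \<le> 1" by (auto simp: max_def divide_le_eq intro: ennreal_leI[of _ 1, simplified])
      finally show ?thesis .
    qed
    have iter: "modular g p w (indicator E) (q ^ n * \<Lambda>0) \<le> 1" for n
    proof (induction n)
      case (Suc n)
      then show ?case using step[of "q ^ n * \<Lambda>0"] q \<Lambda>0 by (simp add: mult.assoc)
    qed (use start in simp)
    have low: "min 1 ?e / ?J / 2 \<le> \<Lambda>" if "0 < \<Lambda>" "modular g p w (indicator E) \<Lambda> \<le> 1" for \<Lambda>
    proof (rule ccontr)
      assume "\<not> ?thesis"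
      then have "\<Lambda> < min 1 ?e / ?J / 2" by (simp only: not_le)
      then have "\<Lambda> * 2 < min 1 ?e / ?J" by (simp only: pos_less_divide_eq[of 2, OF zero_less_numeral])
      then have "\<Lambda> * 2 * ?J < min 1 ?e" by (simp only: pos_less_divide_eq of_nat_0_less_iff zero_less_Suc)
      then have l: "\<Lambda> * ?J * 2 < min 1 ?e" by (simp only: mult_ac)
      have "ennreal (1 / (?J * \<Lambda>) * ?e) \<le> modular g p w (indicator E) \<Lambda>"
      proof (rule modular_indicator_ge[OF Eb sub that(1)])
        fix \<tau> assume \<tau>: "\<tau> \<in> E"
        have "1 \<le> 1 / (?J * \<Lambda>)" using l that(1) by (simp add: le_divide_eq mult.commute)
        then have "(1 / (?J * \<Lambda>)) powr 1 \<le> (1 / (?J * \<Lambda>)) powr p \<tau>" using WE[OF \<tau>] by (intro powr_mono) auto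
        also have "\<dots> \<le> (W \<tau> / \<Lambda>) powr p \<tau>"
        proof (rule powr_mono2)
          have "(1 / ?J) / \<Lambda> \<le> W \<tau> / \<Lambda>" using WE[OF \<tau>] that(1) by (intro divide_right_mono) auto
          then show "1 / (?J * \<Lambda>) \<le> W \<tau> / \<Lambda>" by simp
        qed (use WE[OF \<tau>] that(1) in auto)
        finally show "1 / (?J * \<Lambda>) \<le> (W \<tau> / \<Lambda>) powr p \<tau>" using that(1) by simp
      qed (use that in simp)
      then have "ennreal (1 / (?J * \<Lambda>) * ?e) \<le> 1" using that(2) by (rule order.trans)
      then have "1 / (?J * \<Lambda>) * ?e \<le> 1" by (simp only: ennreal_le_1)
      then have "?e \<le> ?J * \<Lambda>" using that(1) by (simp add: divide_le_eq)
      moreover have "0 < ?J * \<Lambda>" using that(1) by simp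
      ultimately show False using l by (simp add: mult.commute)
    qed
    have "(\<lambda>n. q ^ n * \<Lambda>0) \<longlonglongrightarrow> 0 * \<Lambda>0" using q by (intro tendsto_mult tendsto_const LIMSEQ_power_zero) auto
    moreover have "0 < min 1 ?e / ?J / 2" using ef by simp
    ultimately have "\<forall>\<^sub>F n in sequentially. q ^ n * \<Lambda>0 < min 1 ?e / ?J / 2" by (simp add: order_tendsto_iff)
    then obtain n where "q ^ n * \<Lambda>0 < min 1 ?e / ?J / 2" using eventually_happens by fastforce
    then show False using low[of "q ^ n * \<Lambda>0"] iter[of n] q \<Lambda>0 by auto
  qed
  have small: "measure \<mu> (portion g t r) \<le> 4 * C\<^sup>2 * r" if t: "t \<in> \<Gamma>" and r: "0 < r" "8 * r \<le> D" for t r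
  proof -
    \<comment> \<open>A point at distance at least \<open>D \<ge> 8 r\<close> from \<open>t\<close> lies beyond the annulus of radii \<open>4 r\<close> and \<open>8 r\<close>.\<close>
    let ?E = "portion g t r" and ?F = "annulus t (4 * r)"
    have "(\<lambda>j. measure \<mu> (?E \<inter> tame j) * measure \<mu> (?F \<inter> tame j)) \<longlonglongrightarrow> measure \<mu> ?E * measure \<mu> ?F"
      by (intro tendsto_mult tame_exhausts portion_borel annulus_borel portion_sub annulus_sub)
    then have "measure \<mu> ?E * measure \<mu> ?F \<le> (C * (4 * r))\<^sup>2"
    proof (rule LIMSEQ_le_const2)
      show "\<exists>N. \<forall>j\<ge>N. measure \<mu> (?E \<inter> tame j) * measure \<mu> (?F \<inter> tame j) \<le> (C * (4 * r))\<^sup>2"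
      proof (intro exI[of _ 0] allI impI)
        fix j :: nat
        show "measure \<mu> (?E \<inter> tame j) * measure \<mu> (?F \<inter> tame j) \<le> (C * (4 * r))\<^sup>2"
        proof (rule product)
          show "near_far t (4 * r) (?E \<inter> tame j) (?F \<inter> tame j)"
            unfolding near_far_def
          proof (intro conjI)
            show "?E \<inter> tame j \<in> sets borel" "?F \<inter> tame j \<in> sets borel"
              by (intro sets.Int portion_borel annulus_borel tame_borel)+
            show "\<forall>\<tau>\<in>?E \<inter> tame j. 4 * cmod (\<tau> - t) \<le> 4 * r" by (auto simp: portion_def)
            show "\<forall>\<tau>\<in>?F \<inter> tame j. 4 * r \<le> cmod (\<tau> - t)  \<and> cmod (\<tau> - t) \<le> 2 * (4 * r)" by (auto simp: annulus_def)
            show "?E \<inter> tame j \<subseteq> \<Gamma>" "?F \<inter> tame j \<subseteq> \<Gamma>" using portion_sub annulus_sub by blast+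
          qed (use r in simp)
          show "?E \<inter> tame j \<subseteq> tame j" by blast
        qed
      qed
    qed
    moreover have "4 * r \<le> measure \<mu> ?F" using D(2)[OF t] r annulus_measure_ge[OF t] by fastforce
    then have "measure \<mu> ?E * (4 * r) \<le> measure \<mu> ?E * measure \<mu> ?F" by (intro mult_left_mono) auto
    ultimately have "measure \<mu> ?E * (4 * r) \<le> (4 * C\<^sup>2 * r) * (4 * r)" by (simp add: power2_eq_square algebra_simps)
    then show ?thesis using r by (simp add: mult_ac)
  qed
  show ?thesis
  proof (rule that[of "4 * C\<^sup>2 + 8 * measure \<mu> \<Gamma> / D"])
    show "0 < 4 * C\<^sup>2 + 8 * measure \<mu> \<Gamma> / D" using C D by (intro add_pos_nonneg) auto
    fix t r assume t: "t \<in> \<Gamma>" and r: "0 < (r :: real)"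
    show "measure \<mu> (portion g t r) \<le> (4 * C\<^sup>2 + 8 * measure \<mu> \<Gamma> / D) * r"
    proof (cases "8 * r \<le> D")
      case True
      have "0 \<le> 8 * measure \<mu> \<Gamma> / D * r" using D r by simp
      then show ?thesis using small[OF t r True] by (simp add: algebra_simps)
    next
      case False
      have "measure \<mu> (portion g t r) \<le> measure \<mu> \<Gamma>"
        using portion_sub \<Gamma>_borel by (intro finite_measure_mono sets_\<mu>) auto
      also have "\<dots> \<le> measure \<mu> \<Gamma> * (8 * r / D)" using False D by (intro mult_le_cancel_left1[THEN iffD2]) (auto simp: le_divide_eq)
      also have "\<dots> \<le> (4 * C\<^sup>2 + 8 * measure \<mu> \<Gamma> / D) * r" using r by (simp add: algebra_simps)
      finally show ?thesis .
    qed
  qed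
qed

lemma carleson:
  assumes S: "S_bounded g p w"
  shows "carleson_curve g"
proof -
  interpret finite_measure \<mu> by (rule \<mu>_finite)
  obtain K where K: "0 < K" "\<And>t r. t \<in> \<Gamma> \<Longrightarrow> 0 < r \<Longrightarrow> measure \<mu> (portion g t r) \<le> K * r"
    using carleson_bound[OF S] by blast
  have "(SUP t \<in> \<Gamma>. SUP R \<in> {0<..}. emeasure \<mu> (portion g t R) / ennreal R) \<le> ennreal K"
  proof (intro SUP_least)
    fix t and R :: real assume t: "t \<in> \<Gamma>" and R: "R \<in> {0<..}"
    have "emeasure \<mu> (portion g t R) / ennreal R = ennreal (measure \<mu> (portion g t R) / R)"
      using R by (simp add: emeasure_eq_measure divide_ennreal)
    also have "\<dots> \<le> ennreal K" using K(2)[OF t, of R] R by (intro ennreal_leI) (simp add: divide_le_eq)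
    finally show "emeasure \<mu> (portion g t R) / ennreal R \<le> ennreal K" .
  qed
  also have "\<dots> < \<infinity>" by simp
  finally show ?thesis unfolding carleson_curve_def .
qed

end

section \<open>Scaling of the weight near a singular point\<close>

context weighted_arc begin

text \<open>On the annulus \<open>\<bar>p \<tau> - p t\<^sub>0\<bar> \<bar>ln R\<bar> \<le> 2 A\<close>: the log-Hoelder condition holds with \<open>ln \<bar>\<tau> - t\<^sub>0\<bar>\<close>, and
\<open>\<bar>\<tau> - t\<^sub>0\<bar> < 2 R\<close> with \<open>R \<le> 1/4\<close> costs only a factor \<open>2\<close>. So \<open>R\<close> to the power \<open>- p \<tau> / p t\<^sub>0\<close> is
\<open>1 / R\<close> up to constants.\<close>

lemma log_hoelder_power:
  assumes A: "0 < A"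
    and lh: "\<forall>\<tau>\<in>\<Gamma>. \<forall>s\<in>\<Gamma>. cmod (\<tau> - s) \<le> 1/2 \<longrightarrow> \<bar>p \<tau> - p s\<bar> \<le> - A / ln (cmod (\<tau> - s))"
    and t0: "t0 \<in> \<Gamma>" and R: "0 < R" "R \<le> 1/4" and \<tau>: "\<tau> \<in> annulus t0 R"
  shows "exp (- (2 * A)) / R \<le> (R powr (- (1 / p t0))) powr p \<tau>" "(R powr (- (1 / p t0))) powr p \<tau> \<le> exp (2 * A) / R"
proof -
  let ?x = "cmod (\<tau> - t0)"
  have p0: "1 < p t0" using p_gt1 t0 by blast
  have x: "R \<le> ?x" "?x < 2 * R" "\<tau> \<in> \<Gamma>" using \<tau> by (auto simp: annulus_def)
  have lnR: "ln R < 0" using R by simp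
  have l4: "ln R \<le> - 2 * ln 2"
  proof -
    have "ln R \<le> ln (1 / 4)" using R by (subst ln_le_cancel_iff) auto
    also have "\<dots> = - ln (2 ^ 2)" by (simp add: ln_div)
    also have "\<dots> = - 2 * ln 2" by (subst ln_realpow) auto
    finally show ?thesis .
  qed
  have "ln ?x \<le> ln (2 * R)" using x R by (subst ln_le_cancel_iff) auto
  also have "\<dots> = ln 2 + ln R" using R by (simp add: ln_mult)
  finally have lnx: "ln ?x \<le> ln R / 2" using l4 by linarith
  have "\<bar>p \<tau> - p t0\<bar> \<le> - A / ln ?x" using lh x t0 R by auto
  also have "\<dots> = A / (- ln ?x)" by simp
  also have "\<dots> \<le> A / (- ln R / 2)" using lnx lnR A by (intro divide_left_mono mult_pos_pos) auto
  finally have d: "\<bar>p \<tau> - p t0\<bar> * (- ln R) \<le> 2 * A" using lnR by (simp add: field_simps)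
  define \<theta> where "\<theta> = (p \<tau> - p t0) / p t0 * ln R"
  have "\<bar>\<theta>\<bar> = \<bar>p \<tau> - p t0\<bar> * (- ln R) / p t0" using p0 lnR by (simp add: \<theta>_def abs_mult)
  also have "\<dots> \<le> 2 * A / 1" using d p0 A lnR by (intro frac_le) auto
  finally have \<theta>: "\<bar>\<theta>\<bar> \<le> 2 * A" by simp
  have "(R powr (- (1 / p t0))) powr p \<tau> = exp (- \<theta> - ln R)"
    using R p0 by (simp add: powr_powr powr_def \<theta>_def field_simps)
  also have "\<dots> = exp (- \<theta>) / R" using R by (simp add: exp_diff)
  finally have eq: "(R powr (- (1 / p t0))) powr p \<tau> = exp (- \<theta>) / R" .
  show "exp (- (2 * A)) / R \<le> (R powr (- (1 / p t0))) powr p \<tau>" "(R powr (- (1 / p t0))) powr p \<tau> \<le> exp (2 * A) / R"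
    unfolding eq using \<theta> R by (auto intro!: divide_right_mono)
qed

text \<open>The indicator of the annulus of radius \<open>R\<close> has norm comparable to \<open>N R = b R * R powr (1 / p t\<^sub>0)\<close>: with
the Carleson bound from above (\<open>up\<close> in the proof), and because the annulus has length at least \<open>R\<close> from
below (\<open>low\<close>). Both directions of the transfer between two annuli then compare \<open>N r\<close> with \<open>N R\<close>.\<close>

lemma local_scaling:
  assumes S: "S_bounded g p w" and A: "0 < A"
    and lh: "\<forall>\<tau>\<in>\<Gamma>. \<forall>s\<in>\<Gamma>. cmod (\<tau> - s) \<le> 1/2 \<longrightarrow> \<bar>p \<tau> - p s\<bar> \<le> - A / ln (cmod (\<tau> - s))"
    and t0: "t0 \<in> \<Gamma>" and \<delta>0: "0 < \<delta>0" and H: "1 \<le> H"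
    and b: "\<And>R. 0 < R \<Longrightarrow> R < \<delta>0 \<Longrightarrow> 0 < b R"
    and Wb: "\<And>R \<tau>. 0 < R \<Longrightarrow> R < \<delta>0 \<Longrightarrow> \<tau> \<in> annulus t0 R \<Longrightarrow> \<tau> \<notin> T \<and> b R / H \<le> W \<tau> \<and> W \<tau> \<le> H * b R"
  shows "\<exists>C>0. \<exists>\<delta>>0. \<forall>r R. 0 < r \<and> 8 * r \<le> R \<and> R < \<delta> \<longrightarrow>
     b r * r powr (1 / p t0) \<le> C * (b R * R powr (1 / p t0)) \<and>
     b R * R powr (1 / p t0) * r \<le> C * (b r * r powr (1 / p t0)) * R"
proof -
  have p0: "1 < p t0" using p_gt1 t0 by blast
  obtain C where C: "0 < C" and NF: "\<And>t0 R E F \<Lambda>. near_far t0 R E F \<and> 0 < \<Lambda> \<longrightarrow>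
      (0 < measure \<mu> E \<and> modular g p w (indicator E) \<Lambda> \<le> 1 \<longrightarrow> modular g p w (indicator F) (C * \<Lambda> * R / measure \<mu> E) \<le> 1) \<and>
      (0 < measure \<mu> F \<and> modular g p w (indicator F) \<Lambda> \<le> 1 \<longrightarrow> modular g p w (indicator E) (C * \<Lambda> * R / measure \<mu> F) \<le> 1)"
    using near_far_transfer[OF S p_gt1] by blast
  obtain K where K: "0 < K" "\<And>t r. t \<in> \<Gamma> \<Longrightarrow> 0 < r \<Longrightarrow> measure \<mu> (portion g t r) \<le> K * r"
    using carleson_bound[OF S] by blast
  obtain D where D: "0 < D" "\<And>t. t \<in> \<Gamma> \<Longrightarrow> \<exists>z\<in>\<Gamma>. D \<le> cmod (z - t)" using far_point by blast
  interpret finite_measure \<mu> by (rule \<mu>_finite)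
  define \<delta> where "\<delta> = min \<delta>0 (min (1/4) (D / 2))"
  have \<delta>: "0 < \<delta>" using \<delta>0 D by (simp add: \<delta>_def)
  define N where "N R = b R * R powr (1 / p t0)" for R
  \<comment> \<open>In \<open>M\<close>, the factor \<open>H\<close> compensates the comparison of \<open>W\<close> with \<open>b\<close> and \<open>Y\<close> the product of the
    log-Hoelder constant with the Carleson bound \<open>2 K R\<close>; the factor \<open>2\<close> in \<open>M'\<close> makes the lower
    estimate of the modular exceed \<open>1\<close> strictly.\<close>
  define Y where "Y = 1 + 2 * K * exp (2 * A)"
  have Y: "1 \<le> Y" "0 < Y" using K(1) by (auto simp: Y_def intro: add_pos_pos)
  define M where "M = H * Y"
  define M' where "M' = 2 * H * exp (2 * A)"
  have M: "0 < M" "0 < M'" using H Y by (auto simp: M_def M'_def)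
  have ann: "R \<le> measure \<mu> (annulus t0 R)" "measure \<mu> (annulus t0 R) \<le> 2 * K * R"
      "annulus t0 R \<subseteq> \<Gamma> - T" "0 < N R" "0 < b R"
      "\<And>\<tau>. \<tau> \<in> annulus t0 R \<Longrightarrow> b R / H \<le> W \<tau> \<and> W \<tau> \<le> H * b R \<and> 1 < p \<tau>"
    if R: "0 < R" "R < \<delta>" for R
  proof -
    obtain z where "z \<in> \<Gamma>" "D \<le> cmod (z - t0)" using D(2)[OF t0] by blast
    then show "R \<le> measure \<mu> (annulus t0 R)" using R by (intro annulus_measure_ge[OF t0]) (auto simp: \<delta>_def)
    have "measure \<mu> (annulus t0 R) \<le> measure \<mu> (portion g t0 (2 * R))"
      by (intro finite_measure_mono sets_\<mu> portion_borel portion_sub) (auto simp: annulus_def portion_def)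
    also have "\<dots> \<le> K * (2 * R)" using K(2)[OF t0, of "2 * R"] R by simp
    finally show "measure \<mu> (annulus t0 R) \<le> 2 * K * R" by (simp add: mult_ac)
    show "annulus t0 R \<subseteq> \<Gamma> - T" using Wb[of R] R annulus_sub by (auto simp: \<delta>_def)
    show "0 < b R" using b[of R] R by (simp add: \<delta>_def)
    then show "0 < N R" using R by (simp add: N_def)
    show "b R / H \<le> W \<tau> \<and> W \<tau> \<le> H * b R \<and> 1 < p \<tau>" if "\<tau> \<in> annulus t0 R" for \<tau>
      using Wb[of R \<tau>] R that annulus_sub p_gt1 by (auto simp: \<delta>_def)
  qed
  have lhp: "exp (- (2 * A)) / R \<le> (R powr (- (1 / p t0))) powr p \<tau>" "(R powr (- (1 / p t0))) powr p \<tau> \<le> exp (2 * A) / R"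
    if "0 < R" "R < \<delta>" "\<tau> \<in> annulus t0 R" for R \<tau>
    using log_hoelder_power[OF A lh t0 that(1) _ that(3)] that(2) by (auto simp: \<delta>_def)
  have quot: "b R / (c * N R) = 1 / c * R powr (- (1 / p t0))" if "0 < R" "R < \<delta>" "0 < c" for R c
    using ann(5)[OF that(1,2)] that by (simp add: N_def powr_minus field_simps)
  have up: "modular g p w (indicator (annulus t0 R)) (M * N R) \<le> 1" if R: "0 < R" "R < \<delta>" for R
  proof -
    note a = ann[OF R]
    define c where "c = 1 / Y"
    have c: "0 < c" "c \<le> 1" using Y by (auto simp: c_def)
    have "modular g p w (indicator (annulus t0 R)) (M * N R) \<le> ennreal (c * exp (2 * A) / R * measure \<mu> (annulus t0 R))"
    proof (rule modular_indicator_le[OF annulus_borel a(3)])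
      show "0 < M * N R" "0 \<le> c * exp (2 * A) / R" using M a(4) c R by auto
      fix \<tau> assume \<tau>: "\<tau> \<in> annulus t0 R"
      have "W \<tau> / (M * N R) \<le> H * b R / (M * N R)" using a(6)[OF \<tau>] M a(4) by (intro divide_right_mono) auto
      also have "\<dots> = H * (b R / (M * N R))" by simp
      also have "\<dots> = H * (1 / M * R powr (- (1 / p t0)))" by (simp only: quot[OF R M(1)])
      also have "\<dots> = c * R powr (- (1 / p t0))" using H by (simp add: M_def c_def)
      finally have "(W \<tau> / (M * N R)) powr p \<tau> \<le> (c * R powr (- (1 / p t0))) powr p \<tau>"
      proof (intro powr_mono2)
        have "0 \<le> b R / H" using a(5) H by simp
        then have "0 \<le> W \<tau>" using a(6)[OF \<tau>] by linarith
        then show "0 \<le> W \<tau> / (M * N R)" using M a(4) by simp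
      qed (use a(6)[OF \<tau>] in auto)
      also have "\<dots> = c powr p \<tau> * (R powr (- (1 / p t0))) powr p \<tau>" using c by (simp add: powr_mult)
      also have "\<dots> \<le> c powr 1 * (exp (2 * A) / R)"
        using c a(6)[OF \<tau>] lhp(2)[OF R \<tau>] by (intro mult_mono powr_mono') auto
      finally show "(W \<tau> / (M * N R)) powr p \<tau> \<le> c * exp (2 * A) / R" using c by simp
    qed
    also have "\<dots> \<le> ennreal 1"
    proof (rule ennreal_leI)
      have "c * exp (2 * A) / R * measure \<mu> (annulus t0 R) \<le> c * exp (2 * A) / R * (2 * K * R)"
        using a(2) c R by (intro mult_left_mono) auto
      also have "\<dots> = c * (2 * K * exp (2 * A))" using R by simp
      also have "\<dots> \<le> 1" using Y by (simp add: c_def divide_le_eq Y_def)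
      finally show "c * exp (2 * A) / R * measure \<mu> (annulus t0 R) \<le> 1" .
    qed
    finally show ?thesis by simp
  qed
  have low: "N R \<le> M' * \<Lambda>" if R: "0 < R" "R < \<delta>" and \<Lambda>: "0 < \<Lambda>" "modular g p w (indicator (annulus t0 R)) \<Lambda> \<le> 1" for R \<Lambda>
  proof (rule ccontr)
    assume "\<not> N R \<le> M' * \<Lambda>"
    then have lt: "\<Lambda> < N R / M'" using M by (simp add: field_simps)
    note a = ann[OF R]
    have "ennreal (2 / R * measure \<mu> (annulus t0 R)) \<le> modular g p w (indicator (annulus t0 R)) \<Lambda>"
    proof (rule modular_indicator_ge[OF annulus_borel a(3) \<Lambda>(1)])
      show "0 \<le> 2 / R" using R by simp
      fix \<tau> assume \<tau>: "\<tau> \<in> annulus t0 R"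
      have "1 \<le> exp (2 * A)" using A by simp
      then have e: "1 \<le> 2 * exp (2 * A)" by linarith
      have "2 / R = 2 * exp (2 * A) * (exp (- (2 * A)) / R)" by (simp add: exp_minus)
      also have "\<dots> \<le> (2 * exp (2 * A)) powr p \<tau> * (R powr (- (1 / p t0))) powr p \<tau>"
        using lhp(1)[OF R \<tau>] powr_mono[of 1 "p \<tau>" "2 * exp (2 * A)"] a(6)[OF \<tau>] e R by (intro mult_mono) auto
      also have "\<dots> = (2 * exp (2 * A) * R powr (- (1 / p t0))) powr p \<tau>" by (simp add: powr_mult)
      also have "\<dots> \<le> (W \<tau> / \<Lambda>) powr p \<tau>"
      proof (rule powr_mono2)
        have "2 * exp (2 * A) * R powr (- (1 / p t0)) = b R / H / (N R / M')"
          using ann(5)[OF R] R H by (simp add: N_def M'_def powr_minus field_simps)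
        also have "\<dots> \<le> W \<tau> / \<Lambda>"
          using a(6)[OF \<tau>] lt \<Lambda> a(5) H by (intro frac_le) (auto intro: order.trans[of 0 "b R / H"])
        finally show "2 * exp (2 * A) * R powr (- (1 / p t0)) \<le> W \<tau> / \<Lambda>" .
      qed (use a(6)[OF \<tau>] in auto)
      finally show "2 / R \<le> (W \<tau> / \<Lambda>) powr p \<tau>" .
    qed
    then have "ennreal (2 / R * measure \<mu> (annulus t0 R)) \<le> 1" using \<Lambda>(2) by (rule order.trans)
    then have "2 / R * measure \<mu> (annulus t0 R) \<le> 1" by (simp only: ennreal_le_1)
    moreover have "2 / R * R \<le> 2 / R * measure \<mu> (annulus t0 R)" using a(1) R by (intro mult_left_mono) auto
    moreover have "2 / R * R = 2" using R by simp
    ultimately show False by linarith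
  qed
  have "b r * r powr (1 / p t0) \<le> M' * C * M * (b R * R powr (1 / p t0)) \<and>
     b R * R powr (1 / p t0) * r \<le> M' * C * M * (b r * r powr (1 / p t0)) * R"
    if rR: "0 < r" "8 * r \<le> R" "R < \<delta>" for r R
  proof -
    from rR have r: "0 < r" "r < \<delta>" and R: "0 < R" "R < \<delta>" by auto
    have nf: "near_far t0 R (annulus t0 r) (annulus t0 R)"
      unfolding near_far_def
    proof (intro conjI ballI annulus_borel annulus_sub R(1))
      show "4 * cmod (\<tau> - t0) \<le> R" if "\<tau> \<in> annulus t0 r" for \<tau> using that rR(2) by (simp add: annulus_def)
      show "R \<le> cmod (\<tau> - t0)" "cmod (\<tau> - t0) \<le> 2 * R" if "\<tau> \<in> annulus t0 R" for \<tau>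
        using that by (simp_all add: annulus_def)
    qed
    have pos: "0 < measure \<mu> (annulus t0 r)" "0 < measure \<mu> (annulus t0 R)"
      using ann(1)[OF r] ann(1)[OF R] r R by linarith+
    have "modular g p w (indicator (annulus t0 r)) (C * (M * N R) * R / measure \<mu> (annulus t0 R)) \<le> 1"
      using NF[of t0 R "annulus t0 r" "annulus t0 R" "M * N R"] nf pos up[OF R] M ann(4)[OF R] by auto
    then have "N r \<le> M' * (C * (M * N R) * R / measure \<mu> (annulus t0 R))"
      using C M ann(4)[OF R] R pos by (intro low[OF r]) auto
    also have "\<dots> \<le> M' * (C * (M * N R) * R / R)"
      using C M ann(1,4)[OF R] R by (intro mult_left_mono divide_left_mono mult_pos_pos) (auto intro!: mult_nonneg_nonneg)
    finally have 1: "b r * r powr (1 / p t0) \<le> M' * C * M * (b R * R powr (1 / p t0))" using R by (simp add: N_def mult_ac)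
    have "modular g p w (indicator (annulus t0 R)) (C * (M * N r) * R / measure \<mu> (annulus t0 r)) \<le> 1"
      using NF[of t0 R "annulus t0 r" "annulus t0 R" "M * N r"] nf pos up[OF r] M ann(4)[OF r] by auto
    then have "N R \<le> M' * (C * (M * N r) * R / measure \<mu> (annulus t0 r))"
      using C M ann(4)[OF r] R pos by (intro low[OF R]) auto
    also have "\<dots> \<le> M' * (C * (M * N r) * R / r)"
      using C M ann(1,4)[OF r] R r by (intro mult_left_mono divide_left_mono mult_pos_pos) (auto intro!: mult_nonneg_nonneg)
    finally have "N R * r \<le> M' * (C * (M * N r) * R / r) * r" using r by (intro mult_right_mono) auto
    then have "b R * R powr (1 / p t0) * r \<le> M' * C * M * (b r * r powr (1 / p t0)) * R" using r by (simp add: N_def mult_ac)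
    with 1 show ?thesis by blast
  qed
  moreover have "0 < M' * C * M" using M C by simp
  ultimately show ?thesis using \<delta> by blast
qed

end

section \<open>Matuszewska--Orlicz indices\<close>

text \<open>Fekete's lemma for a continuous parameter. The limit is the infimum of \<open>F s / s\<close> over \<open>s \<ge> 1\<close>: if
\<open>F a / a\<close> is close to it, writing \<open>s = n a + b\<close> with \<open>0 < b \<le> a\<close> shows that \<open>F s / s\<close> exceeds \<open>F a / a\<close>
by at most a multiple of \<open>1 / s\<close>.\<close>

lemma fekete_continuous:
  fixes F :: "real \<Rightarrow> real"
  assumes sub: "\<And>s t. 0 < s \<Longrightarrow> 0 < t \<Longrightarrow> F (s + t) \<le> F s + F t"
    and bd: "\<And>s. 0 < s \<Longrightarrow> \<bar>F s\<bar> \<le> K * (1 + s)"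
  shows "\<exists>l. ((\<lambda>s. F s / s) \<longlongrightarrow> l) at_top"
proof -
  define L where "L = Inf ((\<lambda>s. F s / s) ` {1..})"
  have K: "0 \<le> K" using bd[of 1] by simp
  have "- (2 * K) \<le> F s / s" if "1 \<le> s" for s
  proof -
    have "- (K * (1 + s)) \<le> F s" using bd[of s] that by linarith
    moreover have "K * (1 + s) \<le> 2 * K * s" using mult_left_mono[of 1 s K] that K by (simp add: algebra_simps)
    ultimately show ?thesis using that by (simp add: le_divide_eq)
  qed
  then have bb: "bdd_below ((\<lambda>s. F s / s) ` {1..})" by (intro bdd_belowI[of _ "- (2 * K)"]) auto
  have iter: "F (real n * a + b) \<le> real n * F a + F b" if "0 < a" "0 < b" for n a b
  proof (induction n)
    case (Suc n)
    have "F (a + (real n * a + b)) \<le> F a + F (real n * a + b)" using that by (intro sub add_nonneg_pos) auto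
    then show ?case using Suc by (simp add: algebra_simps)
  qed simp
  have "((\<lambda>s. F s / s) \<longlongrightarrow> L) at_top"
  proof (rule order_tendstoI)
    fix y assume y: "y < L"
    show "\<forall>\<^sub>F s in at_top. y < F s / s"
    proof (rule eventually_at_top_linorderI[of 1])
      fix s :: real assume "1 \<le> s"
      then have "L \<le> F s / s" unfolding L_def by (intro cInf_lower bb) auto
      then show "y < F s / s" using y by simp
    qed
  next
    fix y assume "L < y"
    then obtain a where a: "1 \<le> a" "F a / a < y"
      unfolding L_def using bb by (subst (asm) cInf_less_iff) auto
    define B where "B = a * \<bar>F a / a\<bar> + K * (1 + a)"
    have up: "F s / s \<le> F a / a + B / s" if s: "1 \<le> s" for s
    proof -
      \<comment> \<open>The ceiling keeps the remainder \<open>b\<close> strictly positive, as subadditivity requires.\<close>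
      define n where "n = nat (\<lceil>s / a\<rceil> - 1)"
      define b where "b = s - real n * a"
      have "0 < s / a" using s a by simp
      then have "real n = of_int \<lceil>s / a\<rceil> - 1" by (simp add: n_def)
      then have "real n < s / a" "s / a \<le> real n + 1" by linarith+
      then have b: "0 < b" "b \<le> a" using a by (simp_all add: b_def field_simps)
      have e1: "F s \<le> real n * F a + F b" using iter[of a b n] a b by (simp add: b_def)
      have e2: "F b \<le> K * (1 + a)" using bd[of b] b K mult_left_mono[of b a K] by (simp add: algebra_simps)
      have e3: "real n * F a = s * (F a / a) - b * (F a / a)" using a by (simp add: b_def field_simps)
      have "b * (- (F a / a)) \<le> b * \<bar>F a / a\<bar>" using b by (intro mult_left_mono abs_ge_minus_self) auto
      also have "\<dots> \<le> a * \<bar>F a / a\<bar>" using b by (intro mult_right_mono) auto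
      finally have e4: "- (b * (F a / a)) \<le> a * \<bar>F a / a\<bar>" by simp
      have "F s \<le> s * (F a / a) + B" unfolding B_def using e1 e2 e3 e4 by linarith
      then show ?thesis using s by (simp add: field_simps)
    qed
    have "((\<lambda>s. F a / a + B / s) \<longlongrightarrow> F a / a + 0) at_top"
      by (intro tendsto_intros tendsto_divide_0[OF tendsto_const] filterlim_at_top_imp_at_infinity filterlim_ident)
    then have "\<forall>\<^sub>F s in at_top. F a / a + B / s < y" using a(2) by (simp add: order_tendsto_iff)
    then show "\<forall>\<^sub>F s in at_top. F s / s < y"
      using eventually_ge_at_top[of 1] by eventually_elim (use up in force)
  qed
  then show ?thesis by blast
qed

text \<open>Almost-monotonicity of \<open>x\<^sup>\<alpha> \<rho>\<close> and of \<open>x\<^sup>\<beta> / \<rho>\<close> restated as two-sided power bounds for the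
real-valued function behind \<open>\<rho>\<close>.\<close>

lemma class_WW_real:
  assumes "\<rho> \<in> class_WW L"
  obtains C \<alpha> \<beta> where "1 \<le> C" "continuous_on {0<..L} (\<lambda>x. enn2real (\<rho> x))"
    "\<And>x. 0 < x \<Longrightarrow> x \<le> L \<Longrightarrow> 0 < enn2real (\<rho> x) \<and> \<rho> x = ennreal (enn2real (\<rho> x))"
    "\<And>x y. 0 < x \<Longrightarrow> x \<le> y \<Longrightarrow> y \<le> L \<Longrightarrow> enn2real (\<rho> x) \<le> C * (y / x) powr \<alpha> * enn2real (\<rho> y)"
    "\<And>x y. 0 < x \<Longrightarrow> x \<le> y \<Longrightarrow> y \<le> L \<Longrightarrow> enn2real (\<rho> y) \<le> C * (y / x) powr \<beta> * enn2real (\<rho> x)"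
proof -
  obtain \<alpha> \<beta> u v where u: "u \<in> class_W L" and v: "v \<in> class_W L"
    and eq: "\<And>x. x \<in> {0<..L} \<Longrightarrow> ennreal (x powr \<alpha>) * \<rho> x = ennreal (u x) \<and> ennreal (x powr \<beta>) / \<rho> x = ennreal (v x)"
    using assms unfolding class_WW_def by blast
  obtain C1 where C1: "0 < C1" "\<And>x y. x \<in> {0..L} \<Longrightarrow> y \<in> {0..L} \<Longrightarrow> x \<le> y \<Longrightarrow> u x \<le> C1 * u y"
    using u unfolding class_W_def by blast
  obtain C2 where C2: "0 < C2" "\<And>x y. x \<in> {0..L} \<Longrightarrow> y \<in> {0..L} \<Longrightarrow> x \<le> y \<Longrightarrow> v x \<le> C2 * v y"
    using v unfolding class_W_def by blast
  have upos: "0 < u x" if "x \<in> {0<..L}" for x using u that unfolding class_W_def by blast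
  define r where "r x = enn2real (\<rho> x)" for x
  have r: "0 < r x" "\<rho> x = ennreal (r x)" "u x = x powr \<alpha> * r x" "v x = x powr \<beta> / r x" if x: "x \<in> {0<..L}" for x
  proof -
    have pow: "0 < x powr \<alpha>" "0 < x powr \<beta>" using x by auto
    have "\<rho> x \<noteq> top" using eq[OF x] pow by (auto simp: ennreal_mult_eq_top_iff)
    moreover have "\<rho> x \<noteq> 0" using eq[OF x] upos[OF x] by auto
    ultimately show 1: "0 < r x" "\<rho> x = ennreal (r x)"
      by (auto simp: r_def enn2real_positive_iff less_top zero_less_iff_neq_zero)
    have "ennreal (x powr \<alpha> * r x) = ennreal (u x)" using eq[OF x] 1 by (simp add: ennreal_mult)
    then show "u x = x powr \<alpha> * r x" using 1 upos[OF x] by (subst (asm) ennreal_inj) auto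
    have v0: "0 < v x" using v x unfolding class_W_def by blast
    have "ennreal (x powr \<beta> / r x) = ennreal (v x)" using eq[OF x] 1 by (simp add: divide_ennreal)
    then show "v x = x powr \<beta> / r x" using 1 v0 by (subst (asm) ennreal_inj) auto
  qed
  have rc: "continuous_on {0<..L} r"
  proof -
    have "continuous_on {0<..L} (\<lambda>x. u x / x powr \<alpha>)"
      using u unfolding class_W_def
      by (auto intro!: continuous_intros elim: continuous_on_subset)
    then show ?thesis by (rule continuous_on_cong[THEN iffD1, rotated 2]) (use r in auto)
  qed
  show ?thesis
  proof (rule that[of "max 1 (max C1 C2)" \<alpha> \<beta>])
    show "continuous_on {0<..L} (\<lambda>x. enn2real (\<rho> x))" using rc by (simp add: r_def[abs_def])
    show "0 < enn2real (\<rho> x) \<and> \<rho> x = ennreal (enn2real (\<rho> x))" if "0 < x" "x \<le> L" for x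
    proof -
      have m: "x \<in> {0<..L}" using that by simp
      show ?thesis using r(1)[OF m] r(2)[OF m] unfolding r_def by (rule conjI)
    qed
    fix x y assume xy: "0 < x" "x \<le> y" "y \<le> L"
    then have m: "x \<in> {0<..L}" "y \<in> {0<..L}" by auto
    have "x powr \<alpha> * r x \<le> C1 * (y powr \<alpha> * r y)" using C1(2)[of x y] r(3) m xy by simp
    then have "r x \<le> C1 * (y powr \<alpha> / x powr \<alpha>) * r y" using xy by (simp add: field_simps)
    also have "\<dots> \<le> max 1 (max C1 C2) * (y powr \<alpha> / x powr \<alpha>) * r y"
      using r(1)[OF m(2)] by (intro mult_right_mono) auto
    finally show "enn2real (\<rho> x) \<le> max 1 (max C1 C2) * (y / x) powr \<alpha> * enn2real (\<rho> y)"
      using xy by (simp add: powr_divide r_def)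
    have "x powr \<beta> / r x \<le> C2 * (y powr \<beta> / r y)" using C2(2)[of x y] r(4) m xy by simp
    then have "r y \<le> C2 * (y powr \<beta> / x powr \<beta>) * r x" using xy r(1)[OF m(1)] r(1)[OF m(2)] by (simp add: field_simps)
    also have "\<dots> \<le> max 1 (max C1 C2) * (y powr \<beta> / x powr \<beta>) * r x"
      using r(1)[OF m(1)] by (intro mult_right_mono) auto
    finally show "enn2real (\<rho> y) \<le> max 1 (max C1 C2) * (y / x) powr \<beta> * enn2real (\<rho> x)"
      using xy by (simp add: powr_divide r_def)
  qed simp
qed

locale WW_weight =
  fixes \<rho> :: "real \<Rightarrow> ennreal" and L :: real
  assumes L: "0 < L" and \<rho>: "\<rho> \<in> class_WW L"
begin

definition r :: "real \<Rightarrow> real" where "r x = enn2real (\<rho> x)"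
definition \<phi> :: "real \<Rightarrow> real" where "\<phi> x = enn2real (Phi0 \<rho> x)"

lemma r_pos: "0 < x \<Longrightarrow> x \<le> L \<Longrightarrow> 0 < r x" and \<rho>_r: "0 < x \<Longrightarrow> x \<le> L \<Longrightarrow> \<rho> x = ennreal (r x)"
  using class_WW_real[OF \<rho>] unfolding r_def by metis+

lemma eventually_ratio:
  assumes x: "0 < x"
  shows "\<forall>\<^sub>F y in at_right 0. 0 < y \<and> y \<le> L \<and> x * y \<le> L \<and> \<rho> (x * y) / \<rho> y = ennreal (r (x * y) / r y)"
proof -
  have "0 < min L (L / x)" using x L by simp
  then have "\<forall>\<^sub>F y in at_right 0. y \<in> {0<..<min L (L / x)}" by (rule eventually_at_right_real)
  then show ?thesis
  proof eventually_elim
    fix y assume "y \<in> {0<..<min L (L / x)}"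
    then have y: "0 < y" "y \<le> L" "x * y \<le> L" using x by (auto simp: field_simps)
    then have "\<rho> (x * y) / \<rho> y = ennreal (r (x * y) / r y)"
      using \<rho>_r[of "x * y"] \<rho>_r[of y] r_pos[of "x * y"] r_pos[of y] x by (simp add: divide_ennreal less_imp_le)
    then show "0 < y \<and> y \<le> L \<and> x * y \<le> L \<and> \<rho> (x * y) / \<rho> y = ennreal (r (x * y) / r y)" using y by simp
  qed
qed

lemma Phi0_le:
  assumes x: "0 < x" and B: "\<forall>\<^sub>F y in at_right 0. r (x * y) / r y \<le> B"
  shows "Phi0 \<rho> x \<le> ennreal B"
  unfolding Phi0_def
proof (rule Limsup_bounded)
  show "\<forall>\<^sub>F y in at_right 0. \<rho> (x * y) / \<rho> y \<le> ennreal B"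
    using B eventually_ratio[OF x] by eventually_elim (simp add: ennreal_leI)
qed

lemma Phi0_ge:
  assumes x: "0 < x" and B: "\<forall>\<^sub>F y in at_right 0. B \<le> r (x * y) / r y"
  shows "ennreal B \<le> Phi0 \<rho> x"
  unfolding Phi0_def
proof (rule le_Limsup)
  show "\<forall>\<^sub>F y in at_right 0. ennreal B \<le> \<rho> (x * y) / \<rho> y"
    using B eventually_ratio[OF x] by eventually_elim (simp add: ennreal_leI)
qed simp

text \<open>The power bounds of the class give \<open>\<bar>ln \<phi>\<bar>\<close> at most linear growth in \<open>\<bar>ln x\<bar>\<close>, which is the
boundedness that Fekete's lemma asks for.\<close>

lemma Phi0_bounds: obtains K where "0 \<le> K"
  "\<And>x. 0 < x \<Longrightarrow> 0 < \<phi> x \<and> Phi0 \<rho> x = ennreal (\<phi> x) \<and> \<bar>ln (\<phi> x)\<bar> \<le> K * (1 + \<bar>ln x\<bar>)"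
proof -
  obtain C \<alpha> \<beta> where C: "1 \<le> C" and
    up: "\<And>x y. 0 < x \<Longrightarrow> x \<le> y \<Longrightarrow> y \<le> L \<Longrightarrow> r x \<le> C * (y / x) powr \<alpha> * r y" and
    dn: "\<And>x y. 0 < x \<Longrightarrow> x \<le> y \<Longrightarrow> y \<le> L \<Longrightarrow> r y \<le> C * (y / x) powr \<beta> * r x"
    using class_WW_real[OF \<rho>] unfolding r_def by metis
  define K where "K = ln C + \<bar>\<alpha>\<bar> + \<bar>\<beta>\<bar>"
  have K: "0 \<le> K" using C by (simp add: K_def)
  have "0 < \<phi> x \<and> Phi0 \<rho> x = ennreal (\<phi> x) \<and> \<bar>ln (\<phi> x)\<bar> \<le> K * (1 + \<bar>ln x\<bar>)" if x: "0 < x" for x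
  proof -
    have powb: "x powr e \<le> exp ((\<bar>\<alpha>\<bar> + \<bar>\<beta>\<bar>) * \<bar>ln x\<bar>)" "exp (- ((\<bar>\<alpha>\<bar> + \<bar>\<beta>\<bar>) * \<bar>ln x\<bar>)) \<le> x powr e"
      if "\<bar>e\<bar> \<le> \<bar>\<alpha>\<bar> + \<bar>\<beta>\<bar>" for e
    proof -
      have "\<bar>e * ln x\<bar> \<le> (\<bar>\<alpha>\<bar> + \<bar>\<beta>\<bar>) * \<bar>ln x\<bar>" using that by (simp add: abs_mult mult_right_mono)
      then show "x powr e \<le> exp ((\<bar>\<alpha>\<bar> + \<bar>\<beta>\<bar>) * \<bar>ln x\<bar>)" "exp (- ((\<bar>\<alpha>\<bar> + \<bar>\<beta>\<bar>) * \<bar>ln x\<bar>)) \<le> x powr e"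
        using x by (auto simp: powr_def)
    qed
    define Q where "Q = C * exp ((\<bar>\<alpha>\<bar> + \<bar>\<beta>\<bar>) * \<bar>ln x\<bar>)"
    have Q: "0 < Q" using C by (simp add: Q_def)
    have Qinv: "1 / Q = (1 / C) * exp (- ((\<bar>\<alpha>\<bar> + \<bar>\<beta>\<bar>) * \<bar>ln x\<bar>))" by (simp add: Q_def exp_minus divide_inverse)
    have ratio: "1 / Q \<le> r (x * y) / r y \<and> r (x * y) / r y \<le> Q" if y: "0 < y" "y \<le> L" "x * y \<le> L" for y
    proof -
      have rp: "0 < r y" "0 < r (x * y)" using r_pos[of y] r_pos[of "x * y"] x y by auto
      have "\<exists>e e'. \<bar>e\<bar> \<le> \<bar>\<alpha>\<bar> + \<bar>\<beta>\<bar> \<and> \<bar>e'\<bar> \<le> \<bar>\<alpha>\<bar> + \<bar>\<beta>\<bar> \<and> r (x * y) \<le> C * x powr e * r y \<and> r y \<le> C * x powr e' * r (x * y)"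
      proof (cases "1 \<le> x")
        case True
        have "r (x * y) \<le> C * x powr \<beta> * r y" "r y \<le> C * x powr \<alpha> * r (x * y)"
          using dn[of y "x * y"] up[of y "x * y"] True y by auto
        then show ?thesis by (intro exI[of _ \<beta>] exI[of _ \<alpha>]) auto
      next
        case False
        have "r (x * y) \<le> C * x powr (- \<alpha>) * r y" "r y \<le> C * x powr (- \<beta>) * r (x * y)"
          using up[of "x * y" y] dn[of "x * y" y] False x y by (auto simp: powr_minus powr_divide field_simps)
        then show ?thesis by (intro exI[of _ "- \<alpha>"] exI[of _ "- \<beta>"]) auto
      qed
      then obtain e e' where e: "\<bar>e\<bar> \<le> \<bar>\<alpha>\<bar> + \<bar>\<beta>\<bar>" "\<bar>e'\<bar> \<le> \<bar>\<alpha>\<bar> + \<bar>\<beta>\<bar>" "r (x * y) \<le> C * x powr e * r y" "r y \<le> C * x powr e' * r (x * y)"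
        by blast
      have "r (x * y) \<le> Q * r y"
        by (rule order.trans[OF e(3)]) (use powb(1)[OF e(1)] rp C in \<open>auto simp: Q_def intro!: mult_right_mono\<close>)
      moreover have "r y \<le> Q * r (x * y)"
        by (rule order.trans[OF e(4)]) (use powb(1)[OF e(2)] rp C in \<open>auto simp: Q_def intro!: mult_right_mono\<close>)
      ultimately show ?thesis using rp Q by (simp add: field_simps)
    qed
    have "Phi0 \<rho> x \<le> ennreal Q"
      by (rule Phi0_le[OF x]) (use eventually_ratio[OF x] in eventually_elim, use ratio in auto)
    moreover have "ennreal (1 / Q) \<le> Phi0 \<rho> x"
      by (rule Phi0_ge[OF x]) (use eventually_ratio[OF x] in eventually_elim, use ratio in auto)
    ultimately have b: "1 / Q \<le> \<phi> x" "\<phi> x \<le> Q" "Phi0 \<rho> x = ennreal (\<phi> x)"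
      using Q unfolding \<phi>_def by (cases "Phi0 \<rho> x"; auto simp: top_unique)+
    have \<phi>0: "0 < \<phi> x" using b(1) Q by (smt (verit) divide_pos_pos)
    have "ln (\<phi> x) \<le> ln Q" using b \<phi>0 by simp
    moreover have "ln (1 / Q) \<le> ln (\<phi> x)" using b \<phi>0 Q by (subst ln_le_cancel_iff) auto
    then have "- ln (\<phi> x) \<le> ln Q" using Q by (simp add: ln_div)
    ultimately have "\<bar>ln (\<phi> x)\<bar> \<le> ln Q" by (rule abs_leI)
    also have "\<dots> = ln C + (\<bar>\<alpha>\<bar> + \<bar>\<beta>\<bar>) * \<bar>ln x\<bar>" using C by (simp add: Q_def ln_mult)
    also have "\<dots> \<le> K * (1 + \<bar>ln x\<bar>)" using C by (simp add: K_def algebra_simps)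
    finally have "\<bar>ln (\<phi> x)\<bar> \<le> K * (1 + \<bar>ln x\<bar>)" .
    with \<phi>0 b(3) show ?thesis by blast
  qed
  then show ?thesis using that K by blast
qed

lemma \<phi>_pos: "0 < x \<Longrightarrow> 0 < \<phi> x" and Phi0_\<phi>: "0 < x \<Longrightarrow> Phi0 \<rho> x = ennreal (\<phi> x)"
  using Phi0_bounds by metis+

text \<open>Split \<open>\<rho>(x z y) / \<rho>(y)\<close> at \<open>\<rho>(z y)\<close> and note that \<open>z y\<close> tends to \<open>0\<close> from the right together with \<open>y\<close>.\<close>

lemma \<phi>_submult:
  assumes x: "0 < x" and z: "0 < z"
  shows "\<phi> (x * z) \<le> \<phi> x * \<phi> z"
proof -
  have less: "\<forall>\<^sub>F y in at_right 0. r (x * y) / r y < \<phi> x + e" if x: "0 < x" and e: "0 < e" for x e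
  proof -
    have "Phi0 \<rho> x < ennreal (\<phi> x + e)" using Phi0_\<phi>[OF x] \<phi>_pos[OF x] e by (simp add: ennreal_lessI)
    then have "\<forall>\<^sub>F y in at_right 0. \<rho> (x * y) / \<rho> y < ennreal (\<phi> x + e)" unfolding Phi0_def by (rule Limsup_lessD)
    then show ?thesis using eventually_ratio[OF x]
    proof eventually_elim
      fix y assume "\<rho> (x * y) / \<rho> y < ennreal (\<phi> x + e)" and y: "0 < y \<and> y \<le> L \<and> x * y \<le> L \<and> \<rho> (x * y) / \<rho> y = ennreal (r (x * y) / r y)"
      moreover have "0 < r (x * y) / r y" using y x r_pos[of y] r_pos[of "x * y"] by simp
      ultimately show "r (x * y) / r y < \<phi> x + e" by (simp add: ennreal_less_iff)
    qed
  qed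
  have bound: "\<phi> (x * z) \<le> (\<phi> x + e) * (\<phi> z + e)" if e: "0 < e" for e
  proof -
    have fl: "filterlim (\<lambda>y. z * y) (at_right 0) (at_right 0)"
      using filtermap_times_pos_at_right[OF z, of 0] by (simp add: filterlim_def)
    have "\<forall>\<^sub>F y in at_right 0. r (x * (z * y)) / r (z * y) < \<phi> x + e"
      using eventually_compose_filterlim[OF less[OF x e] fl] .
    then have "\<forall>\<^sub>F y in at_right 0. r ((x * z) * y) / r y \<le> (\<phi> x + e) * (\<phi> z + e)"
      using less[OF z e] eventually_ratio[OF z] eventually_ratio[OF mult_pos_pos[OF x z]]
    proof eventually_elim
      case (elim y)
      have p: "0 < r (z * y)" "0 < r y" "0 < r (x * z * y)"
        using elim x z r_pos[of "z * y"] r_pos[of y] r_pos[of "x * z * y"] by auto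
      have "r ((x * z) * y) / r y = r (x * (z * y)) / r (z * y) * (r (z * y) / r y)" using p by (simp add: mult.assoc)
      also have "\<dots> \<le> (\<phi> x + e) * (\<phi> z + e)" using elim p \<phi>_pos[OF x] \<phi>_pos[OF z] e by (intro mult_mono) (auto simp: mult.assoc)
      finally show ?case .
    qed
    then have "Phi0 \<rho> (x * z) \<le> ennreal ((\<phi> x + e) * (\<phi> z + e))" using x z by (intro Phi0_le) auto
    moreover have "0 \<le> (\<phi> x + e) * (\<phi> z + e)" using \<phi>_pos[OF x] \<phi>_pos[OF z] e by simp
    ultimately show ?thesis using Phi0_\<phi>[of "x * z"] x z by simp
  qed
  have "((\<lambda>e. (\<phi> x + e) * (\<phi> z + e)) \<longlongrightarrow> (\<phi> x + 0) * (\<phi> z + 0)) (at_right 0)" by (intro tendsto_intros)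
  then have "\<phi> (x * z) \<le> (\<phi> x + 0) * (\<phi> z + 0)"
  proof (rule tendsto_lowerbound)
    show "\<forall>\<^sub>F e in at_right 0. \<phi> (x * z) \<le> (\<phi> x + e) * (\<phi> z + e)"
      using bound by (auto simp: eventually_at_right_field intro!: exI[of _ 1])
  qed simp
  then show ?thesis by simp
qed

text \<open>The sign \<open>c\<close> treats the behaviour of \<open>\<phi>\<close> at infinity and at \<open>0\<close> together.\<close>

lemma fekete_\<phi>:
  assumes c: "c = 1 \<or> c = - 1"
  shows "\<exists>l. ((\<lambda>s. ln (\<phi> (exp (c * s))) / s) \<longlongrightarrow> l) at_top"
proof -
  obtain K where K: "0 \<le> K" "\<And>x. 0 < x \<Longrightarrow> \<bar>ln (\<phi> x)\<bar> \<le> K * (1 + \<bar>ln x\<bar>)" using Phi0_bounds by metis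
  show ?thesis
  proof (rule fekete_continuous)
    fix s t :: real assume "0 < s" "0 < t"
    have p: "0 < \<phi> (exp (c * s))" "0 < \<phi> (exp (c * t))" by (auto intro: \<phi>_pos)
    have "\<phi> (exp (c * s) * exp (c * t)) \<le> \<phi> (exp (c * s)) * \<phi> (exp (c * t))" by (rule \<phi>_submult) auto
    then have "ln (\<phi> (exp (c * s) * exp (c * t))) \<le> ln (\<phi> (exp (c * s)) * \<phi> (exp (c * t)))" by (simp add: \<phi>_pos)
    then show "ln (\<phi> (exp (c * (s + t)))) \<le> ln (\<phi> (exp (c * s))) + ln (\<phi> (exp (c * t)))"
      using p by (simp add: ln_mult distrib_left exp_add)
  next
    fix s :: real assume "0 < s"
    then show "\<bar>ln (\<phi> (exp (c * s)))\<bar> \<le> K * (1 + s)" using K(2)[of "exp (c * s)"] c by (auto simp: abs_mult)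
  qed
qed

lemma mo_upper_lim: "((\<lambda>x. ln (\<phi> x) / ln x) \<longlongrightarrow> mo_upper \<rho>) at_top"
proof -
  obtain l where l: "((\<lambda>s. ln (\<phi> (exp (1 * s))) / s) \<longlongrightarrow> l) at_top" using fekete_\<phi>[of 1] by blast
  have "((\<lambda>x. ln (\<phi> (exp (1 * ln x))) / ln x) \<longlongrightarrow> l) at_top" by (rule filterlim_compose[OF l ln_at_top])
  then have lim: "((\<lambda>x. ln (\<phi> x) / ln x) \<longlongrightarrow> l) at_top"
    by (rule Lim_transform_eventually) (use eventually_gt_at_top[of 0] in eventually_elim, auto)
  then show ?thesis unfolding mo_upper_def \<phi>_def[symmetric] using tendsto_Lim[OF _ lim] by simp
qed

lemma mo_lower_lim: "((\<lambda>x. ln (\<phi> x) / ln x) \<longlongrightarrow> mo_lower \<rho>) (at_right 0)"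
proof -
  obtain l where l: "((\<lambda>s. ln (\<phi> (exp (- 1 * s))) / s) \<longlongrightarrow> l) at_top" using fekete_\<phi>[of "- 1"] by blast
  have fl: "filterlim (\<lambda>x. - ln x) at_top (at_right (0::real))"
    using ln_at_0 by (simp add: filterlim_uminus_at_bot)
  have "((\<lambda>x. - (ln (\<phi> (exp (- 1 * (- ln x)))) / (- ln x))) \<longlongrightarrow> - l) (at_right 0)"
    by (intro tendsto_minus filterlim_compose[OF l fl])
  then have lim: "((\<lambda>x. ln (\<phi> x) / ln x) \<longlongrightarrow> - l) (at_right 0)"
    by (rule Lim_transform_eventually) (use eventually_at_right_less[of 0] in eventually_elim, auto)
  then show ?thesis unfolding mo_lower_def \<phi>_def[symmetric] using tendsto_Lim[OF _ lim] by simp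
qed

lemma \<phi>_le_powr:
  assumes x: "0 < x" and \<delta>: "0 < \<delta>" and C: "0 < C"
    and le: "\<And>y. 0 < y \<Longrightarrow> y < \<delta> \<Longrightarrow> r (x * y) * (x * y) powr c \<le> C * (r y * y powr c)"
  shows "ln (\<phi> x) \<le> ln C - c * ln x"
proof -
  have "Phi0 \<rho> x \<le> ennreal (C * x powr (- c))"
  proof (rule Phi0_le[OF x])
    have "\<forall>\<^sub>F y in at_right 0. y \<in> {0<..<\<delta>}" by (rule eventually_at_right_real[OF \<delta>])
    then show "\<forall>\<^sub>F y in at_right 0. r (x * y) / r y \<le> C * x powr (- c)"
      using eventually_ratio[OF x]
    proof eventually_elim
      case (elim y)
      then have y: "0 < y" "y < \<delta>" "y \<le> L" by auto
      have "r (x * y) * x powr c * y powr c \<le> C * r y * y powr c"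
        using le[of y] y x by (simp add: powr_mult mult_ac)
      then have "r (x * y) * x powr c \<le> C * r y" using y by (simp add: mult_le_cancel_right)
      then show ?case using r_pos[of y] y x by (simp add: powr_minus field_simps)
    qed
  qed
  then have "\<phi> x \<le> C * x powr (- c)" using Phi0_\<phi>[OF x] C by simp
  then have "ln (\<phi> x) \<le> ln (C * x powr (- c))" using \<phi>_pos[OF x] C x by (subst ln_le_cancel_iff) auto
  also have "\<dots> = ln C - c * ln x" using C x by (simp add: ln_mult ln_powr)
  finally show ?thesis .
qed

text \<open>A power bound on \<open>\<rho>\<close> along pairs \<open>8 y \<le> R\<close> bounds \<open>\<phi>\<close> on \<open>(0, 1/8)\<close> by a constant times a power,
and constants disappear after division by \<open>ln x\<close>.\<close>

lemma mo_lower_ge: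
  assumes \<delta>: "0 < \<delta>" and C: "0 < C"
    and le: "\<And>y R. 0 < y \<Longrightarrow> 8 * y \<le> R \<Longrightarrow> R < \<delta> \<Longrightarrow> r y * y powr c \<le> C * (r R * R powr c)"
  shows "- c \<le> mo_lower \<rho>"
proof (rule tendsto_le[OF _ mo_lower_lim])
  show "((\<lambda>x. ln C / ln x - c) \<longlongrightarrow> - c) (at_right 0)"
  proof -
    have "((\<lambda>x. ln C / ln x - c) \<longlongrightarrow> 0 - c) (at_right 0)"
      by (intro tendsto_intros tendsto_divide_0[OF tendsto_const] filterlim_at_bot_imp_at_infinity ln_at_0)
    then show ?thesis by simp
  qed
  have "\<forall>\<^sub>F x in at_right 0. x \<in> {0<..<1/8::real}" by (rule eventually_at_right_real) simp
  then show "\<forall>\<^sub>F x in at_right 0. ln C / ln x - c \<le> ln (\<phi> x) / ln x"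
  proof eventually_elim
    case (elim x)
    have "ln (\<phi> x) \<le> ln C - c * ln x"
      by (rule \<phi>_le_powr[OF _ \<delta> C]) (use elim in \<open>auto intro!: le\<close>)
    moreover have "ln x < 0" using elim by simp
    ultimately have "(ln C - c * ln x) / ln x \<le> ln (\<phi> x) / ln x" by (intro divide_right_mono_neg) auto
    then show ?case using \<open>ln x < 0\<close> by (simp add: diff_divide_distrib)
  qed
qed simp

lemma mo_upper_le:
  assumes \<delta>: "0 < \<delta>" and C: "0 < C"
    and le: "\<And>y R. 0 < y \<Longrightarrow> 8 * y \<le> R \<Longrightarrow> R < \<delta> \<Longrightarrow> r R * R powr c \<le> C * (r y * y powr c)"
  shows "mo_upper \<rho> \<le> - c"
proof (rule tendsto_le[OF _ _ mo_upper_lim])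
  show "((\<lambda>x. ln C / ln x - c) \<longlongrightarrow> - c) at_top"
  proof -
    have "((\<lambda>x. ln C / ln x - c) \<longlongrightarrow> 0 - c) at_top"
      by (intro tendsto_intros tendsto_divide_0[OF tendsto_const] filterlim_at_top_imp_at_infinity ln_at_top)
    then show ?thesis by simp
  qed
  show "\<forall>\<^sub>F x in at_top. ln (\<phi> x) / ln x \<le> ln C / ln x - c"
  proof (rule eventually_at_top_linorderI[of 8])
    fix x :: real assume x: "8 \<le> x"
    have "ln (\<phi> x) \<le> ln C - c * ln x"
    proof (rule \<phi>_le_powr[of _ "\<delta> / x"])
      fix y assume "0 < y" "y < \<delta> / x"
      then show "r (x * y) * (x * y) powr c \<le> C * (r y * y powr c)" using x by (intro le) (auto simp: field_simps)
    qed (use x \<delta> C in auto)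
    moreover have "0 < ln x" using x by simp
    ultimately have "ln (\<phi> x) / ln x \<le> (ln C - c * ln x) / ln x" by (intro divide_right_mono) auto
    then show "ln (\<phi> x) / ln x \<le> ln C / ln x - c" using \<open>0 < ln x\<close> by (simp add: diff_divide_distrib)
  qed
qed simp

end

section \<open>Products of oscillating weights\<close>

locale product_weight = rect_arc +
  fixes p :: "complex \<Rightarrow> real" and A :: real and n :: nat and t :: "nat \<Rightarrow> complex"
    and wk :: "nat \<Rightarrow> real \<Rightarrow> ennreal" and w :: "complex \<Rightarrow> ennreal"
  assumes p_gt1: "\<forall>\<tau>\<in>path_image g. 1 < p \<tau>"
    and A_pos: "A > 0"
    and log_hoelder: "\<forall>\<tau>\<in>path_image g. \<forall>s\<in>path_image g. cmod (\<tau> - s) \<le> 1/2 \<longrightarrow>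
          \<bar>p \<tau> - p s\<bar> \<le> - A / ln (cmod (\<tau> - s))"
    and t_mem: "\<forall>k\<in>{1..n}. t k \<in> path_image g"
    and t_inj: "inj_on t {1..n}"
    and wk_class: "\<forall>k\<in>{1..n}. wk k \<in> class_WW (curve_length g)"
    and w_eq: "\<forall>\<tau>\<in>path_image g. w \<tau> = (\<Prod>k=1..n. wk k (cmod (\<tau> - t k)))"
begin

definition rk :: "nat \<Rightarrow> real \<Rightarrow> real" where "rk k x = enn2real (wk k x)"
definition real_weight :: "complex \<Rightarrow> real" where "real_weight \<tau> = (\<Prod>k=1..n. rk k (cmod (\<tau> - t k)))"

lemma WWk: "k \<in> {1..n} \<Longrightarrow> WW_weight (wk k) len"
  using wk_class len_pos by unfold_locales (auto simp: len_unfold)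

lemma rk_pos: "k \<in> {1..n} \<Longrightarrow> 0 < x \<Longrightarrow> x \<le> len \<Longrightarrow> 0 < rk k x"
  using WW_weight.r_pos[OF WWk] WW_weight.r_def[OF WWk] by (simp add: rk_def)

lemma wk_rk: "k \<in> {1..n} \<Longrightarrow> 0 < x \<Longrightarrow> x \<le> len \<Longrightarrow> wk k x = ennreal (rk k x)"
  using WW_weight.\<rho>_r[OF WWk] WW_weight.r_def[OF WWk] by (simp add: rk_def)

lemma dist_le_len: "\<tau> \<in> \<Gamma> \<Longrightarrow> s \<in> \<Gamma> \<Longrightarrow> cmod (\<tau> - s) \<le> len"
proof -
  assume "\<tau> \<in> \<Gamma>" "s \<in> \<Gamma>"
  then obtain a b where "a \<in> {0..len}" "\<gamma> a = \<tau>" "b \<in> {0..len}" "\<gamma> b = s" using \<gamma>_image by (metis imageE)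
  then show ?thesis using \<gamma>_lipschitz[of a b] by auto
qed

lemma rk_dist_cont:
  assumes k: "k \<in> {1..n}"
  shows "continuous_on (\<Gamma> - {t k}) (\<lambda>\<tau>. rk k (cmod (\<tau> - t k)))"
proof -
  have "wk k \<in> class_WW len" using wk_class k by (auto simp: len_unfold)
  then have c: "continuous_on {0<..len} (rk k)"
    unfolding rk_def[abs_def] by (metis class_WW_real)
  show ?thesis
    by (rule continuous_on_compose2[OF c])
       (use k t_mem dist_le_len in \<open>auto intro!: continuous_intros\<close>)
qed

lemma weighted: "0 < \<theta> \<Longrightarrow> weighted_arc g p (\<lambda>\<tau>. epowr (w \<tau>) \<theta>) (\<lambda>\<tau>. real_weight \<tau> powr \<theta>) (t ` {1..n})"
proof unfold_locales
  assume \<theta>: "0 < \<theta>"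
  have pos: "0 < rk k (cmod (\<tau> - t k))" "wk k (cmod (\<tau> - t k)) = ennreal (rk k (cmod (\<tau> - t k)))"
    if "\<tau> \<in> \<Gamma> - t ` {1..n}" "k \<in> {1..n}" for \<tau> k
  proof -
    have "0 < cmod (\<tau> - t k)" "cmod (\<tau> - t k) \<le> len" using that t_mem dist_le_len by auto
    then show "0 < rk k (cmod (\<tau> - t k))" "wk k (cmod (\<tau> - t k)) = ennreal (rk k (cmod (\<tau> - t k)))"
      using rk_pos wk_rk that by auto
  qed
  show "\<forall>\<tau>\<in>\<Gamma>. 1 < p \<tau>" by (rule p_gt1)
  show "finite (t ` {1..n})" by simp
  have real_weight_pos: "0 < real_weight \<tau>" if "\<tau> \<in> \<Gamma> - t ` {1..n}" for \<tau>
    unfolding real_weight_def using pos[OF that] by (intro prod_pos) auto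
  have c: "continuous_on (\<Gamma> - t ` {1..n}) real_weight"
    unfolding real_weight_def[abs_def]
    by (intro continuous_on_prod continuous_on_subset[OF rk_dist_cont]) auto
  show "continuous_on (\<Gamma> - t ` {1..n}) (\<lambda>\<tau>. real_weight \<tau> powr \<theta>)"
    using real_weight_pos by (intro continuous_on_powr c continuous_on_const) force
  fix \<tau> assume \<tau>: "\<tau> \<in> \<Gamma> - t ` {1..n}"
  show "0 < real_weight \<tau> powr \<theta>" using real_weight_pos[OF \<tau>] by simp
  have "w \<tau> = (\<Prod>k=1..n. ennreal (rk k (cmod (\<tau> - t k))))"
    using w_eq \<tau> pos(2)[OF \<tau>] by auto
  also have "\<dots> = ennreal (real_weight \<tau>)"
    unfolding real_weight_def using pos(1)[OF \<tau>] by (intro prod_ennreal) (auto intro: less_imp_le)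
  finally show "epowr (w \<tau>) \<theta> = ennreal (real_weight \<tau> powr \<theta>)"
    using \<theta> real_weight_pos[OF \<tau>] by (simp add: epowr_ennreal)
qed

text \<open>Near \<open>t j\<close> the factors with other indices are continuous and positive, hence bounded above and below,
and the factor with index \<open>j\<close> varies by a bounded factor over an annulus because \<open>wk j\<close> is
almost monotone up to powers.\<close>

lemma real_weight_local:
  assumes j: "j \<in> {1..n}"
  obtains \<delta> H where "0 < \<delta>" "1 \<le> H" "\<delta> \<le> len"
    "\<And>R \<tau>. 0 < R \<Longrightarrow> R < \<delta> \<Longrightarrow> \<tau> \<in> annulus (t j) R \<Longrightarrow> \<tau> \<notin> t ` {1..n} \<and> rk j R / H \<le> real_weight \<tau> \<and> real_weight \<tau> \<le> H * rk j R"
proof -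
  let ?J = "{1..n} - {j}"
  have tj: "t j \<in> \<Gamma>" using t_mem j by auto
  have jk: "t j \<noteq> t k" if "k \<in> ?J" for k using inj_onD[OF t_inj, of j k] j that by auto
  define \<psi> where "\<psi> \<tau> = (\<Prod>k\<in>?J. rk k (cmod (\<tau> - t k)))" for \<tau>
  have real_weight: "real_weight \<tau> = rk j (cmod (\<tau> - t j)) * \<psi> \<tau>" for \<tau>
    unfolding real_weight_def \<psi>_def using j by (subst prod.remove[of _ j]) auto
  have \<psi>c: "continuous_on (\<Gamma> - t ` ?J) \<psi>"
    unfolding \<psi>_def[abs_def] by (intro continuous_on_prod continuous_on_subset[OF rk_dist_cont]) auto
  have \<psi>0: "0 < \<psi> (t j)" unfolding \<psi>_def
  proof (rule prod_pos)
    fix k assume k: "k \<in> ?J"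
    then show "0 < rk k (cmod (t j - t k))" using jk[OF k] dist_le_len[OF tj] t_mem by (intro rk_pos) auto
  qed
  have "t j \<in> \<Gamma> - t ` ?J" using tj jk by blast
  then obtain d1 where d1: "0 < d1" "\<And>\<tau>. \<tau> \<in> \<Gamma> - t ` ?J \<Longrightarrow> dist \<tau> (t j) < d1 \<Longrightarrow> dist (\<psi> \<tau>) (\<psi> (t j)) < \<psi> (t j) / 2"
    using \<psi>c \<psi>0 unfolding continuous_on_iff by (meson half_gt_zero)
  obtain d2 where d2: "0 < d2" "\<And>x. x \<in> t ` ?J \<Longrightarrow> x \<noteq> t j \<Longrightarrow> d2 \<le> dist (t j) x"
    using finite_set_avoid[of "t ` ?J" "t j"] by auto
  have "wk j \<in> class_WW len" using wk_class j by (auto simp: len_unfold)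
  then obtain C \<alpha> \<beta> where C: "1 \<le> C"
    and up: "\<And>x y. 0 < x \<Longrightarrow> x \<le> y \<Longrightarrow> y \<le> len \<Longrightarrow> rk j x \<le> C * (y / x) powr \<alpha> * rk j y"
    and dn: "\<And>x y. 0 < x \<Longrightarrow> x \<le> y \<Longrightarrow> y \<le> len \<Longrightarrow> rk j y \<le> C * (y / x) powr \<beta> * rk j x"
    unfolding rk_def by (metis class_WW_real)
  \<comment> \<open>\<open>B\<close> bounds the variation of \<open>rk j\<close> over an annulus, where radii differ by a factor below \<open>2\<close>; the
    other factors lie between \<open>\<psi> (t j) / 2\<close> and \<open>2 * \<psi> (t j)\<close>.\<close>
  define B where "B = C * 2 powr max 0 (max \<alpha> \<beta>)"
  have B: "0 < B" using C by (simp add: B_def)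
  define H where "H = max 1 (max (2 * B * \<psi> (t j)) (2 * B / \<psi> (t j)))"
  have H: "1 \<le> H" "2 * B * \<psi> (t j) \<le> H" "2 * B / \<psi> (t j) \<le> H" by (auto simp: H_def)
  define \<delta> where "\<delta> = min len (min (d1 / 2) (d2 / 2))"
  show ?thesis
  proof (rule that[of \<delta> H])
    show "0 < \<delta>" "\<delta> \<le> len" "1 \<le> H" using len_pos d1 d2 H by (auto simp: \<delta>_def)
    fix R \<tau> assume R: "0 < R" "R < \<delta>" and \<tau>: "\<tau> \<in> annulus (t j) R"
    let ?x = "cmod (\<tau> - t j)"
    have x: "\<tau> \<in> \<Gamma>" "R \<le> ?x" "?x < 2 * R" "?x \<le> len" using \<tau> dist_le_len tj by (auto simp: annulus_def)
    have nJ: "\<tau> \<notin> t ` ?J"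
    proof
      assume a: "\<tau> \<in> t ` ?J"
      then have "d2 \<le> dist (t j) \<tau>" using x R by (intro d2(2)) auto
      then show False using x R by (simp add: \<delta>_def dist_norm norm_minus_commute)
    qed
    moreover have "\<tau> \<noteq> t j" using x R by auto
    ultimately have nT: "\<tau> \<notin> t ` {1..n}" by auto
    have "dist (\<psi> \<tau>) (\<psi> (t j)) < \<psi> (t j) / 2"
      using x R nJ by (intro d1(2)) (auto simp: \<delta>_def dist_norm)
    then have \<psi>b: "\<psi> (t j) / 2 \<le> \<psi> \<tau>" "\<psi> \<tau> \<le> 2 * \<psi> (t j)" unfolding dist_real_def by linarith+
    have rp: "0 < rk j R" "0 < rk j ?x" 
      using R x by (auto intro!: rk_pos[OF j] simp: \<delta>_def simp del: zero_less_norm_iff)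
    have pw: "(?x / R) powr e \<le> 2 powr max 0 (max \<alpha> \<beta>)" if "e \<le> max \<alpha> \<beta>" for e
    proof -
      have "(?x / R) powr e \<le> (?x / R) powr max 0 (max \<alpha> \<beta>)" using x R that by (intro powr_mono) auto
      also have "\<dots> \<le> 2 powr max 0 (max \<alpha> \<beta>)" using x R by (intro powr_mono2) (auto simp: divide_le_eq)
      finally show ?thesis .
    qed
    have b1: "rk j R \<le> B * rk j ?x"
      by (rule order.trans[OF up[OF R(1) x(2,4)]]) (use pw[of \<alpha>] rp C in \<open>auto simp: B_def intro!: mult_right_mono mult_left_mono\<close>)
    have b2: "rk j ?x \<le> B * rk j R"
      by (rule order.trans[OF dn[OF R(1) x(2,4)]]) (use pw[of \<beta>] rp C in \<open>auto simp: B_def intro!: mult_right_mono mult_left_mono\<close>)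
    have "real_weight \<tau> \<le> (B * rk j R) * (2 * \<psi> (t j))" unfolding real_weight
      using b2 \<psi>b \<psi>0 B rp by (intro mult_mono) auto
    also have "\<dots> = (2 * B * \<psi> (t j)) * rk j R" by simp
    also have "\<dots> \<le> H * rk j R" using H(2) rp by (intro mult_right_mono) auto
    finally have up1: "real_weight \<tau> \<le> H * rk j R" .
    have "rk j R \<le> (B * rk j ?x) * (\<psi> \<tau> / (\<psi> (t j) / 2))"
    proof -
      have "1 \<le> \<psi> \<tau> / (\<psi> (t j) / 2)" using \<psi>b \<psi>0 by (simp add: le_divide_eq)
      then have "(B * rk j ?x) * 1 \<le> (B * rk j ?x) * (\<psi> \<tau> / (\<psi> (t j) / 2))" using B rp by (intro mult_left_mono) auto
      then show ?thesis using b1 by linarith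
    qed
    also have "\<dots> = (2 * B / \<psi> (t j)) * real_weight \<tau>" unfolding real_weight by simp
    also have "\<dots> \<le> H * real_weight \<tau>" unfolding real_weight using H(3) rp \<psi>b \<psi>0 by (intro mult_right_mono mult_nonneg_nonneg) auto
    finally have "rk j R / H \<le> real_weight \<tau>" using H(1) by (simp add: divide_le_eq mult.commute)
    then show "\<tau> \<notin> t ` {1..n} \<and> rk j R / H \<le> real_weight \<tau> \<and> real_weight \<tau> \<le> H * rk j R" using nT up1 by blast
  qed
qed

text \<open>The scaling of the weight raised to the power \<open>\<theta>\<close> is a bound on the \<open>\<theta>\<close>-th power of \<open>rk j\<close>; taking
\<open>\<theta>\<close>-th roots leaves \<open>\<theta>\<close> only in the exponents of the radii.\<close>

lemma index_bounds:
  assumes \<theta>: "0 < \<theta>" and S: "S_bounded g p (\<lambda>\<tau>. epowr (w \<tau>) \<theta>)" and j: "j \<in> {1..n}"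
  shows "0 \<le> 1 / p (t j) + \<theta> * mo_lower (wk j)" "1 / p (t j) + \<theta> * mo_upper (wk j) \<le> 1"
proof -
  interpret wa: weighted_arc g p "\<lambda>\<tau>. epowr (w \<tau>) \<theta>" "\<lambda>\<tau>. real_weight \<tau> powr \<theta>" "t ` {1..n}" by (rule weighted[OF \<theta>])
  interpret ww: WW_weight "wk j" len by (rule WWk[OF j])
  have r_rk: "ww.r x = rk j x" for x by (simp add: ww.r_def rk_def)
  have tj: "t j \<in> \<Gamma>" using t_mem j by auto
  define a where "a = 1 / p (t j)"
  obtain \<delta>0 H where \<delta>0: "0 < \<delta>0" "\<delta>0 \<le> len" and H: "1 \<le> H" and loc:
    "\<And>R \<tau>. 0 < R \<Longrightarrow> R < \<delta>0 \<Longrightarrow> \<tau> \<in> annulus (t j) R \<Longrightarrow> \<tau> \<notin> t ` {1..n} \<and> rk j R / H \<le> real_weight \<tau> \<and> real_weight \<tau> \<le> H * rk j R"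
    using real_weight_local[OF j] by metis
  have rp: "0 < rk j R" if "0 < R" "R < \<delta>0" for R using rk_pos[OF j] that \<delta>0 by auto
  have "\<exists>C>0. \<exists>\<delta>>0. \<forall>r R. 0 < r \<and> 8 * r \<le> R \<and> R < \<delta> \<longrightarrow>
     rk j r powr \<theta> * r powr (1 / p (t j)) \<le> C * (rk j R powr \<theta> * R powr (1 / p (t j))) \<and>
     rk j R powr \<theta> * R powr (1 / p (t j)) * r \<le> C * (rk j r powr \<theta> * r powr (1 / p (t j))) * R"
  proof (rule wa.local_scaling[OF S A_pos log_hoelder tj \<delta>0(1), of "H powr \<theta>"])
    show "1 \<le> H powr \<theta>" using H \<theta> by (simp add: ge_one_powr_ge_zero)
    show "0 < rk j R powr \<theta>" if "0 < R" "R < \<delta>0" for R using rp[OF that] by simp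
    fix R \<tau> assume R: "0 < R" "R < \<delta>0" "\<tau> \<in> annulus (t j) R"
    note l = loc[OF R]
    have "(rk j R / H) powr \<theta> \<le> real_weight \<tau> powr \<theta>" using l rp[OF R(1,2)] H \<theta> by (intro powr_mono2) auto
    moreover have "real_weight \<tau> powr \<theta> \<le> (H * rk j R) powr \<theta>"
      using l rp[OF R(1,2)] H \<theta> by (intro powr_mono2) (auto intro: order.trans[of 0 "rk j R / H"])
    ultimately show "\<tau> \<notin> t ` {1..n} \<and> rk j R powr \<theta> / H powr \<theta> \<le> real_weight \<tau> powr \<theta> \<and> real_weight \<tau> powr \<theta> \<le> H powr \<theta> * rk j R powr \<theta>"
      using l rp[OF R(1,2)] H by (simp add: powr_mult powr_divide)
  qed
  then obtain C \<delta>1 where C: "0 < C" and \<delta>1: "0 < \<delta>1" and sc: "\<And>r R. 0 < r \<Longrightarrow> 8 * r \<le> R \<Longrightarrow> R < \<delta>1 \<Longrightarrow>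
     rk j r powr \<theta> * r powr a \<le> C * (rk j R powr \<theta> * R powr a) \<and>
     rk j R powr \<theta> * R powr a * r \<le> C * (rk j r powr \<theta> * r powr a) * R" unfolding a_def by blast
  define \<delta> where "\<delta> = min \<delta>0 \<delta>1"
  have \<delta>: "0 < \<delta>" using \<delta>0 \<delta>1 by (simp add: \<delta>_def)
  have root: "x * y powr (c / \<theta>) \<le> C powr (1 / \<theta>) * (x' * y' powr (c / \<theta>))"
    if "0 < x" "0 < y" "0 < x'" "0 < y'" "x powr \<theta> * y powr c \<le> C * (x' powr \<theta> * y' powr c)" for x y x' y' c
  proof -
    have "(x powr \<theta> * y powr c) powr (1 / \<theta>) \<le> (C * (x' powr \<theta> * y' powr c)) powr (1 / \<theta>)"
      using that \<theta> by (intro powr_mono2) auto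
    then show ?thesis using that \<theta> C by (simp add: powr_mult powr_powr)
  qed
  have "- (a / \<theta>) \<le> mo_lower (wk j)"
  proof (rule ww.mo_lower_ge[OF \<delta>])
    show "0 < C powr (1 / \<theta>)" using C by simp
    fix y R assume yR: "0 < y" "8 * y \<le> R" "R < \<delta>"
    then have "0 < rk j y" "0 < rk j R" by (auto intro!: rp simp: \<delta>_def)
    then show "ww.r y * y powr (a / \<theta>) \<le> C powr (1 / \<theta>) * (ww.r R * R powr (a / \<theta>))"
      unfolding r_rk using sc[of y R] yR by (intro root) (auto simp: \<delta>_def)
  qed
  then show "0 \<le> 1 / p (t j) + \<theta> * mo_lower (wk j)" using \<theta> by (simp add: a_def[symmetric] field_simps)
  have "mo_upper (wk j) \<le> - ((a - 1) / \<theta>)"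
  proof (rule ww.mo_upper_le[OF \<delta>])
    show "0 < C powr (1 / \<theta>)" using C by simp
    fix y R assume yR: "0 < y" "8 * y \<le> R" "R < \<delta>"
    then have p: "0 < rk j y" "0 < rk j R" by (auto intro!: rp simp: \<delta>_def)
    have "rk j R powr \<theta> * R powr a * y \<le> C * (rk j y powr \<theta> * y powr a) * R"
      using sc[of y R] yR by (auto simp: \<delta>_def)
    then have "rk j R powr \<theta> * R powr (a - 1) \<le> C * (rk j y powr \<theta> * y powr (a - 1))"
      using yR by (simp add: powr_diff field_simps)
    then show "ww.r R * R powr ((a - 1) / \<theta>) \<le> C powr (1 / \<theta>) * (ww.r y * y powr ((a - 1) / \<theta>))"
      unfolding r_rk using p yR by (intro root) auto
  qed
  then show "1 / p (t j) + \<theta> * mo_upper (wk j) \<le> 1" using \<theta> by (simp add: a_def[symmetric] field_simps)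
qed

lemma epowr_1: "epowr x 1 = x" by (cases x) (auto simp: epowr_def)

lemma carleson_of_bounded: assumes S: "S_bounded g p w" shows "carleson_curve g"
proof -
  interpret wa: weighted_arc g p "\<lambda>\<tau>. epowr (w \<tau>) 1" "\<lambda>\<tau>. real_weight \<tau> powr 1" "t ` {1..n}" by (rule weighted) simp
  show ?thesis using wa.carleson S by (simp add: epowr_1)
qed

end

theorem theorem1p3:
  fixes g :: "real \<Rightarrow> complex" and p :: "complex \<Rightarrow> real" and A :: real
    and n :: nat and t :: "nat \<Rightarrow> complex" and wk :: "nat \<Rightarrow> real \<Rightarrow> ennreal"
    and w :: "complex \<Rightarrow> ennreal"
  assumes curve: "rectifiable_arc g"
    and p_cont: "continuous_on (path_image g) p"
    and p_gt1: "\<forall>\<tau>\<in>path_image g. 1 < p \<tau>"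
    and A_pos: "A > 0"
    and log_hoelder: "\<forall>\<tau>\<in>path_image g. \<forall>s\<in>path_image g. cmod (\<tau> - s) \<le> 1/2 \<longrightarrow>
          \<bar>p \<tau> - p s\<bar> \<le> - A / ln (cmod (\<tau> - s))"
    and t_mem: "\<forall>k\<in>{1..n}. t k \<in> path_image g"
    and t_inj: "inj_on t {1..n}"
    and wk_class: "\<forall>k\<in>{1..n}. wk k \<in> class_WW (curve_length g)"
    and w_eq: "\<forall>\<tau>\<in>path_image g. w \<tau> = (\<Prod>k=1..n. wk k (cmod (\<tau> - t k)))"
  shows "(S_bounded g p w \<longrightarrow>
            carleson_curve g \<and>
            (\<forall>k\<in>{1..n}. 0 \<le> 1 / p (t k) + mo_lower (wk k) \<and>
                         1 / p (t k) + mo_upper (wk k) \<le> 1)) \<and>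
         ((\<exists>\<epsilon>0>0. \<forall>\<epsilon>\<in>{-\<epsilon>0<..<\<epsilon>0}. S_bounded g p (\<lambda>\<tau>. epowr (w \<tau>) (1 + \<epsilon>))) \<longrightarrow>
            (\<forall>k\<in>{1..n}. 0 < 1 / p (t k) + mo_lower (wk k) \<and>
                         1 / p (t k) + mo_upper (wk k) < 1))"
proof -
  interpret product_weight g p A n t wk w
    using curve p_gt1 A_pos log_hoelder t_mem t_inj wk_class w_eq by unfold_locales
  show ?thesis
  proof (intro conjI impI ballI)
    assume S: "S_bounded g p w"
    then show "carleson_curve g" by (rule carleson_of_bounded)
    fix k assume k: "k \<in> {1..n}"
    have "S_bounded g p (\<lambda>\<tau>. epowr (w \<tau>) 1)" using S by (simp add: epowr_1)
    from index_bounds[OF zero_less_one this k]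
    show "0 \<le> 1 / p (t k) + mo_lower (wk k)" "1 / p (t k) + mo_upper (wk k) \<le> 1" by simp_all
  next
    assume "\<exists>\<epsilon>0>0. \<forall>\<epsilon>\<in>{-\<epsilon>0<..<\<epsilon>0}. S_bounded g p (\<lambda>\<tau>. epowr (w \<tau>) (1 + \<epsilon>))"
    then obtain \<epsilon>0 where \<epsilon>0: "0 < \<epsilon>0" "\<forall>\<epsilon>\<in>{-\<epsilon>0<..<\<epsilon>0}. S_bounded g p (\<lambda>\<tau>. epowr (w \<tau>) (1 + \<epsilon>))" by blast
    fix k assume k: "k \<in> {1..n}"
    \<comment> \<open>If equality held, the index would have the sign for which replacing \<open>w\<close> by its power
      \<open>1 + \<epsilon>\<close> pushes it beyond the non-strict bound; a positive \<open>\<epsilon>\<close> serves for both indices.\<close>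
    define \<epsilon> where "\<epsilon> = \<epsilon>0 / 2"
    have \<epsilon>: "0 < \<epsilon>" "S_bounded g p (\<lambda>\<tau>. epowr (w \<tau>) (1 + \<epsilon>))" using \<epsilon>0 by (auto simp: \<epsilon>_def)
    define a where "a = 1 / p (t k)"
    have "1 < p (t k)" using p_gt1 t_mem k by blast
    then have a: "0 < a" "a < 1" by (simp_all add: a_def)
    note bounds = index_bounds[of "1 + \<epsilon>", OF _ \<epsilon>(2) k, folded a_def]
    have m: "0 \<le> a + (1 + \<epsilon>) * mo_lower (wk k)" and M: "a + (1 + \<epsilon>) * mo_upper (wk k) \<le> 1"
      using bounds \<epsilon>(1) by simp_all
    show "0 < 1 / p (t k) + mo_lower (wk k)"
      unfolding a_def[symmetric]
    proof (rule ccontr)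
      assume "\<not> 0 < a + mo_lower (wk k)"
      moreover from this have "\<epsilon> * mo_lower (wk k) < 0" using \<epsilon>(1) a by (intro mult_pos_neg) linarith+
      ultimately show False using m by (simp add: distrib_right)
    qed
    show "1 / p (t k) + mo_upper (wk k) < 1"
      unfolding a_def[symmetric]
    proof (rule ccontr)
      assume "\<not> a + mo_upper (wk k) < 1"
      moreover from this have "0 < \<epsilon> * mo_upper (wk k)" using \<epsilon>(1) a by (intro mult_pos_pos) linarith+
      ultimately show False using M by (simp add: distrib_right)
    qed
  qed
qed

end
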